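(* Let $C\subset\mathbb{P}^2$ be a unicuspidal rational complex projective plane curve of degree $d$, with unique singular point $p$, and let $\Gamma_{(C,p)}\subset\mathbb{N}$ be the semigroup of the germ $(C,p)$. The following two conditions are equivalent: (1) (semigroup distribution property) for every integer $l>0$, the interval $((l-1)d,\,ld]$ contains exactly $\min\{l+1,d\}$ elements of $\Gamma_{(C,p)}$; (2) for every integer $l$ with $0\le l\le d-3$, every element $s\in\Gamma_{(C,p)}\cap[0,ld]$ is realized by a (possibly non-reduced) projective plane curve of degree $l$, i.e. there is a nonzero homogeneous polynomial $h\in\mathbb{C}[X,Y,Z]$ of degree $l$ such that the intersection multiplicity of $C$ and $\{h=0\}$ at $p$ equals $s$.
   Context: A unicuspidal rational plane curve is an irreducible rational curve $C\subset\mathbb{P}^2$ having exactly one singular point $p$, the germ $(C,p)$ being locally irreducible. $\mathbb{N}=\{0,1,2,\dots\}$. The semigroup $\Gamma_{(C,p)}\subset\mathbb{N}$ is the set of all (finite) intersection multiplicities $I_p(C,h)$ at $p$, where $h$ runs over germs of holomorphic functions at $p$ that do not vanish identically on $(C,p)$. Condition (1) is equivalent to the identity $$\sum_{k\in\Gamma_{(C,p)}}t^{\lceil k/d\rceil}=1+2t+\cdots+(d-1)t^{d-2}+d\,(t^{d-1}+t^d+t^{d+1}+\cdots).$$ *)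

theory Defs
  imports
    "HOL-Analysis.Analysis"
    "HOL-Computational_Algebra.Computational_Algebra"
begin

section \<open>Plane projective curves\<close>

text \<open>
  The ring \<open>\<complex>[X, Y, Z]\<close> is rendered as the iterated polynomial ring \<open>\<complex>[X][Y][Z]\<close>, the outermost
  variable being \<open>Z\<close>. Points of the projective plane are given by nonzero vectors of homogeneous
  coordinates.
\<close>

type_synonym poly3 = "complex poly poly poly"

definition coeff3 :: "poly3 \<Rightarrow> nat \<Rightarrow> nat \<Rightarrow> nat \<Rightarrow> complex" where
  "coeff3 h i j k = coeff (coeff (coeff h k) j) i"

definition eval3 :: "poly3 \<Rightarrow> complex^3 \<Rightarrow> complex" where
  "eval3 h q = poly (poly (poly h [:[:q $ 3:]:]) [:q $ 2:]) (q $ 1)"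

text \<open>As usual, the zero polynomial is homogeneous of every degree.\<close>

definition homogeneous :: "nat \<Rightarrow> poly3 \<Rightarrow> bool" where
  "homogeneous m h \<longleftrightarrow> (\<forall>i j k. coeff3 h i j k \<noteq> 0 \<longrightarrow> i + j + k = m)"

definition partial_X :: "poly3 \<Rightarrow> poly3" where
  "partial_X h = map_poly (map_poly pderiv) h"

definition partial_Y :: "poly3 \<Rightarrow> poly3" where
  "partial_Y h = map_poly pderiv h"

definition partial_Z :: "poly3 \<Rightarrow> poly3" where
  "partial_Z h = pderiv h"

definition singular_point :: "poly3 \<Rightarrow> complex^3 \<Rightarrow> bool" where
  "singular_point F q \<longleftrightarrow>
     q \<noteq> 0 \<and> eval3 F q = 0 \<and>
     eval3 (partial_X F) q = 0 \<and> eval3 (partial_Y F) q = 0 \<and> eval3 (partial_Z F) q = 0"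

text \<open>
  Birationality to the projective line: \<open>t \<mapsto> [a(t) : b(t) : c(t)]\<close> is a rational map from the line to
  the curve \<open>F = 0\<close>, the quotient \<open>u / v\<close> of two forms of equal degree is a rational map from the
  curve to the line, and they are inverse to each other wherever the compositions are defined.
  In the last clause \<open>\<mu> = 0\<close> occurs only at the finitely many common zeros of \<open>a\<close>, \<open>b\<close>, \<open>c\<close>, where
  the given representative of the first map is undefined.
\<close>

definition rational_curve :: "poly3 \<Rightarrow> bool" where
  "rational_curve F \<longleftrightarrow>
     (\<exists>(a :: complex poly) (b :: complex poly) (c :: complex poly) u v m.
        let \<phi> = (\<lambda>t. vector [poly a t, poly b t, poly c t] :: complex^3) in
        \<not> (a = 0 \<and> b = 0 \<and> c = 0) \<and>
        homogeneous m u \<and> homogeneous m v \<and>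
        (\<forall>t. eval3 F (\<phi> t) = 0) \<and>
        (\<exists>t. eval3 v (\<phi> t) \<noteq> 0) \<and>
        (\<forall>t. eval3 v (\<phi> t) \<noteq> 0 \<longrightarrow> eval3 u (\<phi> t) / eval3 v (\<phi> t) = t) \<and>
        (\<forall>q. q \<noteq> 0 \<longrightarrow> eval3 F q = 0 \<longrightarrow> eval3 v q \<noteq> 0 \<longrightarrow>
             (\<exists>\<mu>. \<phi> (eval3 u q / eval3 v q) = \<mu> *s q)))"


section \<open>Germs of holomorphic functions in two variables\<close>

text \<open>
  A germ at the origin of \<open>\<complex>\<^sup>2\<close> is represented by any function that is, near the origin, the sum of a
  convergent power series. No quotient by equality near the origin is taken: all notions below depend
  only on the germs.
\<close>

type_synonym fun2 = "complex \<times> complex \<Rightarrow> complex"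

definition holo_germs :: "fun2 set" where
  "holo_germs =
     {g. \<exists>(c :: nat \<Rightarrow> nat \<Rightarrow> complex) r. r > 0 \<and>
           (\<forall>x y. norm x < r \<longrightarrow> norm y < r \<longrightarrow>
              ((\<lambda>(i, j). c i j * x ^ i * y ^ j) has_sum g (x, y)) UNIV)}"

definition germ_eq :: "fun2 \<Rightarrow> fun2 \<Rightarrow> bool" where
  "germ_eq g k \<longleftrightarrow> (\<forall>\<^sub>F z in nhds 0. g z = k z)"

definition germ_unit :: "fun2 \<Rightarrow> bool" where
  "germ_unit g \<longleftrightarrow> (\<exists>k\<in>holo_germs. germ_eq (\<lambda>z. g z * k z) (\<lambda>z. 1))"

definition germ_irreducible :: "fun2 \<Rightarrow> bool" where
  "germ_irreducible f \<longleftrightarrow>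
     f \<in> holo_germs \<and> \<not> germ_eq f (\<lambda>z. 0) \<and> \<not> germ_unit f \<and>
     (\<forall>g\<in>holo_germs. \<forall>k\<in>holo_germs.
        germ_eq f (\<lambda>z. g z * k z) \<longrightarrow> germ_unit g \<or> germ_unit k)"

definition vanishes_on_germ :: "fun2 \<Rightarrow> fun2 \<Rightarrow> bool" where
  "vanishes_on_germ f h \<longleftrightarrow> (\<forall>\<^sub>F z in nhds 0. f z = 0 \<longrightarrow> h z = 0)"

definition germ_ideal :: "fun2 \<Rightarrow> fun2 \<Rightarrow> fun2 set" where
  "germ_ideal f h =
     {k. \<exists>a\<in>holo_germs. \<exists>b\<in>holo_germs. germ_eq k (\<lambda>z. a z * f z + b z * h z)}"

text \<open>The residue classes of the elements of \<open>B\<close> form a basis of the complex vector space \<open>O / I\<close>,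
  where \<open>O\<close> is the ring of germs.\<close>

definition quotient_basis :: "fun2 set \<Rightarrow> fun2 set \<Rightarrow> bool" where
  "quotient_basis I B \<longleftrightarrow>
     finite B \<and> B \<subseteq> holo_germs \<and>
     (\<forall>g\<in>holo_germs. \<exists>!c :: fun2 \<Rightarrow> complex.
        c \<in> extensional B \<and> (\<lambda>z. g z - (\<Sum>b\<in>B. c b * b z)) \<in> I)"

text \<open>
  The dimension of \<open>O / (f, h)\<close>. All bases have the same cardinality, and the infimum of the empty
  set, which arises when the quotient is infinite-dimensional, is \<open>\<infinity>\<close>.
\<close>

definition intersection_mult :: "fun2 \<Rightarrow> fun2 \<Rightarrow> enat" where
  "intersection_mult f h = (INF B \<in> {B. quotient_basis (germ_ideal f h) B}. enat (card B))"


section \<open>The germ of a plane curve at a point and its semigroup\<close>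

text \<open>
  The standard affine chart \<open>X = 1\<close>, \<open>Y = 1\<close> or \<open>Z = 1\<close> (the first one that contains \<open>p\<close>), with
  coordinates translated so that \<open>p\<close> becomes the origin.
\<close>

definition affine_chart :: "complex^3 \<Rightarrow> complex \<times> complex \<Rightarrow> complex^3" where
  "affine_chart p = (\<lambda>(x, y).
     if p $ 1 \<noteq> 0 then vector [1, p $ 2 / p $ 1 + x, p $ 3 / p $ 1 + y]
     else if p $ 2 \<noteq> 0 then vector [p $ 1 / p $ 2 + x, 1, p $ 3 / p $ 2 + y]
     else vector [p $ 1 / p $ 3 + x, p $ 2 / p $ 3 + y, 1])"

definition local_equation :: "poly3 \<Rightarrow> complex^3 \<Rightarrow> fun2" where
  "local_equation h p = (\<lambda>z. eval3 h (affine_chart p z))"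

definition curve_intersection_mult :: "complex^3 \<Rightarrow> poly3 \<Rightarrow> poly3 \<Rightarrow> enat" where
  "curve_intersection_mult p F h = intersection_mult (local_equation F p) (local_equation h p)"

definition semigroup_of_germ :: "poly3 \<Rightarrow> complex^3 \<Rightarrow> nat set" where
  "semigroup_of_germ F p =
     {s. \<exists>h\<in>holo_germs. \<not> vanishes_on_germ (local_equation F p) h \<and>
           intersection_mult (local_equation F p) h = enat s}"

text \<open>The curve \<open>F = 0\<close> is irreducible and rational of degree \<open>d\<close>, and \<open>p\<close> is its only singular
  point, at which it is locally irreducible.\<close>

definition unicuspidal_rational_curve :: "poly3 \<Rightarrow> nat \<Rightarrow> complex^3 \<Rightarrow> bool" where
  "unicuspidal_rational_curve F d p \<longleftrightarrow>
     homogeneous d F \<and> irreducible F \<and> rational_curve F \<and>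
     singular_point F p \<and> (\<forall>q. singular_point F q \<longrightarrow> (\<exists>\<mu>. q = \<mu> *s p)) \<and>
     germ_irreducible (local_equation F p)"

end

theory Submission
  imports Defs "HOL-Complex_Analysis.Complex_Analysis" "HOL-Computational_Algebra.Field_as_Ring"
begin

text \<open>
  Parametrize \<open>C\<close> by polynomials with the parameter \<open>\<infinity>\<close> at the cusp and write \<open>S\<^sub>l\<close> for the set of
  orders at \<open>\<infinity>\<close> of the forms of degree \<open>l\<close> that do not vanish on \<open>C\<close>. Since the
  orders realized by a space of polynomials are as many as its dimension,
  \<open>|S\<^sub>l| = (l + 1)(l + 2) / 2\<close> for \<open>l < d\<close> and \<open>|S\<^sub>l| = l d + 1 - (d - 1)(d - 2) / 2\<close> for
  \<open>l \<ge> d\<close>. The curve has no other singular point, so for large \<open>l\<close> the forms of degree \<open>l\<close>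
  restrict to all polynomials of degree at most \<open>l d\<close> minus a constant; together with polynomial
  approximation of germs this gives \<open>S\<^sub>l = \<Gamma> \<inter> [0, l d]\<close> for large \<open>l\<close>. Hence \<open>\<Gamma>\<close> has
  \<open>(d - 1)(d - 2) / 2\<close> gaps, and as a semigroup with \<open>g\<close> gaps it contains all \<open>x \<ge> 2 g\<close>. As
  \<open>S\<^sub>l \<subseteq> \<Gamma> \<inter> [0, l d]\<close>, both conditions say that \<open>|\<Gamma> \<inter> [0, l d]| = (l + 1)(l + 2) / 2\<close> for
  \<open>l \<le> d - 3\<close>; the intervals with \<open>l \<ge> d - 2\<close> are controlled by the conductor.

  The intersection multiplicity is the dimension of \<open>O / (f, h)\<close>, so the orders have to be identified with
  it: in the form \<open>(t\<^sup>k, y(t))\<close> of the branch the germs vanishing on it are generated by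
  \<open>\<Prod> (Y - y(\<zeta> t))\<close> over the \<open>k\<close>-th roots of unity \<open>\<zeta>\<close>, and the pullbacks of germs contain all
  multiples of a power of \<open>t\<close>, so that multiplication by \<open>h\<close> has cokernel of dimension \<open>ord\<^sub>t h\<close>.
\<close>

text \<open>That only multiples of \<open>F\<close> restrict to zero is itself a counting fact: the
  inverse map \<open>u / v\<close> supplies so many forms independent on the curve that a form not
  divisible by \<open>F\<close> and vanishing on it would violate Bezout's count. The degree
  \<open>e\<close> of the parametrization is not given; its equality with \<open>d\<close> comes
  from comparing two growth rates of the number of degrees of restricted forms.

  The definition of rationality does not say that the cusp is a value of the parametrization, nor
  that it is the value of a single parameter. Attainment is an integrality argument: otherwise a
  determinant produces a form that vanishes on the curve but not at \<open>p\<close>. Uniqueness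
  uses local irreducibility: all zeros of the local equation near \<open>p\<close> lie on the branch
  at infinity, and \<open>u / v\<close> recovers the parameter from a point.

  With the cusp at infinity, the order of a form of degree \<open>l\<close> at the cusp is
  \<open>l * d\<close> minus the degree of its restriction, so that dimensions and orders are both
  read off from degrees of polynomials in one variable.\<close>

no_notation fps_nth (infixl "$" 75)

section \<open>Linear algebra through degrees of polynomials\<close>

lemma linear_system_nontrivial:
  fixes M :: "'a \<Rightarrow> 'b \<Rightarrow> complex"
  assumes "finite A" "finite B" "card A < card B"
  shows "\<exists>v. (\<exists>b\<in>B. v b \<noteq> 0) \<and> (\<forall>a\<in>A. (\<Sum>b\<in>B. M a b * v b) = 0)"
  using assms
proof (induction A arbitrary: B M rule: finite_induct)
  case empty
  then have "B \<noteq> {}" by auto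
  then show ?case by (intro exI[of _ "\<lambda>_. 1"]) auto
next
  case (insert a A)
  show ?case
  proof (cases "\<forall>b\<in>B. M a b = 0")
    case True
    obtain v where "\<exists>b\<in>B. v b \<noteq> 0" "\<forall>a\<in>A. (\<Sum>b\<in>B. M a b * v b) = 0"
      using insert.IH[of B M] insert.prems insert.hyps by (auto simp: card_insert_if)
    then show ?thesis using True by (intro exI[of _ v]) auto
  next
    case False
    then obtain b0 where b0: "b0 \<in> B" "M a b0 \<noteq> 0" by auto
    \<comment> \<open>An equation with a nonzero coefficient at \<open>b0\<close> determines that
      unknown; subtracting multiples of row \<open>a\<close> removes \<open>b0\<close> from the
      other equations, leaving one equation and one unknown fewer.\<close>
    let ?B = "B - {b0}"
    let ?M = "\<lambda>a' b. M a' b - M a' b0 * M a b / M a b0"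
    have "card A < card ?B"
      using insert b0 by (simp add: card_insert_if)
    then obtain v where v: "\<exists>b\<in>?B. v b \<noteq> 0" "\<forall>a'\<in>A. (\<Sum>b\<in>?B. ?M a' b * v b) = 0"
      using insert.IH[of ?B ?M] insert.prems by auto
    define s where "s = (\<Sum>b\<in>?B. M a b * v b)"
    define v' where "v' = v(b0 := - s / M a b0)"
    have eq: "(\<Sum>b\<in>B. M a' b * v' b) = (\<Sum>b\<in>?B. M a' b * v b) - M a' b0 * s / M a b0" for a'
    proof -
      have "(\<Sum>b\<in>B. M a' b * v' b) = M a' b0 * v' b0 + (\<Sum>b\<in>?B. M a' b * v' b)"
        using b0 insert.prems by (intro sum.remove) auto
      also have "(\<Sum>b\<in>?B. M a' b * v' b) = (\<Sum>b\<in>?B. M a' b * v b)"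
        by (intro sum.cong) (auto simp: v'_def)
      finally show ?thesis by (simp add: v'_def)
    qed
    have "(\<Sum>b\<in>B. M a' b * v' b) = 0" if "a' \<in> insert a A" for a'
    proof (cases "a' = a")
      case True
      then show ?thesis using eq[of a] b0 by (simp add: s_def)
    next
      case False
      then have "a' \<in> A" using that by auto
      then have "(\<Sum>b\<in>?B. ?M a' b * v b) = 0" using v by auto
      moreover have "(\<Sum>b\<in>?B. ?M a' b * v b) = (\<Sum>b\<in>?B. M a' b * v b) - M a' b0 * s / M a b0"
        unfolding s_def
        by (simp add: algebra_simps sum_subtractf sum_distrib_left sum_distrib_right sum_divide_distrib)
      ultimately show ?thesis using eq[of a'] by simp
    qed
    moreover have "\<exists>b\<in>B. v' b \<noteq> 0" using v(1) by (auto simp: v'_def)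
    ultimately show ?thesis by blast
  qed
qed

text \<open>The largest index with a nonzero coefficient contributes a monomial that no other
  summand can cancel.\<close>

lemma distinct_degrees_independent:
  fixes f :: "nat \<Rightarrow> complex poly"
  assumes "finite D" "\<And>\<delta>. \<delta> \<in> D \<Longrightarrow> f \<delta> \<noteq> 0 \<and> degree (f \<delta>) = \<delta>"
    and "(\<Sum>\<delta>\<in>D. smult (c \<delta>) (f \<delta>)) = 0" "\<delta> \<in> D"
  shows "c \<delta> = 0"
proof (rule ccontr)
  assume "c \<delta> \<noteq> 0"
  define E where "E = {\<delta>\<in>D. c \<delta> \<noteq> 0}"
  have E: "finite E" "E \<noteq> {}" using assms \<open>c \<delta> \<noteq> 0\<close> by (auto simp: E_def)
  define m where "m = Max E"
  have m: "m \<in> E" using E unfolding m_def by (rule Max_in)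
  have "0 = coeff (\<Sum>\<delta>\<in>D. smult (c \<delta>) (f \<delta>)) m" using assms by simp
  also have "\<dots> = (\<Sum>\<delta>\<in>D. c \<delta> * coeff (f \<delta>) m)" by (simp add: coeff_sum)
  also have "\<dots> = (\<Sum>\<delta>\<in>{m}. c \<delta> * coeff (f \<delta>) m)"
  proof (rule sum.mono_neutral_right)
    show "finite D" by fact
    show "{m} \<subseteq> D" using m by (auto simp: E_def)
    show "\<forall>i\<in>D - {m}. c i * coeff (f i) m = 0"
    proof
      fix i assume i: "i \<in> D - {m}"
      show "c i * coeff (f i) m = 0"
      proof (cases "c i = 0")
        case False
        then have "i \<in> E" using i by (auto simp: E_def)
        then have "i \<le> m" using E Max_ge[of E i] by (simp add: m_def)
          then have "i < m" using i by auto
        then have "coeff (f i) m = 0" using assms(2)[of i] i by (auto intro: coeff_eq_0)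
        then show ?thesis by simp
      qed simp
    qed
  qed
  also have "\<dots> \<noteq> 0"
    using m assms(2)[of m] leading_coeff_0_iff[of "f m"] by (simp add: E_def)
  finally show False by simp
qed

definition poly_subspace :: "complex poly set \<Rightarrow> bool" where
  "poly_subspace W \<longleftrightarrow> 0 \<in> W \<and> (\<forall>f\<in>W. \<forall>g\<in>W. f + g \<in> W) \<and> (\<forall>c. \<forall>f\<in>W. smult c f \<in> W)"

definition degs :: "complex poly set \<Rightarrow> nat set" where
  "degs W = degree ` (W - {0})"

lemma poly_subspace_sum:
  assumes "poly_subspace W" "\<And>b. b \<in> B \<Longrightarrow> f b \<in> W"
  shows "(\<Sum>b\<in>B. f b) \<in> W"
  using assms(2) by (induction B rule: infinite_finite_induct) (use assms(1) in \<open>auto simp: poly_subspace_def\<close>)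

text \<open>This is the inequality \<open>dim W <= card (degs W)\<close>: more elements than degrees
  admit a nontrivial combination whose coefficients at all exponents of \<open>degs W\<close>
  vanish, whereas a nonzero element of \<open>W\<close> has a nonzero coefficient at its own
  degree.\<close>

lemma independent_card_le_degs:
  fixes w :: "'b \<Rightarrow> complex poly"
  assumes W: "poly_subspace W" and fin: "finite (degs W)" and B: "finite B"
    and wW: "\<And>b. b \<in> B \<Longrightarrow> w b \<in> W"
    and ind: "\<And>c. (\<Sum>b\<in>B. smult (c b) (w b)) = 0 \<Longrightarrow> \<forall>b\<in>B. c b = 0"
  shows "card B \<le> card (degs W)"
proof (rule ccontr)
  assume "\<not> card B \<le> card (degs W)"
  then obtain v where v: "\<exists>b\<in>B. v b \<noteq> 0" "\<forall>\<delta>\<in>degs W. (\<Sum>b\<in>B. coeff (w b) \<delta> * v b) = 0"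
    using linear_system_nontrivial[OF fin B, of "\<lambda>\<delta> b. coeff (w b) \<delta>"] by auto
  define s where "s = (\<Sum>b\<in>B. smult (v b) (w b))"
  have "s \<in> W" unfolding s_def using W wW
    by (intro poly_subspace_sum) (auto simp: poly_subspace_def)
  have "coeff s \<delta> = 0" if "\<delta> \<in> degs W" for \<delta>
    using v(2) that by (simp add: s_def coeff_sum mult.commute)
  moreover have "coeff s (degree s) \<noteq> 0" if "s \<noteq> 0" using that by simp
  moreover have "degree s \<in> degs W" if "s \<noteq> 0" using that \<open>s \<in> W\<close> by (auto simp: degs_def)
  ultimately have "s = 0" by blast
  then show False using ind[of v] v(1) by (auto simp: s_def)
qed

section \<open>Forms in three variables: evaluation, coefficients, homogeneity\<close>

lemma eval3_add [simp]: "eval3 (f + g) q = eval3 f q + eval3 g q"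
  by (simp add: eval3_def)

lemma eval3_mult [simp]: "eval3 (f * g) q = eval3 f q * eval3 g q"
  by (simp add: eval3_def)

lemma eval3_diff [simp]: "eval3 (f - g) q = eval3 f q - eval3 g q"
  by (simp add: eval3_def)

lemma eval3_uminus [simp]: "eval3 (- f) q = - eval3 f q"
  by (simp add: eval3_def)

lemma eval3_0 [simp]: "eval3 0 q = 0"
  by (simp add: eval3_def)

lemma eval3_1 [simp]: "eval3 1 q = 1"
  by (simp add: eval3_def)

lemma eval3_sum: "eval3 (\<Sum>b\<in>B. f b) q = (\<Sum>b\<in>B. eval3 (f b) q)"
  by (induction B rule: infinite_finite_induct) auto

lemma eval3_power [simp]: "eval3 (f ^ n) q = eval3 f q ^ n"
  by (induction n) auto

definition scal :: "complex \<Rightarrow> poly3" where "scal c = [:[:[:c:]:]:]"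

definition mon :: "nat \<Rightarrow> nat \<Rightarrow> nat \<Rightarrow> poly3" where
  "mon i j k = monom (monom (monom 1 i) j) k"

definition lin :: "complex^3 \<Rightarrow> poly3" where
  "lin w = scal (w $ 1) * mon 1 0 0 + scal (w $ 2) * mon 0 1 0 + scal (w $ 3) * mon 0 0 1"

lemma eval3_scal [simp]: "eval3 (scal c) q = c"
  by (simp add: eval3_def scal_def)

lemma eval3_mon [simp]: "eval3 (mon i j k) q = (q $ 1) ^ i * (q $ 2) ^ j * (q $ 3) ^ k"
  by (simp add: eval3_def mon_def poly_monom)

lemma eval3_lin [simp]: "eval3 (lin w) q = w $ 1 * q $ 1 + w $ 2 * q $ 2 + w $ 3 * q $ 3"
  by (simp add: lin_def)

lemma coeff3_add [simp]: "coeff3 (f + g) i j k = coeff3 f i j k + coeff3 g i j k"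
  by (simp add: coeff3_def)

lemma coeff3_diff [simp]: "coeff3 (f - g) i j k = coeff3 f i j k - coeff3 g i j k"
  by (simp add: coeff3_def)

lemma coeff3_0 [simp]: "coeff3 0 i j k = 0"
  by (simp add: coeff3_def)

lemma coeff3_sum: "coeff3 (\<Sum>b\<in>B. f b) i j k = (\<Sum>b\<in>B. coeff3 (f b) i j k)"
  by (induction B rule: infinite_finite_induct) auto

lemma coeff3_scal_mult [simp]: "coeff3 (scal c * f) i j k = c * coeff3 f i j k"
  by (simp add: coeff3_def scal_def)

lemma coeff3_scal: "coeff3 (scal c) i j k = (if i = 0 \<and> j = 0 \<and> k = 0 then c else 0)"
  by (auto simp: coeff3_def scal_def coeff_pCons split: nat.split)

lemma coeff3_mon: "coeff3 (mon i j k) i' j' k' = (if (i, j, k) = (i', j', k') then 1 else 0)"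
  by (auto simp: coeff3_def mon_def)

lemma coeff3_mult:
  "coeff3 (f * g) i j k =
     (\<Sum>k'\<le>k. \<Sum>j'\<le>j. \<Sum>i'\<le>i. coeff3 f i' j' k' * coeff3 g (i - i') (j - j') (k - k'))"
  by (simp add: coeff3_def coeff_mult coeff_sum)

lemma poly3_eqI: "(\<And>i j k. coeff3 f i j k = coeff3 g i j k) \<Longrightarrow> f = g"
  by (auto simp: coeff3_def intro!: poly_eqI)

lemma scal_0 [simp]: "scal 0 = 0" by (simp add: scal_def)
lemma scal_1 [simp]: "scal 1 = 1" by (simp add: scal_def one_pCons)
lemma scal_mult: "scal (a * b) = scal a * scal b" by (simp add: scal_def)
lemma scal_eq_0_iff [simp]: "scal c = 0 \<longleftrightarrow> c = 0" by (simp add: scal_def)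
lemma mon_000 [simp]: "mon 0 0 0 = 1" by (simp add: mon_def monom_0 one_pCons)

lemma homogeneous_0 [simp]: "homogeneous m 0" by (simp add: homogeneous_def)

lemma homogeneous_add: "homogeneous m f \<Longrightarrow> homogeneous m g \<Longrightarrow> homogeneous m (f + g)"
  unfolding homogeneous_def by (metis add.right_neutral add_0 coeff3_add)

lemma homogeneous_diff: "homogeneous m f \<Longrightarrow> homogeneous m g \<Longrightarrow> homogeneous m (f - g)"
  unfolding homogeneous_def by (metis coeff3_diff diff_0_right diff_self)

lemma homogeneous_sum: "(\<And>b. b \<in> B \<Longrightarrow> homogeneous m (f b)) \<Longrightarrow> homogeneous m (\<Sum>b\<in>B. f b)"
  by (induction B rule: infinite_finite_induct) (auto intro: homogeneous_add)

lemma homogeneous_scal [simp]: "homogeneous 0 (scal c)"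
  by (auto simp: homogeneous_def coeff3_scal split: if_splits)

lemma homogeneous_scal_mult: "homogeneous m f \<Longrightarrow> homogeneous m (scal c * f)"
  by (auto simp: homogeneous_def)

lemma homogeneous_mon: "i + j + k = m \<Longrightarrow> homogeneous m (mon i j k)"
  by (auto simp: homogeneous_def coeff3_mon split: if_splits)

lemma homogeneous_1 [simp]: "homogeneous 0 1"
  using homogeneous_mon[of 0 0 0] by simp

lemma homogeneous_lin [simp]: "homogeneous 1 (lin w)"
  unfolding lin_def by (intro homogeneous_add homogeneous_scal_mult homogeneous_mon) auto

lemma homogeneous_mult:
  assumes "homogeneous m f" "homogeneous n g"
  shows "homogeneous (m + n) (f * g)"
  unfolding homogeneous_def
proof (intro allI impI)
  fix i j k assume "coeff3 (f * g) i j k \<noteq> 0"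
  then obtain k' where k': "k' \<in> {..k}"
      "(\<Sum>j'\<le>j. \<Sum>i'\<le>i. coeff3 f i' j' k' * coeff3 g (i - i') (j - j') (k - k')) \<noteq> 0"
    unfolding coeff3_mult by (meson sum.not_neutral_contains_not_neutral)
  then obtain j' where j': "j' \<in> {..j}"
      "(\<Sum>i'\<le>i. coeff3 f i' j' k' * coeff3 g (i - i') (j - j') (k - k')) \<noteq> 0"
    by (meson sum.not_neutral_contains_not_neutral)
  then obtain i' where i': "i' \<in> {..i}" "coeff3 f i' j' k' * coeff3 g (i - i') (j - j') (k - k') \<noteq> 0"
    by (meson sum.not_neutral_contains_not_neutral)
  then have "i' + j' + k' = m" "(i - i') + (j - j') + (k - k') = n"
    using assms i'(2) unfolding homogeneous_def by (metis mult_not_zero)+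
  moreover have "i' \<le> i" "j' \<le> j" "k' \<le> k" using k'(1) j'(1) i'(1) by auto
  ultimately show "i + j + k = m + n" by linarith
qed

lemma homogeneous_power: "homogeneous m f \<Longrightarrow> homogeneous (n * m) (f ^ n)"
  by (induction n) (auto intro: homogeneous_mult)

section \<open>Counting monomials, also modulo a leading monomial\<close>

definition Mon :: "nat \<Rightarrow> (nat \<times> nat \<times> nat) set" where
  "Mon l = {(i, j, k). i + j + k = l}"

definition Mcomb :: "(nat \<times> nat \<times> nat) set \<Rightarrow> (nat \<times> nat \<times> nat \<Rightarrow> complex) \<Rightarrow> poly3" where
  "Mcomb A c = (\<Sum>(i, j, k)\<in>A. scal (c (i, j, k)) * mon i j k)"

lemma Mon_altdef: "Mon l = (\<lambda>(i, j). (i, j, l - i - j)) ` (SIGMA i:{..l}. {..l - i})"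
  by (force simp: Mon_def)

lemma finite_Mon [simp]: "finite (Mon l)"
  unfolding Mon_altdef by simp

lemma card_Mon: "2 * card (Mon l) = (l + 1) * (l + 2)"
proof -
  have "card (Mon l) = card (SIGMA i:{..l}. {..l - i})"
    unfolding Mon_altdef by (rule card_image) (auto simp: inj_on_def)
  also have "\<dots> = (\<Sum>i\<le>l. l - i + 1)" by simp
  also have "\<dots> = (\<Sum>i\<le>l. i + 1)"
    by (rule sum.reindex_bij_witness[of _ "\<lambda>i. l - i" "\<lambda>i. l - i"]) auto
  also have "2 * \<dots> = (l + 1) * (l + 2)"
    by (induction l) auto
  finally show ?thesis .
qed

lemma coeff3_Mcomb:
  assumes "finite A"
  shows "coeff3 (Mcomb A c) i j k = (if (i, j, k) \<in> A then c (i, j, k) else 0)"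
proof -
  have "coeff3 (Mcomb A c) i j k = (\<Sum>b\<in>A. if b = (i, j, k) then c b else 0)"
    unfolding Mcomb_def coeff3_sum by (intro sum.cong refl) (simp add: coeff3_mon split: prod.split)
  then show ?thesis using assms by simp
qed

lemma homogeneous_expand:
  assumes "homogeneous l h"
  shows "h = Mcomb (Mon l) (\<lambda>(i, j, k). coeff3 h i j k)"
proof (rule poly3_eqI)
  fix i j k
  show "coeff3 h i j k = coeff3 (Mcomb (Mon l) (\<lambda>(i, j, k). coeff3 h i j k)) i j k"
    using assms unfolding coeff3_Mcomb[OF finite_Mon] homogeneous_def by (auto simp: Mon_def)
qed

lemma homogeneous_Mcomb: "A \<subseteq> Mon l \<Longrightarrow> homogeneous l (Mcomb A c)"
  unfolding Mcomb_def
  by (intro homogeneous_sum) (auto simp: Mon_def intro!: homogeneous_scal_mult homogeneous_mon)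

lemma eval3_homogeneous_scale:
  assumes "homogeneous l h"
  shows "eval3 h (\<mu> *s q) = \<mu> ^ l * eval3 h q"
proof -
  have "eval3 (Mcomb (Mon l) c) (\<mu> *s q) = \<mu> ^ l * eval3 (Mcomb (Mon l) c) q" for c
    unfolding Mcomb_def eval3_sum sum_distrib_left
    by (intro sum.cong) (auto simp: Mon_def power_add power_mult_distrib)
  then show ?thesis using homogeneous_expand[OF assms] by metis
qed

text \<open>The exponents \<open>(i\<^sub>0, j\<^sub>0, k\<^sub>0)\<close> are those of the leading monomial for the lexicographic order.\<close>

lemma leading_monomial:
  assumes "F \<noteq> 0" "homogeneous d F"
  obtains i0 j0 k0 where "i0 + j0 + k0 = d"
    "\<And>q. q \<noteq> 0 \<Longrightarrow> \<exists>i j k. coeff3 (F * q) (i0 + i) (j0 + j) (k0 + k) \<noteq> 0"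
proof -
  define k0 where "k0 = degree F"
  define j0 where "j0 = degree (lead_coeff F)"
  define i0 where "i0 = degree (lead_coeff (lead_coeff F))"
  have "coeff3 F i0 j0 k0 \<noteq> 0"
    using assms(1) by (simp add: coeff3_def i0_def j0_def k0_def)
  then have 1: "i0 + j0 + k0 = d" using assms by (auto simp: homogeneous_def)
  have 2: "\<exists>i j k. coeff3 (F * q) (i0 + i) (j0 + j) (k0 + k) \<noteq> 0" if "q \<noteq> 0" for q
  proof -
    define k where "k = degree q"
    define j where "j = degree (lead_coeff q)"
    define i where "i = degree (lead_coeff (lead_coeff q))"
    have "coeff3 (F * q) (i0 + i) (j0 + j) (k0 + k) =
        lead_coeff (lead_coeff (lead_coeff F)) * lead_coeff (lead_coeff (lead_coeff q))"
      unfolding coeff3_def i0_def j0_def k0_def i_def j_def k_def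
      by (simp only: coeff_mult_degree_sum)
    then show ?thesis using assms(1) that
      by (metis leading_coeff_0_iff mult_eq_0_iff)
  qed
  from 1 2 show thesis by (rule that)
qed

text \<open>For the exponents of the leading monomial of \<open>F\<close> these are the standard
  monomials: those of degree \<open>l\<close> not divisible by it. They form a basis of the forms of
  degree \<open>l\<close> modulo multiples of \<open>F\<close>.\<close>

definition MonN :: "nat \<times> nat \<times> nat \<Rightarrow> nat \<Rightarrow> (nat \<times> nat \<times> nat) set" where
  "MonN = (\<lambda>(i0, j0, k0) l. Mon l - (\<lambda>(i, j, k). (i0 + i, j0 + j, k0 + k)) ` UNIV)"

lemma MonN_subset: "MonN e l \<subseteq> Mon l"
  by (cases e) (auto simp: MonN_def)

lemma finite_MonN [simp]: "finite (MonN e l)"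
  using MonN_subset finite_Mon finite_subset by blast

lemma card_MonN:
  assumes "i0 + j0 + k0 = d"
  shows "card (MonN (i0, j0, k0) l) = card (Mon l) - (if d \<le> l then card (Mon (l - d)) else 0)"
proof -
  let ?s = "\<lambda>(i, j, k). (i0 + i, j0 + j, k0 + k)"
  have inj: "inj_on ?s A" for A by (auto simp: inj_on_def)
  show ?thesis
  proof (cases "d \<le> l")
    case True
    have "MonN (i0, j0, k0) l = Mon l - ?s ` Mon (l - d)"
      using assms True by (auto simp: MonN_def Mon_def image_iff)
    moreover have "?s ` Mon (l - d) \<subseteq> Mon l" using assms True by (auto simp: Mon_def)
    ultimately show ?thesis using True inj[of "Mon (l - d)"]
      by (simp add: card_Diff_subset card_image)
  next
    case False
    have "MonN (i0, j0, k0) l = Mon l"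
      using assms False by (auto simp: MonN_def Mon_def)
    then show ?thesis using False by simp
  qed
qed

lemma independent_forms_card_le:
  assumes B: "finite B" and H: "\<And>b. b \<in> B \<Longrightarrow> homogeneous l (H b)"
    and ind: "\<And>c. (\<Sum>b\<in>B. scal (c b) * H b) = 0 \<Longrightarrow> \<forall>b\<in>B. c b = 0"
  shows "card B \<le> card (Mon l)"
proof (rule ccontr)
  assume "\<not> card B \<le> card (Mon l)"
  then obtain v where v: "\<exists>b\<in>B. v b \<noteq> 0"
      "\<forall>a\<in>Mon l. (\<Sum>b\<in>B. (case a of (i, j, k) \<Rightarrow> coeff3 (H b) i j k) * v b) = 0"
    using linear_system_nontrivial[OF finite_Mon B,
        where M = "\<lambda>a b. case a of (i, j, k) \<Rightarrow> coeff3 (H b) i j k"] by (meson not_le)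
  have "(\<Sum>b\<in>B. scal (v b) * H b) = 0"
  proof (rule poly3_eqI)
    fix i j k
    show "coeff3 (\<Sum>b\<in>B. scal (v b) * H b) i j k = coeff3 0 i j k"
    proof (cases "(i, j, k) \<in> Mon l")
      case True
      then have "(\<Sum>b\<in>B. coeff3 (H b) i j k * v b) = 0" using v(2) by fastforce
      then show ?thesis by (simp add: coeff3_sum) (simp add: mult.commute)
    next
      case False
      then have "coeff3 (H b) i j k = 0" if "b \<in> B" for b
        using H[OF that] by (auto simp: homogeneous_def Mon_def)
      then show ?thesis by (simp add: coeff3_sum)
    qed
  qed
  then show False using ind[of v] v(1) by auto
qed

section \<open>Restriction of forms to a parametrized curve\<close>

definition subst3 :: "complex poly^3 \<Rightarrow> poly3 \<Rightarrow> complex poly" where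
  "subst3 Q h = poly (map_poly (\<lambda>g. poly (map_poly (\<lambda>k. pcompose k (Q $ 1)) g) (Q $ 2)) h) (Q $ 3)"

definition pev :: "complex poly^3 \<Rightarrow> complex \<Rightarrow> complex^3" where
  "pev Q t = (\<chi> i. poly (Q $ i) t)"

lemma pev_nth [simp]: "pev Q t $ i = poly (Q $ i) t"
  by (simp add: pev_def)

lemma poly_subst3 [simp]: "poly (subst3 Q h) t = eval3 h (pev Q t)"
proof -
  have 1: "poly (poly (map_poly (\<lambda>k. pcompose k (Q $ 1)) g) (Q $ 2)) t =
      poly (poly g [:poly (Q $ 2) t:]) (poly (Q $ 1) t)" for g
    by (induction g) (auto simp: map_poly_pCons poly_pcompose)
  have "poly (poly (map_poly (\<lambda>g. poly (map_poly (\<lambda>k. pcompose k (Q $ 1)) g) (Q $ 2)) h) (Q $ 3)) t =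
      poly (poly (poly h [:[:poly (Q $ 3) t:]:]) [:poly (Q $ 2) t:]) (poly (Q $ 1) t)"
    by (induction h) (auto simp: map_poly_pCons 1)
  then show ?thesis by (simp add: subst3_def eval3_def)
qed

text \<open>Over the complex numbers every identity for \<open>subst3\<close> can be checked at each
  parameter, where \<open>poly_subst3\<close> turns it into an identity for
  \<open>eval3\<close>.\<close>

lemma poly_eqI_eval: "(\<And>t. poly p t = poly q t) \<Longrightarrow> p = (q :: complex poly)"
  using poly_eq_poly_eq_iff by blast

lemma subst3_add [simp]: "subst3 Q (f + g) = subst3 Q f + subst3 Q g"
  by (rule poly_eqI_eval) simp
lemma subst3_diff [simp]: "subst3 Q (f - g) = subst3 Q f - subst3 Q g"
  by (rule poly_eqI_eval) simp
lemma subst3_mult [simp]: "subst3 Q (f * g) = subst3 Q f * subst3 Q g"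
  by (rule poly_eqI_eval) simp
lemma subst3_power [simp]: "subst3 Q (f ^ n) = subst3 Q f ^ n"
  by (rule poly_eqI_eval) simp
lemma subst3_0 [simp]: "subst3 Q 0 = 0"
  by (rule poly_eqI_eval) simp
lemma subst3_1 [simp]: "subst3 Q 1 = 1"
  by (rule poly_eqI_eval) simp
lemma subst3_scal_mult [simp]: "subst3 Q (scal c * f) = smult c (subst3 Q f)"
  by (rule poly_eqI_eval) simp
lemma subst3_scal [simp]: "subst3 Q (scal c) = [:c:]"
  by (rule poly_eqI_eval) simp
lemma subst3_mon: "subst3 Q (mon i j k) = (Q $ 1) ^ i * (Q $ 2) ^ j * (Q $ 3) ^ k"
  by (rule poly_eqI_eval) simp
lemma subst3_lin: "subst3 Q (lin w) = smult (w $ 1) (Q $ 1) + smult (w $ 2) (Q $ 2) + smult (w $ 3) (Q $ 3)"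
  by (rule poly_eqI_eval) simp
lemma subst3_sum: "subst3 Q (\<Sum>b\<in>B. f b) = (\<Sum>b\<in>B. subst3 Q (f b))"
  by (induction B rule: infinite_finite_induct) auto

lemma degree_subst3_le:
  assumes "homogeneous l h" "\<And>i. degree (Q $ i) \<le> e"
  shows "degree (subst3 Q h) \<le> l * e"
proof -
  have "degree (subst3 Q (mon i j k)) \<le> l * e" if "i + j + k = l" for i j k
  proof -
    have pw: "degree ((Q $ a) ^ n) \<le> n * e" for a n
      by (rule order_trans[OF degree_power_le]) (use assms(2)[of a] in \<open>simp add: mult.commute\<close>)
    have "degree ((Q $ 1) ^ i * (Q $ 2) ^ j * (Q $ 3) ^ k) \<le> i * e + j * e + k * e"
      by (intro order_trans[OF degree_mult_le] add_mono pw)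
    also have "\<dots> = l * e" using that by (auto simp: algebra_simps)
    finally show ?thesis by (simp add: subst3_mon)
  qed
  then have "degree (subst3 Q (Mcomb (Mon l) c)) \<le> l * e" for c
    unfolding Mcomb_def subst3_sum
    by (intro degree_sum_le finite_Mon) (auto simp: Mon_def intro: order_trans[OF degree_smult_le])
  then show ?thesis using homogeneous_expand[OF assms(1)] by metis
qed

lemma irreducible_imp_prime_poly3: "irreducible (F::poly3) \<Longrightarrow> prime_elem F"
  by (rule irreducible_imp_prime_elem_gcd)

text \<open>A nonzero multiple of \<open>F\<close> contains a monomial divisible by the leading one,
  and such exponents are excluded from \<open>MonN\<close>.\<close>

lemma dvd_Mcomb_MonN_imp_0:
  assumes lead: "\<And>q. q \<noteq> 0 \<Longrightarrow> \<exists>i j k. coeff3 (F * q) (i0 + i) (j0 + j) (k0 + k) \<noteq> 0"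
    and dvd: "F dvd Mcomb (MonN (i0, j0, k0) l) c" and x: "x \<in> MonN (i0, j0, k0) l"
  shows "c x = 0"
proof -
  obtain q where q: "Mcomb (MonN (i0, j0, k0) l) c = F * q" using dvd by (auto elim: dvdE)
  have "q = 0"
  proof (rule ccontr)
    assume "q \<noteq> 0"
    then obtain i j k where "coeff3 (F * q) (i0 + i) (j0 + j) (k0 + k) \<noteq> 0" using lead by blast
    then have "(i0 + i, j0 + j, k0 + k) \<in> MonN (i0, j0, k0) l"
      unfolding q[symmetric] by (simp add: coeff3_Mcomb split: if_splits)
    moreover have "(i0 + i, j0 + j, k0 + k) \<in> range (\<lambda>(i, j, k). (i0 + i, j0 + j, k0 + k))"
      by (rule image_eqI[of _ _ "(i, j, k)"]) auto
    ultimately show False by (simp add: MonN_def)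
  qed
  then have 0: "coeff3 (Mcomb (MonN (i0, j0, k0) l) c) i j k = 0" for i j k using q by simp
  show ?thesis using 0[of "fst x" "fst (snd x)" "snd (snd x)"] x by (simp add: coeff3_Mcomb)
qed

lemma Mcomb_0_imp: "finite A \<Longrightarrow> Mcomb A c = 0 \<Longrightarrow> x \<in> A \<Longrightarrow> c x = 0"
  using coeff3_Mcomb[of A c "fst x" "fst (snd x)" "snd (snd x)"] by simp

lemma Mcomb_mult: "(\<Sum>b\<in>A. scal (c b) * (case b of (i, j, k) \<Rightarrow> h * mon i j k)) = h * Mcomb A c"
  unfolding Mcomb_def sum_distrib_left by (intro sum.cong) (auto simp: mult_ac)

text \<open>The identity \<open>uvQ\<close> encodes birationality: \<open>t = u / v\<close> along
  the curve. The number \<open>e\<close> is only a bound for the degrees of the coordinates, and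
  common zeros of the coordinates are still allowed.\<close>

locale parametrized_curve =
  fixes F :: poly3 and d :: nat and Q :: "complex poly^3" and e :: nat and u v :: poly3 and m :: nat
  assumes homF: "homogeneous d F" and irrF: "irreducible F"
    and degQ: "\<And>i. degree (Q $ i) \<le> e" and FQ: "subst3 Q F = 0"
    and homu: "homogeneous m u" and homv: "homogeneous m v"
    and vQ: "subst3 Q v \<noteq> 0" and uvQ: "subst3 Q u = [:0, 1:] * subst3 Q v"
begin

definition W :: "nat \<Rightarrow> complex poly set" where
  "W l = subst3 Q ` {h. homogeneous l h}"

lemma subst3_in_W: "homogeneous l h \<Longrightarrow> subst3 Q h \<in> W l"
  by (auto simp: W_def)

lemma W_subspace: "poly_subspace (W l)"
  unfolding poly_subspace_def W_def
proof (intro conjI ballI allI)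
  show "0 \<in> subst3 Q ` {h. homogeneous l h}" by (rule image_eqI[of _ _ 0]) auto
  fix f assume "f \<in> subst3 Q ` {h. homogeneous l h}"
  then obtain h where h: "homogeneous l h" "f = subst3 Q h" by auto
  show "smult c f \<in> subst3 Q ` {h. homogeneous l h}" for c
    by (rule image_eqI[of _ _ "scal c * h"]) (use h in \<open>auto intro: homogeneous_scal_mult\<close>)
  fix g assume "g \<in> subst3 Q ` {h. homogeneous l h}"
  then obtain k where k: "homogeneous l k" "g = subst3 Q k" by auto
  show "f + g \<in> subst3 Q ` {h. homogeneous l h}"
    by (rule image_eqI[of _ _ "h + k"]) (use h k in \<open>auto intro: homogeneous_add\<close>)
qed

lemma W_mult: "f \<in> W k \<Longrightarrow> g \<in> W l \<Longrightarrow> f * g \<in> W (k + l)"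
  unfolding W_def by (force intro: homogeneous_mult simp flip: subst3_mult)

lemma W_power: "f \<in> W k \<Longrightarrow> f ^ n \<in> W (n * k)"
  unfolding W_def by (force intro: homogeneous_power simp flip: subst3_power)

lemma W_degree: "f \<in> W l \<Longrightarrow> degree f \<le> l * e"
  unfolding W_def using degree_subst3_le[OF _ degQ] by auto

lemma degs_W_subset: "degs (W l) \<subseteq> {..l * e}"
  unfolding degs_def using W_degree by auto

lemma finite_degs_W [simp]: "finite (degs (W l))"
  using degs_W_subset finite_subset by blast

lemma m_pos: "m > 0"
proof (rule ccontr)
  assume "\<not> m > 0"
  then have "degree (subst3 Q u) = 0"
    using W_degree[OF subst3_in_W[OF homu]] by simp
  moreover have "degree (subst3 Q u) = 1 + degree (subst3 Q v)"
    unfolding uvQ using vQ by (subst degree_mult_eq) auto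
  ultimately show False by simp
qed

text \<open>In degree \<open>N * m\<close> these are \<open>N + 1\<close> forms whose restrictions
  are a fixed nonzero polynomial times \<open>1, t, ..., t^N\<close>, hence independent on the
  curve.\<close>

lemma subst3_uv_power:
  assumes "i \<le> N"
  shows "subst3 Q (v ^ (N - i) * u ^ i) = subst3 Q v ^ N * monom 1 i"
proof -
  have "subst3 Q (v ^ (N - i) * u ^ i) = subst3 Q v ^ (N - i) * ([:0, 1:] * subst3 Q v) ^ i"
    by (simp only: subst3_mult subst3_power uvQ)
  also have "\<dots> = (subst3 Q v ^ (N - i) * subst3 Q v ^ i) * [:0, 1:] ^ i"
    by (simp only: power_mult_distrib mult_ac)
  also have "\<dots> = subst3 Q v ^ N * monom 1 i"
    using assms by (simp add: monom_altdef flip: power_add)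
  finally show ?thesis .
qed

text \<open>If \<open>F\<close> did not divide \<open>h\<close>, the forms of large degree
  \<open>l\<close> modulo \<open>F\<close> and \<open>h\<close> would have dimension
  \<open>d * n\<close>, as in Bezout's theorem. The forms in \<open>u\<close> and \<open>v\<close>
  stay independent modulo \<open>F\<close> and \<open>h\<close>, because both vanish on the curve,
  and there are more than \<open>d * n\<close> of them.\<close>

lemma kernel:
  assumes h: "homogeneous n h" "subst3 Q h = 0"
  shows "F dvd h"
proof (rule ccontr)
  assume nd: "\<not> F dvd h"
  have primeF: "prime_elem F" using irreducible_imp_prime_poly3[OF irrF] .
  then have F0: "F \<noteq> 0" by auto
  obtain i0 j0 k0 where e0: "i0 + j0 + k0 = d"
    and lead: "\<And>q. q \<noteq> 0 \<Longrightarrow> \<exists>i j k. coeff3 (F * q) (i0 + i) (j0 + j) (k0 + k) \<noteq> 0"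
    using leading_monomial[OF F0 homF] by metis
  \<comment> \<open>Any \<open>N >= d * n\<close> gives the contradiction; the summands
    \<open>d + n\<close> make room for the degree \<open>l - d - n\<close> in the count.\<close>
  define N where "N = d * n + d + n"
  define l where "l = N * m"
  have "N \<le> l" using m_pos by (simp add: l_def)
  define x where "x = l - d - n"
  have lx: "l = d + n + x" using \<open>N \<le> l\<close> by (simp add: x_def N_def)
  \<comment> \<open>Restricting the multipliers of \<open>h\<close> to standard monomials makes the
    sum direct: \<open>F * A + h * B = 0\<close> forces \<open>F\<close> to divide \<open>B\<close>,
    hence \<open>B = 0\<close>.\<close>
  let ?M1 = "Mon (l - d)" and ?M2 = "MonN (i0, j0, k0) (l - n)"
  let ?B = "?M1 <+> (?M2 <+> {..N})"
  define H where "H = case_sum (\<lambda>(i, j, k). F * mon i j k)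
    (case_sum (\<lambda>(i, j, k). h * mon i j k) (\<lambda>i. v ^ (N - i) * u ^ i))"
  have c6: "card ?B \<le> card (Mon l)"
  proof (rule independent_forms_card_le)
    show "finite ?B" by auto
  next
    fix b assume "b \<in> ?B"
    then show "homogeneous l (H b)"
    proof (elim PlusE; clarsimp simp: H_def)
      fix i j k assume "(i, j, k) \<in> Mon (l - d)"
      then have "homogeneous (l - d) (mon i j k)" by (auto simp: Mon_def intro: homogeneous_mon)
      from homogeneous_mult[OF homF this] show "homogeneous l (F * mon i j k)"
        using lx by (simp add: add_ac)
    next
      fix i j k assume "(i, j, k) \<in> MonN (i0, j0, k0) (l - n)"
      then have "(i, j, k) \<in> Mon (l - n)" using MonN_subset by blast
      then have "homogeneous (l - n) (mon i j k)" by (auto simp: Mon_def intro: homogeneous_mon)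
      from homogeneous_mult[OF h(1) this] show "homogeneous l (h * mon i j k)"
        using lx by (simp add: add_ac)
    next
      fix i assume "i \<le> N"
      have "homogeneous ((N - i) * m + i * m) (v ^ (N - i) * u ^ i)"
        using homu homv by (intro homogeneous_mult homogeneous_power)
      moreover have "(N - i) * m + i * m = l"
        using \<open>i \<le> N\<close> by (simp add: l_def flip: add_mult_distrib)
      ultimately show "homogeneous l (v ^ (N - i) * u ^ i)" by simp
    qed
  next
    fix c assume "(\<Sum>b\<in>?B. scal (c b) * H b) = 0"
    moreover have "(\<Sum>b\<in>?B. scal (c b) * H b) = F * Mcomb ?M1 (c \<circ> Inl) +
        (h * Mcomb ?M2 (c \<circ> Inr \<circ> Inl) + (\<Sum>i\<le>N. scal (c (Inr (Inr i))) * (v ^ (N - i) * u ^ i)))"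
      using Mcomb_mult[of "c \<circ> Inl" F ?M1] Mcomb_mult[of "c \<circ> Inr \<circ> Inl" h ?M2]
      by (simp add: sum.Plus H_def)
    ultimately have eq: "F * Mcomb ?M1 (c \<circ> Inl) +
        (h * Mcomb ?M2 (c \<circ> Inr \<circ> Inl) + (\<Sum>i\<le>N. scal (c (Inr (Inr i))) * (v ^ (N - i) * u ^ i))) = 0"
      by simp
    have "subst3 Q (\<Sum>i\<le>N. scal (c (Inr (Inr i))) * (v ^ (N - i) * u ^ i)) = 0"
      using arg_cong[OF eq, of "subst3 Q"] by (simp add: FQ h(2))
    then have "(\<Sum>i\<le>N. smult (c (Inr (Inr i))) (subst3 Q (v ^ (N - i) * u ^ i))) = 0"
      by (simp only: subst3_sum subst3_scal_mult)
    then have "(\<Sum>i\<le>N. smult (c (Inr (Inr i))) (subst3 Q v ^ N * monom 1 i)) = 0"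
      using subst3_uv_power by (simp del: subst3_mult subst3_power)
    then have "subst3 Q v ^ N * (\<Sum>i\<le>N. monom (c (Inr (Inr i))) i) = 0"
      by (simp add: sum_distrib_left smult_monom flip: mult_smult_right)
    then have 0: "(\<Sum>i\<le>N. monom (c (Inr (Inr i))) i) = 0" using vQ by simp
    have c3: "c (Inr (Inr i)) = 0" if "i \<le> N" for i
      using arg_cong[OF 0, of "\<lambda>p. coeff p i"] that by (simp add: coeff_sum)
    then have eq2: "F * Mcomb ?M1 (c \<circ> Inl) + h * Mcomb ?M2 (c \<circ> Inr \<circ> Inl) = 0"
      using eq by simp
    then have "h * Mcomb ?M2 (c \<circ> Inr \<circ> Inl) = F * (- Mcomb ?M1 (c \<circ> Inl))"
      by (simp add: add_eq_0_iff)
    then have "F dvd h * Mcomb ?M2 (c \<circ> Inr \<circ> Inl)" by simp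
    then have "F dvd Mcomb ?M2 (c \<circ> Inr \<circ> Inl)"
      using nd primeF prime_elem_dvd_mult_iff by blast
    then have c2: "c (Inr (Inl y)) = 0" if "y \<in> ?M2" for y
      using dvd_Mcomb_MonN_imp_0[OF lead _ that] by fastforce
    then have "Mcomb ?M2 (c \<circ> Inr \<circ> Inl) = 0"
      unfolding Mcomb_def by (intro sum.neutral) auto
    then have "Mcomb ?M1 (c \<circ> Inl) = 0" using eq2 F0 by simp
    then have c1: "c (Inl y) = 0" if "y \<in> ?M1" for y
      using Mcomb_0_imp[OF finite_Mon _ that] by fastforce
    show "\<forall>b\<in>?B. c b = 0" using c1 c2 c3 by auto
  qed
  have c7: "card ?B = card ?M1 + (card ?M2 + (N + 1))" by (simp add: card_Plus)
  have c1: "2 * card ?M1 = (n + x + 1) * (n + x + 2)" using card_Mon[of "l - d"] lx by simp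
  have c2: "2 * card (Mon (l - n)) = (d + x + 1) * (d + x + 2)"
    using card_Mon[of "l - n"] lx by simp
  have c3: "2 * card (Mon (l - n - d)) = (x + 1) * (x + 2)"
    using card_Mon[of "l - n - d"] lx by simp
  have c4: "2 * card (Mon l) = (d + n + x + 1) * (d + n + x + 2)"
    using card_Mon[of l] lx by simp
  have "2 * card (Mon (l - n - d)) \<le> 2 * card (Mon (l - n))"
    unfolding c2 c3 by (intro mult_le_mono) auto
  then have c5: "card ?M2 + card (Mon (l - n - d)) = card (Mon (l - n))"
    using card_MonN[OF e0, of "l - n"] lx by simp
  \<comment> \<open>Expanded, this inequality says \<open>N + 1 <= d * n\<close>.\<close>
  have "(n + x + 1) * (n + x + 2) + (d + x + 1) * (d + x + 2) + 2 * (N + 1)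
      \<le> (d + n + x + 1) * (d + n + x + 2) + (x + 1) * (x + 2)"
  proof -
    have "A + B + 2 * (N + 1) \<le> D + C"
      if "2 * c1 = A" "2 * c3 = B" "2 * c4 = C" "2 * c = D" "c2 + c4 = c3" "c1 + (c2 + (N + 1)) \<le> c"
      for A B C D c1 c2 c3 c4 c :: nat using that by presburger
    from this[OF c1 c2 c3 c4 c5] c6 c7 show ?thesis by simp
  qed
  then show False by (simp add: algebra_simps N_def)
qed

text \<open>Both sides are the dimension of the forms of degree \<open>l\<close> modulo multiples of
  \<open>F\<close>. Standard monomials restrict to independent polynomials by \<open>kernel\<close>;
  conversely, forms whose restrictions have distinct degrees are independent of each other and of
  the multiples of \<open>F\<close>.\<close>

lemma card_degs_W:
  "card (degs (W l)) = card (Mon l) - (if d \<le> l then card (Mon (l - d)) else 0)"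
proof (rule antisym)
  have primeF: "prime_elem F" using irreducible_imp_prime_poly3[OF irrF] .
  then have F0: "F \<noteq> 0" by auto
  obtain i0 j0 k0 where e0: "i0 + j0 + k0 = d"
    and lead: "\<And>q. q \<noteq> 0 \<Longrightarrow> \<exists>i j k. coeff3 (F * q) (i0 + i) (j0 + j) (k0 + k) \<noteq> 0"
    using leading_monomial[OF F0 homF] by metis
  let ?M = "MonN (i0, j0, k0) l"
  have "card ?M \<le> card (degs (W l))"
  proof (rule independent_card_le_degs[OF W_subspace finite_degs_W])
    show "finite ?M" by simp
    show "(case b of (i, j, k) \<Rightarrow> subst3 Q (mon i j k)) \<in> W l" if "b \<in> ?M" for b
      using that MonN_subset[of "(i0, j0, k0)" l]
      by (auto simp: Mon_def split: prod.split intro!: subst3_in_W homogeneous_mon)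
    fix c assume 0: "(\<Sum>b\<in>?M. smult (c b) (case b of (i, j, k) \<Rightarrow> subst3 Q (mon i j k))) = 0"
    have "subst3 Q (Mcomb ?M c) = (\<Sum>b\<in>?M. smult (c b) (case b of (i, j, k) \<Rightarrow> subst3 Q (mon i j k)))"
      unfolding Mcomb_def subst3_sum by (intro sum.cong) auto
    then have "subst3 Q (Mcomb ?M c) = 0" using 0 by simp
    then have "F dvd Mcomb ?M c" using homogeneous_Mcomb[OF MonN_subset] kernel by blast
    then show "\<forall>b\<in>?M. c b = 0" using dvd_Mcomb_MonN_imp_0[OF lead] by blast
  qed
  then show "card (Mon l) - (if d \<le> l then card (Mon (l - d)) else 0) \<le> card (degs (W l))"
    using card_MonN[OF e0, of l] by simp
next
  have F0: "F \<noteq> 0" using irrF by auto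
  define M where "M = (if d \<le> l then Mon (l - d) else {})"
  have finM: "finite M" by (simp add: M_def)
  have "\<forall>\<delta>\<in>degs (W l). \<exists>h. homogeneous l h \<and> subst3 Q h \<noteq> 0 \<and> degree (subst3 Q h) = \<delta>"
    by (auto simp: degs_def W_def)
  then obtain h where h: "\<And>\<delta>. \<delta> \<in> degs (W l) \<Longrightarrow>
      homogeneous l (h \<delta>) \<and> subst3 Q (h \<delta>) \<noteq> 0 \<and> degree (subst3 Q (h \<delta>)) = \<delta>" by metis
  let ?B = "degs (W l) <+> M"
  define H where "H = case_sum h (\<lambda>(i, j, k). F * mon i j k)"
  have "card ?B \<le> card (Mon l)"
  proof (rule independent_forms_card_le)
    show "finite ?B" using finM by auto
    show "homogeneous l (H b)" if "b \<in> ?B" for b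
      using that
    proof (elim PlusE; clarsimp simp: H_def h)
      fix i j k assume "(i, j, k) \<in> M"
      then have "homogeneous (l - d) (mon i j k)" "d \<le> l"
        by (auto simp: M_def Mon_def intro: homogeneous_mon split: if_splits)
      with homogeneous_mult[OF homF this(1)] show "homogeneous l (F * mon i j k)" by simp
    qed
    fix c assume "(\<Sum>b\<in>?B. scal (c b) * H b) = 0"
    then have eq: "(\<Sum>\<delta>\<in>degs (W l). scal (c (Inl \<delta>)) * h \<delta>) + F * Mcomb M (c \<circ> Inr) = 0"
      using Mcomb_mult[of "c \<circ> Inr" F M] finM by (simp add: sum.Plus H_def)
    have "(\<Sum>\<delta>\<in>degs (W l). smult (c (Inl \<delta>)) (subst3 Q (h \<delta>))) = 0"
      using arg_cong[OF eq, of "subst3 Q"] by (simp add: FQ subst3_sum)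
    then have c1: "c (Inl \<delta>) = 0" if "\<delta> \<in> degs (W l)" for \<delta>
      using distinct_degrees_independent[OF finite_degs_W, of l "\<lambda>\<delta>. subst3 Q (h \<delta>)" "\<lambda>\<delta>. c (Inl \<delta>)"] h that
      by blast
    then have "Mcomb M (c \<circ> Inr) = 0" using eq F0 by simp
    then have c2: "c (Inr y) = 0" if "y \<in> M" for y
      using Mcomb_0_imp[OF finM _ that] by fastforce
    show "\<forall>b\<in>?B. c b = 0" using c1 c2 by auto
  qed
  then show "card (degs (W l)) \<le> card (Mon l) - (if d \<le> l then card (Mon (l - d)) else 0)"
    using finM by (simp add: card_Plus M_def split: if_splits)
qed

lemma card_degs_W_small: "l < d \<Longrightarrow> 2 * card (degs (W l)) = (l + 1) * (l + 2)"
  using card_degs_W[of l] card_Mon[of l] by simp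

text \<open>Over the integers \<open>(l - d + 1) * (l - d + 2)\<close> also vanishes for
  \<open>l = d - 1\<close> and \<open>l = d - 2\<close>, so the count for \<open>l >= d\<close>
  extends to these two degrees.\<close>

lemma card_degs_W_large:
  assumes "d \<ge> 1" "d \<le> l + 2"
  shows "2 * card (degs (W l)) + (d - 1) * (d - 2) = 2 * (l * d + 1)"
proof -
  have d: "int ((d - 1) * (d - 2)) = (int d - 1) * (int d - 2)"
    using assms(1) by (cases "d = 1") (auto simp: of_nat_diff)
  have "2 * int (card (degs (W l))) + (int d - 1) * (int d - 2) = 2 * (int l * int d + 1)"
  proof (cases "d \<le> l")
    case True
    have "card (Mon (l - d)) \<le> card (Mon l)"
      using card_Mon[of l] card_Mon[of "l - d"] mult_le_mono[of "l - d + 1" "l + 1" "l - d + 2" "l + 2"]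
      by simp
    then have "2 * int (card (degs (W l))) = int (2 * card (Mon l)) - int (2 * card (Mon (l - d)))"
      using card_degs_W[of l] True by (simp add: of_nat_diff)
    also have "\<dots> = (int l + 1) * (int l + 2) - (int l - int d + 1) * (int l - int d + 2)"
      unfolding card_Mon of_nat_mult of_nat_add of_nat_diff[OF True] by simp
    finally show ?thesis by (simp add: algebra_simps)
  next
    case False
    then have "2 * int (card (degs (W l))) = (int l + 1) * (int l + 2)"
      using card_degs_W_small[of l] by (metis not_le of_nat_1 of_nat_add of_nat_mult of_nat_numeral)
    moreover have "int d = int l + 1 \<or> int d = int l + 2" using False assms by linarith
    ultimately show ?thesis by (auto simp: algebra_simps)
  qed
  then have "int (2 * card (degs (W l)) + (d - 1) * (d - 2)) = int (2 * (l * d + 1))"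
    using d by simp
  then show ?thesis by presburger
qed

end

section \<open>Frames and affine charts\<close>

text \<open>An element \<open>f\<close> that is nonzero on \<open>Z\<close> and an element
  \<open>g\<close> that is nonzero at \<open>z\<close> are combined to \<open>c * f + g\<close>;
  only finitely many values of \<open>c\<close> create a zero at one of the points.\<close>

lemma poly_subspace_avoid_zeros:
  assumes V: "poly_subspace V" and "finite Z" and "\<And>z. z \<in> Z \<Longrightarrow> \<exists>f\<in>V. poly f z \<noteq> 0"
  shows "\<exists>f\<in>V. \<forall>z\<in>Z. poly f z \<noteq> 0"
  using assms(2,3)
proof (induction Z rule: finite_induct)
  case empty
  then show ?case using V by (auto simp: poly_subspace_def)
next
  case (insert z Z)
  obtain f where f: "f \<in> V" "\<forall>z\<in>Z. poly f z \<noteq> 0"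
    using insert.IH insert.prems by blast
  obtain g where g: "g \<in> V" "poly g z \<noteq> 0" using insert.prems by blast
  define bad where "bad = (\<lambda>y. - poly g y / poly f y) ` insert z Z \<union> {0}"
  have "finite bad" using insert.hyps by (simp add: bad_def)
  then obtain c where c: "c \<notin> bad" using ex_new_if_finite[OF infinite_UNIV_char_0] by blast
  define h where "h = smult c f + g"
  have "h \<in> V" using f g V by (auto simp: h_def poly_subspace_def)
  moreover have "poly h y \<noteq> 0" if "y \<in> insert z Z" for y
  proof (cases "poly f y = 0")
    case True
    then have "y = z" using f that by auto
    then show ?thesis using True g by (simp add: h_def)
  next
    case False
    then have "c \<noteq> - poly g y / poly f y" using c that unfolding bad_def by blast
    moreover have "c = - poly g y / poly f y" if "poly h y = 0"
    proof -
      have "c * poly f y = - poly g y" using that by (simp add: h_def eq_neg_iff_add_eq_0)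
      then show ?thesis using False by (metis nonzero_eq_divide_eq)
    qed
    ultimately show ?thesis by blast
  qed
  ultimately show ?case by blast
qed

lemma coprime_poly_if_no_common_root:
  assumes "A \<noteq> (0 :: complex poly)" "\<And>z. poly A z = 0 \<Longrightarrow> poly B z \<noteq> 0"
  shows "coprime A B"
proof (rule ccontr)
  assume "\<not> coprime A B"
  then obtain c where c: "c dvd A" "c dvd B" "\<not> is_unit c" by (auto simp: coprime_def)
  have "c \<noteq> 0" using c assms(1) by auto
  then have "degree c \<noteq> 0" using c(3) by (metis is_unit_iff_degree)
  then have "\<not> constant (poly c)" by (simp add: constant_degree)
  then obtain z where "poly c z = 0" 
    using Fundamental_Theorem_Algebra.fundamental_theorem_of_algebra by blast
  then have "poly A z = 0" "poly B z = 0" using c(1,2) by (metis dvdE mult_zero_left poly_mult)+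
  then show False using assms(2) by blast
qed

text \<open>Reducing the multiplier of \<open>B\<close> modulo \<open>A\<close> bounds its degree;
  the degree of the other multiplier is then forced by the identity. For \<open>a = 0\<close> the
  truncated \<open>a - 1\<close> is \<open>0\<close>, and the reduced multiplier is zero.\<close>

lemma bezout_degree_bound:
  fixes A B f :: "complex poly"
  assumes "coprime A B" "degree A = a" "A \<noteq> 0" "degree B \<le> b" "degree f \<le> a + n" "b \<le> n + 1"
  shows "\<exists>x y. f = x * A + y * B \<and> degree x \<le> n \<and> degree y \<le> a - 1"
proof -
  obtain r s where rs: "r * A + s * B = 1"
    using bezout_coefficients_fst_snd[of A B] assms(1) by (metis coprime_imp_gcd_eq_1)
  define y where "y = (f * s) mod A"
  have dy: "degree y \<le> a - 1"
  proof (cases "a = 0")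
    case True
    then have "is_unit A" using assms by (simp add: is_unit_iff_degree)
    then show ?thesis by (simp add: y_def mod_eq_0_iff_dvd unit_imp_dvd)
  next
    case False
    then have "degree y < a \<or> y = 0" unfolding y_def using degree_mod_less[of A "f * s"] assms by auto
    then show ?thesis using False by auto
  qed
  define x where "x = f * r + (f * s div A) * B"
  have "x * A + y * B = f * r * A + ((f * s div A) * A + y) * B" by (simp add: x_def algebra_simps)
  also have "(f * s div A) * A + y = f * s" by (simp add: y_def)
  also have "f * r * A + f * s * B = f * (r * A + s * B)" by (simp add: algebra_simps)
  finally have f: "f = x * A + y * B" using rs by simp
  have "degree x \<le> n"
  proof (cases "x = 0")
    case False
    have xA: "x * A = f - y * B" by (subst f) simp
    have "degree (y * B) \<le> a + n"
    proof (cases "a = 0")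
      case True
      then have "is_unit A" using assms by (simp add: is_unit_iff_degree)
      then have "y = 0" by (simp add: y_def mod_eq_0_iff_dvd unit_imp_dvd)
      then show ?thesis by simp
    next
      case False
      have "degree (y * B) \<le> (a - 1) + b" using dy assms by (intro order_trans[OF degree_mult_le] add_mono)
      then show ?thesis using False assms by linarith
    qed
    then have "degree (x * A) \<le> a + n" unfolding xA using assms by (intro degree_diff_le) auto
    moreover have "degree (x * A) = degree x + a" using False assms by (subst degree_mult_eq) auto
    ultimately show ?thesis by simp
  qed simp
  then show ?thesis using f dy by blast
qed

text \<open>The bilinear pairing, without conjugation, so that \<open>lin w\<close> evaluates to
  \<open>dot3 w\<close>.\<close>

definition dot3 :: "complex^3 \<Rightarrow> complex^3 \<Rightarrow> complex" where
  "dot3 w q = w $ 1 * q $ 1 + w $ 2 * q $ 2 + w $ 3 * q $ 3"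

lemma eval3_lin_dot3: "eval3 (lin w) q = dot3 w q"
  by (simp add: dot3_def)

lemma vec3_eq_iff: "(x :: complex^3) = y \<longleftrightarrow> x $ 1 = y $ 1 \<and> x $ 2 = y $ 2 \<and> x $ 3 = y $ 3"
  by (simp add: vec_eq_iff forall_3)

text \<open>Three choices of \<open>w\<close> annihilating \<open>p\<close> are tested; if all of
  them annihilate \<open>q\<close> as well, the cross product of \<open>p\<close> and
  \<open>q\<close> is zero.\<close>

lemma not_parallel_imp_separated:
  fixes p q :: "complex^3"
  assumes "p \<noteq> 0" "\<And>\<mu>. q \<noteq> \<mu> *s p"
  shows "\<exists>w. dot3 w p = 0 \<and> dot3 w q \<noteq> 0"
proof (rule ccontr)
  assume "\<not> ?thesis"
  then have *: "dot3 w p = 0 \<Longrightarrow> dot3 w q = 0" for w by blast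
  have div: "b = d / a * c" if "a \<noteq> 0" "a * b = c * d" for a b c d :: complex
    using that by (metis mult.commute nonzero_mult_div_cancel_left times_divide_eq_left)
  have e12: "p $ 1 * q $ 2 = p $ 2 * q $ 1"
    using *[of "vector [- p $ 2, p $ 1, 0]"] by (simp add: dot3_def algebra_simps)
  have e13: "p $ 1 * q $ 3 = p $ 3 * q $ 1"
    using *[of "vector [- p $ 3, 0, p $ 1]"] by (simp add: dot3_def algebra_simps)
  have e23: "p $ 2 * q $ 3 = p $ 3 * q $ 2"
    using *[of "vector [0, - p $ 3, p $ 2]"] by (simp add: dot3_def algebra_simps)
  have "\<exists>\<mu>. q = \<mu> *s p"
  proof -
    consider "p $ 1 \<noteq> 0" | "p $ 2 \<noteq> 0" | "p $ 3 \<noteq> 0" using assms(1) by (auto simp: vec3_eq_iff)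
    then show ?thesis
    proof cases
      case 1
      then have "q = (q $ 1 / p $ 1) *s p"
        using div[OF _ e12] div[OF _ e13] by (simp add: vec3_eq_iff)
      then show ?thesis by blast
    next
      case 2
      then have "q = (q $ 2 / p $ 2) *s p"
        using div[OF _ e12[symmetric]] div[OF _ e23] by (simp add: vec3_eq_iff)
      then show ?thesis by blast
    next
      case 3
      then have "q = (q $ 3 / p $ 3) *s p"
        using div[OF _ e13[symmetric]] div[OF _ e23[symmetric]] by (simp add: vec3_eq_iff)
      then show ?thesis by blast
    qed
  qed
  then show False using assms(2) by blast
qed

text \<open>The value of the parametrization at \<open>t = \<infinity>\<close>, in homogeneous
  coordinates.\<close>

definition top_coeffs :: "complex poly^3 \<Rightarrow> nat \<Rightarrow> complex^3" where
  "top_coeffs Q e = (\<chi> i. coeff (Q $ i) e)"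

lemma poly_subst3_lin: "poly (subst3 Q (lin w)) t = dot3 w (pev Q t)"
  by (simp add: dot3_def)

lemma coeff_subst3_lin: "coeff (subst3 Q (lin w)) e = dot3 w (top_coeffs Q e)"
  by (simp add: subst3_lin dot3_def top_coeffs_def)

text \<open>Gaussian elimination replaces the determinant of \<open>M\<close>: each step preserves the diagonal
  shape of \<open>M\<close> at \<open>p\<close>.\<close>

lemma eliminate_rows:
  assumes "\<And>i j. i < Suc n \<Longrightarrow> j < Suc n \<Longrightarrow> homogeneous D (M j i)"
    and "\<And>j. j < Suc n \<Longrightarrow> (\<Sum>i<Suc n. subst3 Q (M j i) * w i) = 0"
    and "\<And>i j. i < Suc n \<Longrightarrow> j < Suc n \<Longrightarrow> i \<noteq> j \<Longrightarrow> eval3 (M j i) p = 0"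
    and "\<And>i. i < Suc n \<Longrightarrow> eval3 (M i i) p \<noteq> 0"
    and "w 0 = 1"
  shows "\<exists>D' G. homogeneous D' G \<and> subst3 Q G = 0 \<and> eval3 G p \<noteq> 0"
  using assms(1-4)
proof (induction n arbitrary: D M)
  case 0
  then show ?case using assms(5) by (intro exI[of _ D] exI[of _ "M 0 0"]) auto
next
  case (Suc n)
  let ?N = "Suc n"
  define M' where "M' = (\<lambda>j i. M ?N ?N * M j i - M j ?N * M ?N i)"
  show ?case
  proof (rule Suc.IH[of "D + D" M'])
    show "homogeneous (D + D) (M' j i)" if "i < ?N" "j < ?N" for i j
      unfolding M'_def using that by (intro homogeneous_diff homogeneous_mult Suc.prems(1)) auto
    show "eval3 (M' j i) p = 0" if "i < ?N" "j < ?N" "i \<noteq> j" for i j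
      using that Suc.prems(3)[of i j] Suc.prems(3)[of ?N j] by (simp add: M'_def)
    show "eval3 (M' i i) p \<noteq> 0" if "i < ?N" for i
      using that Suc.prems(4)[of i] Suc.prems(4)[of ?N] Suc.prems(3)[of ?N i] by (simp add: M'_def)
    fix j assume j: "j < ?N"
    let ?S = "\<lambda>j. \<Sum>i<?N. subst3 Q (M j i) * w i"
    have 1: "?S j = - (subst3 Q (M j ?N) * w ?N)"
      using Suc.prems(2)[of j] j by (simp add: add_eq_0_iff)
    have 2: "?S ?N = - (subst3 Q (M ?N ?N) * w ?N)"
      using Suc.prems(2)[of ?N] by (simp add: add_eq_0_iff)
    have "(\<Sum>i<?N. subst3 Q (M' j i) * w i) = subst3 Q (M ?N ?N) * ?S j - subst3 Q (M j ?N) * ?S ?N"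
      unfolding M'_def by (simp add: sum_distrib_left algebra_simps sum_subtractf del: sum.lessThan_Suc)
    also have "\<dots> = 0" unfolding 1 2 by simp
    finally show "(\<Sum>i<?N. subst3 Q (M' j i) * w i) = 0" .
  qed
qed

section \<open>Partial derivatives and singular points\<close>

lemma map_poly_add_hom:
  assumes "\<delta> 0 = 0" "\<And>a b. \<delta> (a + b) = \<delta> a + \<delta> b"
  shows "map_poly \<delta> (f + g) = map_poly \<delta> f + map_poly \<delta> g"
  using assms by (intro poly_eqI) (simp add: coeff_map_poly)

lemma map_poly_derivation:
  fixes \<delta> :: "'a :: comm_ring_1 \<Rightarrow> 'a"
  assumes 0: "\<delta> 0 = 0" and add: "\<And>a b. \<delta> (a + b) = \<delta> a + \<delta> b"
    and mult: "\<And>a b. \<delta> (a * b) = \<delta> a * b + a * \<delta> b"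
  shows "map_poly \<delta> (f * g) = map_poly \<delta> f * g + f * map_poly \<delta> g"
proof (rule poly_eqI)
  fix n
  have sum: "\<delta> (\<Sum>i\<in>A. h i) = (\<Sum>i\<in>A. \<delta> (h i))" for h and A :: "nat set"
    by (induction A rule: infinite_finite_induct) (simp_all add: 0 add)
  show "coeff (map_poly \<delta> (f * g)) n = coeff (map_poly \<delta> f * g + f * map_poly \<delta> g) n"
    by (simp add: coeff_map_poly 0 coeff_mult sum mult sum.distrib)
qed

lemma partial_Z_mult: "partial_Z (f * g) = partial_Z f * g + f * partial_Z g"
  by (simp add: partial_Z_def pderiv_mult algebra_simps)

lemma partial_Z_add: "partial_Z (f + g) = partial_Z f + partial_Z g"
  by (simp add: partial_Z_def pderiv_add)

lemma partial_Y_mult: "partial_Y (f * g) = partial_Y f * g + f * partial_Y g"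
  unfolding partial_Y_def by (rule map_poly_derivation) (auto simp: pderiv_add pderiv_mult algebra_simps)

lemma partial_Y_add: "partial_Y (f + g) = partial_Y f + partial_Y g"
  unfolding partial_Y_def by (rule map_poly_add_hom) (auto simp: pderiv_add)

lemma partial_X_mult: "partial_X (f * g) = partial_X f * g + f * partial_X g"
  unfolding partial_X_def
  by (intro map_poly_derivation map_poly_add_hom) (auto simp: pderiv_add pderiv_mult algebra_simps)

lemma partial_X_add: "partial_X (f + g) = partial_X f + partial_X g"
  unfolding partial_X_def
  by (intro map_poly_add_hom) (auto simp: pderiv_add intro!: map_poly_add_hom)

text \<open>By the product rule every term of a partial derivative of \<open>y * A + z * B\<close>
  keeps a factor vanishing at \<open>q\<close>. It is applied in contrapositive form: at a smooth
  point one of the two cofactors is nonzero.\<close>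

lemma singular_point_ideal_square:
  assumes "q \<noteq> 0" "F = y * A + z * B" "eval3 y q = 0" "eval3 z q = 0" "eval3 A q = 0" "eval3 B q = 0"
  shows "singular_point F q"
  using assms(1,3-6) unfolding singular_point_def assms(2)
  by (simp add: partial_X_add partial_X_mult partial_Y_add partial_Y_mult partial_Z_add partial_Z_mult)

lemma mon_mult: "mon i j k * mon i' j' k' = mon (i + i') (j + j') (k + k')"
  by (simp add: mon_def mult_monom)

lemma scal_add: "scal (a + b) = scal a + scal b"
  by (simp add: scal_def)

text \<open>A frame at \<open>q\<close>: \<open>w\<^sub>0, w\<^sub>1, w\<^sub>2\<close> is the basis dual to \<open>q, e\<^sub>1, e\<^sub>2\<close>.\<close>

definition frame :: "complex^3 \<Rightarrow> complex^3 \<Rightarrow> complex^3 \<Rightarrow> complex^3 \<Rightarrow> complex^3 \<Rightarrow> complex^3 \<Rightarrow> bool" where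
  "frame q e1 e2 w0 w1 w2 \<longleftrightarrow>
     dot3 w0 q = 1 \<and> dot3 w0 e1 = 0 \<and> dot3 w0 e2 = 0 \<and>
     dot3 w1 q = 0 \<and> dot3 w1 e1 = 1 \<and> dot3 w1 e2 = 0 \<and>
     dot3 w2 q = 0 \<and> dot3 w2 e1 = 0 \<and> dot3 w2 e2 = 1 \<and>
     (\<forall>w. lin w = scal (dot3 w q) * lin w0 + scal (dot3 w e1) * lin w1 + scal (dot3 w e2) * lin w2) \<and>
     (\<forall>x. x = dot3 w0 x *s q + dot3 w1 x *s e1 + dot3 w2 x *s e2)"

lemma lin_eqI:
  assumes "w $ 1 = a * w0 $ 1 + b * w1 $ 1 + c * w2 $ 1" "w $ 2 = a * w0 $ 2 + b * w1 $ 2 + c * w2 $ 2"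
    "w $ 3 = a * w0 $ 3 + b * w1 $ 3 + c * w2 $ 3"
  shows "lin w = scal a * lin w0 + scal b * lin w1 + scal c * lin w2"
  unfolding lin_def assms by (simp add: algebra_simps scal_add scal_mult)

text \<open>The three cases of \<open>affine_chart\<close> are absorbed into a frame, so that later
  arguments need no case distinction: \<open>q\<close> is the multiple of \<open>p\<close> whose
  distinguished coordinate is 1, and \<open>lin w0\<close> is that coordinate.\<close>

lemma affine_chart_frame:
  assumes "p \<noteq> 0"
  shows "\<exists>q e1 e2 w0 w1 w2 \<mu>. frame q e1 e2 w0 w1 w2 \<and> p = \<mu> *s q \<and> \<mu> \<noteq> 0 \<and>
           (\<forall>x y. affine_chart p (x, y) = q + x *s e1 + y *s e2)"
proof -
  consider "p $ 1 \<noteq> 0" | "p $ 1 = 0" "p $ 2 \<noteq> 0" | "p $ 1 = 0" "p $ 2 = 0" "p $ 3 \<noteq> 0"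
    using assms by (auto simp: vec3_eq_iff)
  then show ?thesis
  proof cases
    case 1
    define a b where "a = p $ 2 / p $ 1" and "b = p $ 3 / p $ 1"
    have "frame (vector [1, a, b]) (vector [0, 1, 0]) (vector [0, 0, 1])
        (vector [1, 0, 0]) (vector [- a, 1, 0]) (vector [- b, 0, 1])"
      unfolding frame_def
      by (intro conjI allI lin_eqI) (simp_all add: dot3_def vec3_eq_iff)
    moreover have "p = p $ 1 *s vector [1, a, b]" using 1 by (simp add: vec3_eq_iff a_def b_def)
    moreover have "affine_chart p (x, y) = vector [1, a, b] + x *s vector [0, 1, 0] + y *s vector [0, 0, 1]" for x y
      using 1 by (simp add: affine_chart_def vec3_eq_iff a_def b_def)
    ultimately show ?thesis using 1 by blast
  next
    case 2
    define b where "b = p $ 3 / p $ 2"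
    have "frame (vector [0, 1, b]) (vector [1, 0, 0]) (vector [0, 0, 1])
        (vector [0, 1, 0]) (vector [1, 0, 0]) (vector [0, - b, 1])"
      unfolding frame_def
      by (intro conjI allI lin_eqI) (simp_all add: dot3_def vec3_eq_iff)
    moreover have "p = p $ 2 *s vector [0, 1, b]" using 2 by (simp add: vec3_eq_iff b_def)
    moreover have "affine_chart p (x, y) = vector [0, 1, b] + x *s vector [1, 0, 0] + y *s vector [0, 0, 1]" for x y
      using 2 by (simp add: affine_chart_def vec3_eq_iff b_def)
    ultimately show ?thesis using 2 by blast
  next
    case 3
    have "frame (vector [0, 0, 1]) (vector [1, 0, 0]) (vector [0, 1, 0])
        (vector [0, 0, 1]) (vector [1, 0, 0]) (vector [0, 1, 0])"
      unfolding frame_def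
      by (intro conjI allI lin_eqI) (simp_all add: dot3_def vec3_eq_iff)
    moreover have "p = p $ 3 *s vector [0, 0, 1]" using 3 by (simp add: vec3_eq_iff)
    moreover have "affine_chart p (x, y) = vector [0, 0, 1] + x *s vector [1, 0, 0] + y *s vector [0, 1, 0]" for x y
      using 3 by (simp add: affine_chart_def vec3_eq_iff)
    ultimately show ?thesis using 3 by blast
  qed
qed

lemma frame_scale:
  assumes "frame q e1 e2 w0 w1 w2" "\<mu> \<noteq> 0"
  shows "frame (\<mu> *s q) e1 e2 ((1 / \<mu>) *s w0) w1 w2"
proof -
  have d1: "dot3 w (\<mu> *s x) = \<mu> * dot3 w x" "dot3 ((1 / \<mu>) *s w) x = dot3 w x / \<mu>" for w x
    using assms(2) by (simp_all add: dot3_def field_simps)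
  have "lin ((1 / \<mu>) *s w0) = scal (1 / \<mu>) * lin w0 + scal 0 * lin 0 + scal 0 * lin 0"
    by (rule lin_eqI) simp_all
  then have sc: "scal (\<mu> * c) * lin ((1 / \<mu>) *s w0) = scal c * lin w0" for c
    using assms(2) by (simp add: mult_ac flip: scal_mult mult.assoc)
  have fl: "lin w = scal (dot3 w q) * lin w0 + scal (dot3 w e1) * lin w1 + scal (dot3 w e2) * lin w2" for w
    using assms(1) unfolding frame_def by blast
  have fx: "x = dot3 w0 x *s q + dot3 w1 x *s e1 + dot3 w2 x *s e2" for x
    using assms(1) unfolding frame_def by blast
  have L: "lin w = scal (dot3 w (\<mu> *s q)) * lin ((1 / \<mu>) *s w0) + scal (dot3 w e1) * lin w1
      + scal (dot3 w e2) * lin w2" for w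
    unfolding d1(1) sc by (rule fl)
  have X: "x = dot3 ((1 / \<mu>) *s w0) x *s (\<mu> *s q) + dot3 w1 x *s e1 + dot3 w2 x *s e2" for x
    unfolding d1(2) vector_smult_assoc using fx[of x] assms(2) by simp
  show ?thesis
    unfolding frame_def
  proof (intro conjI allI)
    show "dot3 ((1 / \<mu>) *s w0) (\<mu> *s q) = 1" "dot3 ((1 / \<mu>) *s w0) e1 = 0" "dot3 ((1 / \<mu>) *s w0) e2 = 0"
      "dot3 w1 (\<mu> *s q) = 0" "dot3 w1 e1 = 1" "dot3 w1 e2 = 0" "dot3 w2 (\<mu> *s q) = 0"
      "dot3 w2 e1 = 0" "dot3 w2 e2 = 1"
      using assms unfolding frame_def d1 by simp_all
  qed (rule L, rule X)
qed

lemma frame_exists: "q \<noteq> 0 \<Longrightarrow> \<exists>e1 e2 w0 w1 w2. frame q e1 e2 w0 w1 w2"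
  using affine_chart_frame[of q] frame_scale by blast

text \<open>First-order Taylor expansion in homogeneous form, with \<open>lin w1\<close> and
  \<open>lin w2\<close> generating the ideal of \<open>q\<close>. The property is stable under
  multiplication by linear forms and under linear combinations, which reduces it to
  monomials.\<close>

lemma local_expansion:
  assumes fr: "frame q e1 e2 w0 w1 w2" and h: "homogeneous (Suc l) h"
  shows "\<exists>A B. homogeneous l A \<and> homogeneous l B \<and>
           h = scal (eval3 h q) * lin w0 ^ Suc l + lin w1 * A + lin w2 * B"
proof -
  define P where "P = (\<lambda>l h. \<exists>A B. homogeneous l A \<and> homogeneous l B \<and>
           h = scal (eval3 h q) * lin w0 ^ Suc l + lin w1 * A + lin w2 * B)"
  have linw: "lin w = scal (dot3 w q) * lin w0 + scal (dot3 w e1) * lin w1 + scal (dot3 w e2) * lin w2" for w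
    using fr unfolding frame_def by blast
  have P0: "P 0 (lin w)" for w
  proof -
    have "lin w = scal (eval3 (lin w) q) * lin w0 ^ Suc 0 + lin w1 * scal (dot3 w e1) + lin w2 * scal (dot3 w e2)"
      using linw[of w] unfolding eval3_lin_dot3 by (simp add: mult.commute)
    then show ?thesis unfolding P_def using homogeneous_scal by blast
  qed
  have Pmult: "P (Suc l) (lin w * h)" if "P l h" for w l h
  proof -
    obtain A B where AB: "homogeneous l A" "homogeneous l B"
      "h = scal (eval3 h q) * lin w0 ^ Suc l + lin w1 * A + lin w2 * B"
      using \<open>P l h\<close> unfolding P_def by blast
    \<comment> \<open>The value \<open>eval3 h q\<close> times the \<open>w1\<close> and
      \<open>w2\<close> components of \<open>lin w\<close> is absorbed by the cofactors.\<close>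
    define A' where "A' = lin w * A + scal (dot3 w e1 * eval3 h q) * lin w0 ^ Suc l"
    define B' where "B' = lin w * B + scal (dot3 w e2 * eval3 h q) * lin w0 ^ Suc l"
    have pw: "homogeneous (Suc l) (lin w0 ^ Suc l)"
      using homogeneous_power[OF homogeneous_lin, of "Suc l" w0] by (simp del: power_Suc)
    have "homogeneous (Suc l) A'" unfolding A'_def
      using homogeneous_mult[OF homogeneous_lin AB(1), of w] pw
      by (intro homogeneous_add homogeneous_scal_mult) auto
    moreover have "homogeneous (Suc l) B'" unfolding B'_def
      using homogeneous_mult[OF homogeneous_lin AB(2), of w] pw
      by (intro homogeneous_add homogeneous_scal_mult) auto
    moreover have "lin w * h = scal (eval3 (lin w * h) q) * lin w0 ^ Suc (Suc l) + lin w1 * A' + lin w2 * B'"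
    proof -
      have "lin w * h = scal (eval3 h q) * lin w0 ^ Suc l *
              (scal (dot3 w q) * lin w0 + scal (dot3 w e1) * lin w1 + scal (dot3 w e2) * lin w2)
            + lin w1 * (lin w * A) + lin w2 * (lin w * B)"
        unfolding linw[of w, symmetric] by (subst AB(3)) (simp add: algebra_simps)
      also have "\<dots> = scal (eval3 (lin w * h) q) * lin w0 ^ Suc (Suc l) + lin w1 * A' + lin w2 * B'"
        unfolding eval3_mult eval3_lin_dot3 A'_def B'_def scal_mult power_Suc
        by (simp only: algebra_simps)
      finally show ?thesis .
    qed
    ultimately show ?thesis unfolding P_def by blast
  qed
  have lin_axis: "lin (vector [1, 0, 0]) = mon 1 0 0" "lin (vector [0, 1, 0]) = mon 0 1 0"
    "lin (vector [0, 0, 1]) = mon 0 0 1"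
    by (simp_all add: lin_def)
  have Pmon: "P l (mon i j k)" if "i + j + k = Suc l" for i j k l
    using that
  proof (induction l arbitrary: i j k)
    case 0
    then consider "i = 1" "j = 0" "k = 0" | "i = 0" "j = 1" "k = 0" | "i = 0" "j = 0" "k = 1" by force
    then show ?case using P0 lin_axis by cases metis+
  next
    case (Suc l)
    then consider i' where "i = Suc i'" | j' where "j = Suc j'" | k' where "k = Suc k'"
      by (metis Zero_not_Suc add_0 not0_implies_Suc)
    then show ?case
    proof cases
      case 1
      then have "P (Suc l) (lin (vector [1, 0, 0]) * mon i' j k)"
        using Suc by (intro Pmult Suc.IH) simp
      then show ?thesis using 1 by (simp add: lin_axis mon_mult)
    next
      case 2
      then have "P (Suc l) (lin (vector [0, 1, 0]) * mon i j' k)"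
        using Suc by (intro Pmult Suc.IH) simp
      then show ?thesis using 2 by (simp add: lin_axis mon_mult)
    next
      case 3
      then have "P (Suc l) (lin (vector [0, 0, 1]) * mon i j k')"
        using Suc by (intro Pmult Suc.IH) simp
      then show ?thesis using 3 by (simp add: lin_axis mon_mult)
    qed
  qed
  have Padd: "P l (f + scal c * g)" if "P l f" "P l g" for f g c l
  proof -
    obtain A B where AB: "homogeneous l A" "homogeneous l B"
      "f = scal (eval3 f q) * lin w0 ^ Suc l + lin w1 * A + lin w2 * B"
      using \<open>P l f\<close> unfolding P_def by blast
    obtain A' B' where AB': "homogeneous l A'" "homogeneous l B'"
      "g = scal (eval3 g q) * lin w0 ^ Suc l + lin w1 * A' + lin w2 * B'"
      using \<open>P l g\<close> unfolding P_def by blast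
    have "f + scal c * g = (scal (eval3 f q) * lin w0 ^ Suc l + lin w1 * A + lin w2 * B)
        + scal c * (scal (eval3 g q) * lin w0 ^ Suc l + lin w1 * A' + lin w2 * B')"
      by (simp only: flip: AB(3) AB'(3))
    also have "\<dots> = scal (eval3 (f + scal c * g) q) * lin w0 ^ Suc l
        + lin w1 * (A + scal c * A') + lin w2 * (B + scal c * B')"
      by (simp add: scal_add scal_mult algebra_simps)
    finally have "f + scal c * g = scal (eval3 (f + scal c * g) q) * lin w0 ^ Suc l
        + lin w1 * (A + scal c * A') + lin w2 * (B + scal c * B')" .
    moreover have "homogeneous l (A + scal c * A')" "homogeneous l (B + scal c * B')"
      using AB(1,2) AB'(1,2) by (auto intro: homogeneous_add homogeneous_scal_mult)
    ultimately show ?thesis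
      unfolding P_def by (rule_tac x="A + scal c * A'" in exI, rule_tac x="B + scal c * B'" in exI) simp
  qed
  have "P l (\<Sum>b\<in>X. scal (c b) * f b)" if "\<And>b. b \<in> X \<Longrightarrow> P l (f b)" for X and c :: "nat \<times> nat \<times> nat \<Rightarrow> complex" and f
    using that
  proof (induction X rule: infinite_finite_induct)
    case (insert x X)
    then have "P l (\<Sum>b\<in>X. scal (c b) * f b)" "P l (f x)" by blast+
    then have "P l ((\<Sum>b\<in>X. scal (c b) * f b) + scal (c x) * f x)" by (rule Padd)
    then show ?case using insert by (simp add: add.commute)
  qed (simp_all add: P_def, (rule exI[of _ 0], simp, rule exI[of _ 0], simp)+)
  from this[of "Mon (Suc l)" "\<lambda>b. mon (fst b) (fst (snd b)) (snd (snd b))"]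
  have "P l (Mcomb (Mon (Suc l)) c)" for c
    unfolding Mcomb_def case_prod_unfold prod.collapse using Pmon by (simp add: Mon_def case_prod_unfold)
  then have "P l h" by (subst homogeneous_expand[OF h])
  then show ?thesis unfolding P_def .
qed

lemma homogeneous_dvd_degree_le:
  assumes "homogeneous d F" "homogeneous l h" "h \<noteq> 0" "F dvd h"
  shows "d \<le> l"
proof -
  have "F \<noteq> 0" using assms by auto
  then obtain i0 j0 k0 where e: "i0 + j0 + k0 = d"
    "\<And>q. q \<noteq> 0 \<Longrightarrow> \<exists>i j k. coeff3 (F * q) (i0 + i) (j0 + j) (k0 + k) \<noteq> 0"
    using leading_monomial assms(1) by metis
  obtain q where q: "h = F * q" using assms(4) by (auto elim: dvdE)
  then have "q \<noteq> 0" using assms(3) by auto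
  then obtain i j k where "coeff3 h (i0 + i) (j0 + j) (k0 + k) \<noteq> 0" using e(2) q by blast
  then have "(i0 + i) + (j0 + j) + (k0 + k) = l" using assms(2) by (simp add: homogeneous_def)
  then show ?thesis using e(1) by simp
qed

lemma lin_eq_0_iff: "lin w = 0 \<longleftrightarrow> w = 0"
proof
  assume "lin w = 0"
  then have "coeff3 (lin w) 1 0 0 = 0" "coeff3 (lin w) 0 1 0 = 0" "coeff3 (lin w) 0 0 1 = 0" by simp_all
  then show "w = 0" by (simp add: lin_def coeff3_mon vec3_eq_iff)
qed (simp add: lin_def)

section \<open>Parametrizations without base points\<close>

lemma poly_eqI_nonzero:
  assumes "\<And>t. t \<noteq> 0 \<Longrightarrow> poly p t = poly q t"
  shows "p = (q :: complex poly)"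
proof -
  have "[:0, 1:] * p = [:0, 1:] * q"
  proof (rule poly_eqI_eval)
    show "poly ([:0, 1:] * p) t = poly ([:0, 1:] * q) t" for t
      using assms[of t] by (cases "t = 0") simp_all
  qed
  then show ?thesis by simp
qed

text \<open>No base points, neither at finite parameters nor at infinity: the coordinates define a
  morphism from the whole projective line.\<close>

locale reduced_parametrization = parametrized_curve +
  assumes pev_nz: "pev Q t \<noteq> 0" and top_nz: "top_coeffs Q e \<noteq> 0"
begin

lemma e_pos: "e > 0"
proof (rule ccontr)
  assume "\<not> e > 0"
  then have "degree (subst3 Q u) = 0" using W_degree[OF subst3_in_W[OF homu]] by simp
  moreover have "degree (subst3 Q u) = 1 + degree (subst3 Q v)"
    unfolding uvQ using vQ by (subst degree_mult_eq) auto
  ultimately show False by simp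
qed

lemma linear_pencil_subspace: "poly_subspace ((\<lambda>w. subst3 Q (lin w)) ` {w. dot3 w p = 0})"
  unfolding poly_subspace_def
proof (intro conjI ballI allI)
  let ?V = "(\<lambda>w. subst3 Q (lin w)) ` {w. dot3 w p = 0}"
  show "0 \<in> ?V" by (rule image_eqI[of _ _ 0]) (auto simp: lin_eq_0_iff dot3_def lin_def)
  fix f assume "f \<in> ?V"
  then obtain w where w: "f = subst3 Q (lin w)" "dot3 w p = 0" by auto
  show "smult c f \<in> ?V" for c
  proof (rule image_eqI[of _ _ "c *s w"])
    show "smult c f = subst3 Q (lin (c *s w))" by (rule poly_eqI_eval) (simp add: w algebra_simps)
    have "dot3 (c *s w) p = c * dot3 w p" by (simp add: dot3_def algebra_simps)
    then show "c *s w \<in> {w. dot3 w p = 0}" using w(2) by simp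
  qed
  fix g assume "g \<in> ?V"
  then obtain w' where w': "g = subst3 Q (lin w')" "dot3 w' p = 0" by auto
  show "f + g \<in> ?V"
  proof (rule image_eqI[of _ _ "w + w'"])
    show "f + g = subst3 Q (lin (w + w'))" by (rule poly_eqI_eval) (simp add: w w' algebra_simps)
    have "dot3 (w + w') p = dot3 w p + dot3 w' p" by (simp add: dot3_def algebra_simps)
    then show "w + w' \<in> {w. dot3 w p = 0}" using w(2) w'(2) by simp
  qed
qed

lemma degree_subst3_lin_le: "degree (subst3 Q (lin w)) \<le> e"
  using W_degree[OF subst3_in_W[OF homogeneous_lin]] by simp

lemma coprime_pencil_pair:
  assumes "\<And>t. \<exists>w. dot3 w p = 0 \<and> dot3 w (pev Q t) \<noteq> 0"
    and "\<exists>w. dot3 w p = 0 \<and> dot3 w (top_coeffs Q e) \<noteq> 0"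
  obtains wA wB where "dot3 wA p = 0" "dot3 wB p = 0"
    "degree (subst3 Q (lin wA)) = e" "subst3 Q (lin wA) \<noteq> 0"
    "coprime (subst3 Q (lin wA)) (subst3 Q (lin wB))"
proof -
  obtain wA where wA: "dot3 wA p = 0" "dot3 wA (top_coeffs Q e) \<noteq> 0" using assms(2) by blast
  let ?A = "subst3 Q (lin wA)"
  have c: "coeff ?A e \<noteq> 0" using wA(2) by (simp only: coeff_subst3_lin not_False_eq_True)
  then have A: "degree ?A = e" "?A \<noteq> 0"
    using le_degree[OF c] degree_subst3_lin_le[of wA] by auto
  have "finite {z. poly ?A z = 0}" using A(2) by (rule poly_roots_finite)
  moreover have "\<exists>f\<in>(\<lambda>w. subst3 Q (lin w)) ` {w. dot3 w p = 0}. poly f z \<noteq> 0" for z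
    using assms(1)[of z] by (auto simp: poly_subst3_lin simp del: poly_subst3)
  ultimately obtain f where f: "f \<in> (\<lambda>w. subst3 Q (lin w)) ` {w. dot3 w p = 0}"
      "\<forall>z\<in>{z. poly ?A z = 0}. poly f z \<noteq> 0"
    using poly_subspace_avoid_zeros[OF linear_pencil_subspace] by metis
  then obtain wB where wB: "dot3 wB p = 0" "f = subst3 Q (lin wB)" by blast
  have "coprime ?A (subst3 Q (lin wB))"
    using f(2) unfolding wB(2) by (intro coprime_poly_if_no_common_root[OF A(2)]) blast
  then show thesis using that wA(1) wB(1) A by blast
qed

text \<open>Multiplying polynomials of bounded degree by two coprime restrictions of linear forms
  gains \<open>e\<close> in the degree, by \<open>bezout_degree_bound\<close>; \<open>k\<close> such
  steps give everything. The subspace \<open>V\<close> is arbitrary because the induction replaces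
  it by the set of multipliers that send a given \<open>C\<close> into \<open>V\<close>.\<close>

lemma W_mult_polys:
  assumes N: "N \<ge> e" and V: "poly_subspace V"
    and WV: "\<And>w g. w \<in> W k \<Longrightarrow> degree g \<le> N \<Longrightarrow> w * g \<in> V"
    and f: "degree f \<le> N + k * e"
  shows "f \<in> V"
proof -
  have sep: "\<exists>w. dot3 w 0 = 0 \<and> dot3 w x \<noteq> 0" if x: "x \<noteq> 0" for x
  proof -
    consider "x $ 1 \<noteq> 0" | "x $ 2 \<noteq> 0" | "x $ 3 \<noteq> 0" using x by (auto simp: vec3_eq_iff)
    then show ?thesis
    proof cases
      case 1 then show ?thesis by (intro exI[of _ "vector [1, 0, 0]"]) (simp add: dot3_def)
    next
      case 2 then show ?thesis by (intro exI[of _ "vector [0, 1, 0]"]) (simp add: dot3_def)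
    next
      case 3 then show ?thesis by (intro exI[of _ "vector [0, 0, 1]"]) (simp add: dot3_def)
    qed
  qed
  obtain wA wB where AB: "degree (subst3 Q (lin wA)) = e" "subst3 Q (lin wA) \<noteq> 0"
    "coprime (subst3 Q (lin wA)) (subst3 Q (lin wB))"
    using coprime_pencil_pair[of 0] sep[OF pev_nz] sep[OF top_nz] by blast
  let ?A = "subst3 Q (lin wA)" and ?B = "subst3 Q (lin wB)"
  have AW: "?A \<in> W 1" "?B \<in> W 1" by (simp_all add: subst3_in_W del: One_nat_def)
  show ?thesis
    using V WV f
  proof (induction k arbitrary: V f)
    case 0
    have "1 \<in> W 0" using subst3_in_W[of 0 1] by simp
    then show ?case using 0(2)[of 1 f] 0(3) by simp
  next
    case (Suc k)
    have "degree f \<le> e + (N + k * e)" using Suc.prems by simp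
    then obtain x y where xy: "f = x * ?A + y * ?B" "degree x \<le> N + k * e" "degree y \<le> e - 1"
      using bezout_degree_bound[OF AB(3,1,2) degree_subst3_lin_le, where f = f and n = "N + k * e"] N by auto
    have *: "g * C \<in> V" if "C \<in> W 1" "degree g \<le> N + k * e" for g C
    proof -
      let ?V = "{g. g * C \<in> V}"
      have "g \<in> ?V"
      proof (rule Suc.IH[OF _ _ that(2)])
        show "poly_subspace ?V" using Suc.prems(1) unfolding poly_subspace_def
          by (simp add: distrib_right)
        fix w g' :: "complex poly" assume "w \<in> W k" "degree g' \<le> N"
        then have "(w * C) * g' \<in> V" using W_mult[OF _ that(1)] by (intro Suc.prems(2)) auto
        then show "w * g' \<in> ?V" by (simp add: mult_ac)
      qed
      then show ?thesis by simp
    qed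
    have "x * ?A \<in> V" "y * ?B \<in> V" using * AW xy(2,3) N by auto
    then show ?case using Suc.prems(1) unfolding xy(1) poly_subspace_def by blast
  qed
qed

text \<open>If \<open>p\<close> were missed, two lines through \<open>p\<close> would restrict to
  coprime \<open>?A\<close> and \<open>?B\<close>, and each \<open>t^j * ?a\<close> with
  \<open>j < e\<close> would be a combination of them with coefficients of degree below
  \<open>e\<close>. As in the Cayley-Hamilton argument, the determinant of this system is a form
  vanishing on the curve. At \<open>p\<close> only the diagonal contributions of
  \<open>lin w0\<close> survive, so it is nonzero there, although \<open>kernel\<close> makes it a
  multiple of \<open>F\<close>.\<close>

lemma point_is_attained:
  assumes p: "p \<noteq> 0" "eval3 F p = 0"
  shows "(\<exists>\<mu>. top_coeffs Q e = \<mu> *s p) \<or> (\<exists>t \<mu>. pev Q t = \<mu> *s p)"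
proof (rule ccontr)
  assume "\<not> ?thesis"
  then have "\<And>t. \<exists>w. dot3 w p = 0 \<and> dot3 w (pev Q t) \<noteq> 0"
    "\<exists>w. dot3 w p = 0 \<and> dot3 w (top_coeffs Q e) \<noteq> 0"
    using not_parallel_imp_separated[OF p(1)] by blast+
  then obtain wA wB where AB: "dot3 wA p = 0" "dot3 wB p = 0"
    "degree (subst3 Q (lin wA)) = e" "subst3 Q (lin wA) \<noteq> 0"
    "coprime (subst3 Q (lin wA)) (subst3 Q (lin wB))"
    using coprime_pencil_pair by blast
  let ?A = "subst3 Q (lin wA)" and ?B = "subst3 Q (lin wB)"
  obtain e1 e2 w0 w1 w2 where "frame p e1 e2 w0 w1 w2" using frame_exists[OF p(1)] by blast
  then have w0: "dot3 w0 p = 1" by (simp add: frame_def)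
  let ?a = "subst3 Q (lin w0)"
  obtain n where n: "e = Suc n" using e_pos by (cases e) auto
  have "\<exists>x y. monom 1 j * ?a = x * ?A + y * ?B \<and> degree x \<le> n \<and> degree y \<le> n" if "j \<le> n" for j
  proof -
    have "degree (monom 1 j * ?a) \<le> j + e"
      by (rule order_trans[OF degree_mult_le]) (simp add: degree_monom_eq degree_subst3_lin_le)
    then show ?thesis
      using bezout_degree_bound[OF AB(5,3,4) degree_subst3_lin_le, where f = "monom 1 j * ?a" and n = n] that n by auto
  qed
  then obtain x y where xy: "\<And>j. j \<le> n \<Longrightarrow>
      monom 1 j * ?a = x j * ?A + y j * ?B \<and> degree (x j) \<le> n \<and> degree (y j) \<le> n" by metis
  \<comment> \<open>Row \<open>j\<close> turns \<open>t^j * ?a = x j * ?A + y j * ?B\<close> into a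
    linear relation among the powers of \<open>t\<close> whose coefficients are restrictions of
    linear forms.\<close>
  define M where "M = (\<lambda>j i. (if i = j then lin w0 else 0) - scal (coeff (x j) i) * lin wA
    - scal (coeff (y j) i) * lin wB)"
  have expand: "(\<Sum>i<Suc n. smult (coeff g i) (monom 1 i)) = g" if "degree g \<le> n" for g :: "complex poly"
    using poly_as_sum_of_monoms'[OF that] by (simp add: smult_monom lessThan_Suc_atMost)
  have "\<exists>D' G. homogeneous D' G \<and> subst3 Q G = 0 \<and> eval3 G p \<noteq> 0"
  proof (rule eliminate_rows[where M = M and D = 1 and w = "\<lambda>i. monom 1 i" and n = n])
    show "homogeneous 1 (M j i)" for i j
      unfolding M_def by (intro homogeneous_diff homogeneous_scal_mult) (auto simp del: One_nat_def)
    show "eval3 (M j i) p = 0" if "i \<noteq> j" for i j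
      using that AB(1,2) by (simp add: M_def eval3_lin_dot3 del: eval3_lin)
    show "eval3 (M i i) p \<noteq> 0" for i
      using AB(1,2) w0 by (simp add: M_def eval3_lin_dot3 del: eval3_lin)
    show "monom 1 0 = (1 :: complex poly)" by (simp add: monom_0 one_pCons)
    fix j assume j: "j < Suc n"
    have "(\<Sum>i<Suc n. subst3 Q (M j i) * monom 1 i) =
        (\<Sum>i<Suc n. (if i = j then ?a else 0) * monom 1 i) - (\<Sum>i<Suc n. smult (coeff (x j) i) (monom 1 i)) * ?A
        - (\<Sum>i<Suc n. smult (coeff (y j) i) (monom 1 i)) * ?B"
      unfolding sum_distrib_right sum_subtractf[symmetric]
      by (intro sum.cong refl) (simp add: M_def algebra_simps)
    also have "(\<Sum>i<Suc n. (if i = j then ?a else 0) * monom 1 i) = (\<Sum>i<Suc n. if i = j then ?a * monom 1 i else 0)"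
      by (intro sum.cong) auto
    also have "\<dots> = monom 1 j * ?a" using j by (simp add: sum.delta mult.commute del: sum.lessThan_Suc)
    finally show "(\<Sum>i<Suc n. subst3 Q (M j i) * monom 1 i) = 0"
      using xy[of j] j expand[of "x j"] expand[of "y j"] by (simp del: sum.lessThan_Suc)
  qed
  then obtain D' G where G: "homogeneous D' G" "subst3 Q G = 0" "eval3 G p \<noteq> 0" by blast
  have "F dvd G" using kernel G by blast
  then show False using G(3) p(2) by (auto elim!: dvdE)
qed

end

lemma subst3_scale:
  assumes "homogeneous l h" "\<And>i. Q0 $ i = \<gamma> * Q $ i"
  shows "subst3 Q0 h = \<gamma> ^ l * subst3 Q h"
proof (rule poly_eqI_eval)
  fix t
  have "pev Q0 t = poly \<gamma> t *s pev Q t" using assms(2) by (simp add: vec_eq_iff)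
  then show "poly (subst3 Q0 h) t = poly (\<gamma> ^ l * subst3 Q h) t"
    using eval3_homogeneous_scale[OF assms(1)] by simp
qed

lemma gcd_cofactors_no_common_root:
  fixes a b c :: "complex poly"
  assumes "\<not> (a = 0 \<and> b = 0 \<and> c = 0)"
  obtains \<gamma> a' b' c' where "\<gamma> \<noteq> 0" "a = \<gamma> * a'" "b = \<gamma> * b'" "c = \<gamma> * c'"
    "\<And>t. \<not> (poly a' t = 0 \<and> poly b' t = 0 \<and> poly c' t = 0)"
proof -
  define \<gamma> where "\<gamma> = gcd a (gcd b c)"
  have \<gamma>: "\<gamma> \<noteq> 0" using assms by (auto simp: \<gamma>_def)
  have "\<gamma> dvd a" "\<gamma> dvd b" "\<gamma> dvd c"
    unfolding \<gamma>_def by (blast intro: dvd_trans gcd_dvd1 gcd_dvd2)+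
  then obtain a' b' c' where abc: "a = \<gamma> * a'" "b = \<gamma> * b'" "c = \<gamma> * c'" by (auto elim!: dvdE)
  have "\<not> (poly a' t = 0 \<and> poly b' t = 0 \<and> poly c' t = 0)" for t
  proof
    assume "poly a' t = 0 \<and> poly b' t = 0 \<and> poly c' t = 0"
    then have "[:- t, 1:] dvd a'" "[:- t, 1:] dvd b'" "[:- t, 1:] dvd c'"
      by (simp_all add: poly_eq_0_iff_dvd)
    then have "\<gamma> * [:- t, 1:] dvd \<gamma> * 1"
      unfolding mult_1_right by (subst (2) \<gamma>_def) (intro gcd_greatest; simp only: abc mult_dvd_mono dvd_refl)
    then have "[:- t, 1:] dvd 1" using \<gamma> by (subst (asm) dvd_mult_cancel_left) blast
    then show False by (simp add: is_unit_iff_degree)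
  qed
  then show thesis using that \<gamma> abc by blast
qed

lemma reduced_parametrization_exists:
  assumes F: "homogeneous d F" "irreducible F" "rational_curve F"
  obtains Q e u v m where "reduced_parametrization F d Q e u v m"
proof -
  obtain a b c :: "complex poly" and u v m where abc: "\<not> (a = 0 \<and> b = 0 \<and> c = 0)"
    and hu: "homogeneous m u" and hv: "homogeneous m v"
    and F0: "\<And>t. eval3 F (vector [poly a t, poly b t, poly c t]) = 0"
    and v0: "\<exists>t. eval3 v (vector [poly a t, poly b t, poly c t]) \<noteq> 0"
    and uv: "\<And>t. eval3 v (vector [poly a t, poly b t, poly c t]) \<noteq> 0 \<Longrightarrow>
       eval3 u (vector [poly a t, poly b t, poly c t]) / eval3 v (vector [poly a t, poly b t, poly c t]) = t"
    using F(3) unfolding rational_curve_def Let_def by blast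
  define Q0 :: "complex poly^3" where "Q0 = vector [a, b, c]"
  have pev0: "pev Q0 t = vector [poly a t, poly b t, poly c t]" for t
    by (simp add: vec3_eq_iff Q0_def)
  have FQ0: "subst3 Q0 F = 0" by (rule poly_eqI_eval) (simp add: pev0 F0)
  have vQ0: "subst3 Q0 v \<noteq> 0" using v0 by (metis pev0 poly_0 poly_subst3)
  \<comment> \<open>The quotient identity is given only where the denominator is nonzero; the extra
    factor covers the remaining parameters and is cancelled afterwards.\<close>
  have "subst3 Q0 v * (subst3 Q0 u - [:0, 1:] * subst3 Q0 v) = 0"
  proof (rule poly_eqI_eval)
    fix t
    show "poly (subst3 Q0 v * (subst3 Q0 u - [:0, 1:] * subst3 Q0 v)) t = poly 0 t"
      using uv[of t] by (cases "eval3 v (pev Q0 t) = 0") (auto simp: pev0 divide_eq_eq)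
  qed
  then have uvQ0: "subst3 Q0 u - [:0, 1:] * subst3 Q0 v = 0" using vQ0 by (metis mult_eq_0_iff)
  obtain \<gamma> a' b' c' where g: "\<gamma> \<noteq> 0" "a = \<gamma> * a'" "b = \<gamma> * b'" "c = \<gamma> * c'"
    and nz: "\<And>t. \<not> (poly a' t = 0 \<and> poly b' t = 0 \<and> poly c' t = 0)"
    using gcd_cofactors_no_common_root[OF abc] by metis
  define Q :: "complex poly^3" where "Q = vector [a', b', c']"
  have "Q0 $ i = \<gamma> * Q $ i" for i
    using exhaust_3[of i] by (auto simp: Q0_def Q_def g)
  note sc = subst3_scale[OF _ this]
  define e where "e = Max (range (\<lambda>i. degree (Q $ i)))"
  have le: "degree (Q $ i) \<le> e" for i unfolding e_def by (rule Max_ge) auto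
  have "e \<in> range (\<lambda>i. degree (Q $ i))" unfolding e_def by (rule Max_in) auto
  then obtain i where i: "degree (Q $ i) = e" by auto
  have pn: "pev Q t \<noteq> 0" for t using nz[of t] by (auto simp: vec3_eq_iff Q_def)
  \<comment> \<open>A coordinate of maximal degree has a nonzero coefficient at \<open>e\<close>
    unless it is the zero polynomial; then \<open>e = 0\<close>, and the coordinates are constants
    that do not all vanish.\<close>
  have "\<exists>j. coeff (Q $ j) e \<noteq> 0"
  proof (cases "Q $ i = 0")
    case True
    then have "e = 0" using i by simp
    moreover obtain j where "poly (Q $ j) 0 \<noteq> 0" using pn[of 0] by (auto simp: vec_eq_iff)
    ultimately show ?thesis by (auto simp: poly_0_coeff_0)
  next
    case False
    then have "lead_coeff (Q $ i) \<noteq> 0" by simp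
    then show ?thesis unfolding i by blast
  qed
  then have tn: "top_coeffs Q e \<noteq> 0" by (auto simp: top_coeffs_def vec_eq_iff)
  have "reduced_parametrization F d Q e u v m"
  proof
    show "homogeneous d F" "irreducible F" "homogeneous m u" "homogeneous m v" by fact+
    show "degree (Q $ i) \<le> e" "pev Q t \<noteq> 0" "top_coeffs Q e \<noteq> 0" for i t by fact+
    show "subst3 Q F = 0" using FQ0 sc[OF F(1)] g(1) by simp
    show "subst3 Q v \<noteq> 0" using vQ0 sc[OF hv] by auto
    have "\<gamma> ^ m * (subst3 Q u - [:0, 1:] * subst3 Q v) = 0"
      using uvQ0 sc[OF hv] sc[OF hu] by (simp add: algebra_simps)
    then have "subst3 Q u - [:0, 1:] * subst3 Q v = 0" using g(1) by (metis mult_eq_0_iff power_not_zero)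
    then show "subst3 Q u = [:0, 1:] * subst3 Q v" by simp
  qed
  then show thesis by (rule that)
qed

text \<open>The substitution \<open>t = t\<^sub>0 + 1 / t'\<close> moves the parameter \<open>t\<^sub>0\<close> to infinity.\<close>

lemma (in reduced_parametrization) move_to_infinity:
  obtains Q' where "reduced_parametrization F d Q' e v (u - scal t0 * v) m" "top_coeffs Q' e = pev Q t0"
proof -
  define R where "R = (\<lambda>i. pcompose (Q $ i) [:t0, 1:])"
  \<comment> \<open>This is \<open>t^e * Q (t0 + 1 / t)\<close>, the monomial padding coordinates of
    smaller degree. The new parameter is \<open>1 / (u / v - t0) = v / (u - t0 * v)\<close>, which
    explains the new pair of forms.\<close>
  define Q' :: "complex poly^3" where
    "Q' = (\<chi> i. monom 1 (e - degree (R i)) * reflect_poly (R i))"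
  have dR: "degree (R i) = degree (Q $ i)" for i by (simp add: R_def degree_pcompose)
  have deg: "degree (Q' $ i) \<le> e" for i
  proof -
    have "degree (Q' $ i) \<le> (e - degree (R i)) + degree (R i)"
      unfolding Q'_def vec_lambda_beta
      by (intro order_trans[OF degree_mult_le] add_mono degree_reflect_poly_le) (simp add: degree_monom_eq)
    then show ?thesis using degQ[of i] dR[of i] by simp
  qed
  have p0: "pev Q' 0 = top_coeffs Q e"
  proof -
    have "poly (Q' $ i) 0 = coeff (Q $ i) e" for i
    proof (cases "degree (Q $ i) = e")
      case True
      have "lead_coeff (R i) = lead_coeff (Q $ i)"
        unfolding R_def by (subst lead_coeff_comp) auto
      then show ?thesis using True dR[of i] by (simp add: Q'_def)
    next
      case False
      then have "degree (Q $ i) < e" using degQ[of i] by simp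
      then show ?thesis using dR[of i] by (simp add: Q'_def poly_monom coeff_eq_0)
    qed
    then show ?thesis by (simp add: vec_eq_iff top_coeffs_def)
  qed
  have pt: "pev Q' t = t ^ e *s pev Q (t0 + 1 / t)" if "t \<noteq> 0" for t
  proof -
    have "poly (Q' $ i) t = t ^ e * poly (Q $ i) (t0 + 1 / t)" for i
    proof -
      have "poly (Q' $ i) t = t ^ (e - degree (R i)) * (t ^ degree (R i) * poly (R i) (inverse t))"
        using that by (simp add: Q'_def poly_monom poly_reflect_poly_nz)
      also have "\<dots> = t ^ e * poly (R i) (inverse t)"
        using degQ[of i] dR[of i] by (simp flip: mult.assoc power_add)
      finally show ?thesis by (simp add: R_def poly_pcompose inverse_eq_divide)
    qed
    then show ?thesis by (simp add: vec_eq_iff)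
  qed
  have top: "top_coeffs Q' e = pev Q t0"
  proof -
    have "coeff (Q' $ i) e = poly (Q $ i) t0" for i
    proof -
      have "coeff (Q' $ i) e = coeff (R i) 0"
        using degQ[of i] dR[of i] by (simp add: Q'_def coeff_monom_mult coeff_reflect_poly)
      also have "\<dots> = poly (R i) 0" by (simp add: poly_0_coeff_0)
      finally show ?thesis by (simp add: R_def poly_pcompose)
    qed
    then show ?thesis by (simp add: vec_eq_iff top_coeffs_def)
  qed
  have ev: "eval3 h (pev Q' t) = (t ^ e) ^ l * eval3 h (pev Q (t0 + 1 / t))"
    if "homogeneous l h" "t \<noteq> 0" for h l t
    unfolding pt[OF that(2)] by (rule eval3_homogeneous_scale[OF that(1)])
  have uv: "eval3 u (pev Q s) = s * eval3 v (pev Q s)" for s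
    using arg_cong[OF uvQ, of "\<lambda>p. poly p s"] by simp
  have "reduced_parametrization F d Q' e v (u - scal t0 * v) m"
  proof
    show "homogeneous d F" "irreducible F" "homogeneous m v" by (fact homF irrF homv)+
    show "homogeneous m (u - scal t0 * v)"
      by (intro homogeneous_diff homogeneous_scal_mult homu homv)
    show "degree (Q' $ i) \<le> e" for i by (rule deg)
    show "top_coeffs Q' e \<noteq> 0" unfolding top by (rule pev_nz)
    show "pev Q' t \<noteq> 0" for t
    proof (cases "t = 0")
      case True
      then show ?thesis using p0 top_nz by simp
    next
      case False
      then show ?thesis unfolding pt[OF False] using pev_nz by (simp add: vector_mul_eq_0)
    qed
    show "subst3 Q' F = 0"
    proof (rule poly_eqI_nonzero)
      show "poly (subst3 Q' F) t = poly 0 t" if "t \<noteq> 0" for t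
        using ev[OF homF that] arg_cong[OF FQ, of "\<lambda>p. poly p (t0 + 1 / t)"] by simp
    qed
    have key: "eval3 (u - scal t0 * v) (pev Q' t) = (t ^ e) ^ m * (eval3 v (pev Q (t0 + 1 / t)) / t)"
      if "t \<noteq> 0" for t
      using ev[OF homv that] ev[OF homu that] uv[of "t0 + 1 / t"] by (simp add: algebra_simps)
    show "subst3 Q' v = [:0, 1:] * subst3 Q' (u - scal t0 * v)"
    proof (rule poly_eqI_nonzero)
      fix t :: complex assume t: "t \<noteq> 0"
      show "poly (subst3 Q' v) t = poly ([:0, 1:] * subst3 Q' (u - scal t0 * v)) t"
        unfolding poly_mult poly_subst3 key[OF t] ev[OF homv t] using t by simp
    qed
    show "subst3 Q' (u - scal t0 * v) \<noteq> 0"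
    proof
      assume 0: "subst3 Q' (u - scal t0 * v) = 0"
      have "[:- t0, 1:] * subst3 Q v = 0"
      proof (rule poly_eqI_eval)
        fix s
        show "poly ([:- t0, 1:] * subst3 Q v) s = poly 0 s"
        proof (cases "s = t0")
          case False
          define t where "t = 1 / (s - t0)"
          have t: "t \<noteq> 0" "t0 + 1 / t = s" using False by (simp_all add: t_def)
          have "eval3 (u - scal t0 * v) (pev Q' t) = 0"
            using arg_cong[OF 0, of "\<lambda>p. poly p t"] by simp
          then have "eval3 v (pev Q s) = 0" using key[OF t(1)] t by simp
          then show ?thesis by simp
        qed simp
      qed
      then show False using vQ by (metis mult_eq_0_iff pCons_eq_0_iff one_neq_zero)
    qed
  qed
  then show thesis using top by (rule that)
qed

lemma normal_parametrization_exists: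
  assumes F: "homogeneous d F" "irreducible F" "rational_curve F" and p: "p \<noteq> 0" "eval3 F p = 0"
  obtains Q e u v m \<mu> where "reduced_parametrization F d Q e u v m" "top_coeffs Q e = \<mu> *s p"
proof -
  obtain Q e u v m where r: "reduced_parametrization F d Q e u v m"
    using reduced_parametrization_exists[OF F] by blast
  interpret reduced_parametrization F d Q e u v m by (rule r)
  from point_is_attained[OF p] show thesis
  proof
    assume "\<exists>\<mu>. top_coeffs Q e = \<mu> *s p"
    then show thesis using that r by blast
  next
    assume "\<exists>t \<mu>. pev Q t = \<mu> *s p"
    then obtain t0 \<mu> where t0: "pev Q t0 = \<mu> *s p" by blast
    obtain Q' where "reduced_parametrization F d Q' e v (u - scal t0 * v) m" "top_coeffs Q' e = pev Q t0"
      using move_to_infinity[of t0 thesis] by blast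
    then show thesis using that t0 by metis
  qed
qed

section \<open>Smooth points and restrictions of forms of large degree\<close>

lemma local_expansion_zero:
  assumes "frame q e1 e2 w0 w1 w2" "homogeneous (Suc l) h" "eval3 h q = 0"
  obtains A B where "homogeneous l A" "homogeneous l B" "h = lin w1 * A + lin w2 * B"
proof -
  obtain A B where AB: "homogeneous l A" "homogeneous l B"
      "h = scal (eval3 h q) * lin w0 ^ Suc l + lin w1 * A + lin w2 * B"
    using local_expansion[OF assms(1,2)] by (elim exE conjE) (rule that)
  have "scal (eval3 h q) * lin w0 ^ Suc l = 0" using assms(3) by simp
  then have "h = lin w1 * A + lin w2 * B" by (subst AB(3)) simp
  then show thesis using that AB(1,2) by blast
qed

context reduced_parametrization
begin

text \<open>Multiplying \<open>r\<close> by \<open>B\<close> and replacing \<open>z * B\<close> by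
  \<open>- y * A\<close> modulo \<open>F\<close> makes the result divisible by \<open>y\<close>. On
  the curve \<open>B\<close> is nonzero at \<open>\<alpha>\<close> while \<open>y\<close> vanishes
  there, so cancelling \<open>y\<close> lowers the order; the same operation on \<open>s\<close>
  keeps the quotient \<open>s / r = t\<close>.\<close>

lemma descent_step:
  assumes F: "F = y * A + z * B" and hA: "homogeneous n A" and hB: "homogeneous n B"
    and hy: "homogeneous 1 y" and y0: "y \<noteq> 0" and yq: "eval3 y (pev Q \<alpha>) = 0"
    and Bq: "eval3 B (pev Q \<alpha>) \<noteq> 0" and d: "d \<ge> 2"
    and r: "r = y * A1 + z * B1" "homogeneous l A1" "homogeneous l B1" "subst3 Q r \<noteq> 0"
    and s: "s = y * A2 + z * B2" "homogeneous l A2" "homogeneous l B2"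
    and rs: "subst3 Q s = [:0, 1:] * subst3 Q r"
  shows "\<exists>l r1 s1. homogeneous l r1 \<and> homogeneous l s1 \<and> subst3 Q r1 \<noteq> 0 \<and>
    subst3 Q s1 = [:0, 1:] * subst3 Q r1 \<and> order \<alpha> (subst3 Q r1) < order \<alpha> (subst3 Q r)"
proof -
  define r1 where "r1 = A1 * B - A * B1"
  define s1 where "s1 = A2 * B - A * B2"
  have "B * r = y * r1 + B1 * F" unfolding r(1) r1_def by (subst F) (simp add: algebra_simps)
  from arg_cong[OF this, of "subst3 Q"] have er: "subst3 Q B * subst3 Q r = subst3 Q y * subst3 Q r1"
    by (simp add: FQ)
  have "B * s = y * s1 + B2 * F" unfolding s(1) s1_def by (subst F) (simp add: algebra_simps)
  from arg_cong[OF this, of "subst3 Q"] have es: "subst3 Q B * subst3 Q s = subst3 Q y * subst3 Q s1"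
    by (simp add: FQ)
  have y: "subst3 Q y \<noteq> 0"
    using kernel[OF hy] homogeneous_dvd_degree_le[OF homF hy y0] d by linarith
  have B: "subst3 Q B \<noteq> 0" using Bq by (metis poly_0 poly_subst3)
  have nz: "subst3 Q B * subst3 Q r \<noteq> 0" using B r(4) by simp
  then have r1: "subst3 Q r1 \<noteq> 0" unfolding er by auto
  have "subst3 Q y * subst3 Q s1 = subst3 Q y * ([:0, 1:] * subst3 Q r1)"
    unfolding es[symmetric] rs using er by (metis mult.left_commute)
  then have "subst3 Q s1 = [:0, 1:] * subst3 Q r1" using y by (metis mult_left_cancel)
  moreover have "homogeneous (l + n) r1" "homogeneous (l + n) s1"
    unfolding r1_def s1_def using r(2,3) s(2,3) hA hB
    by (auto intro!: homogeneous_diff intro: homogeneous_mult simp: homogeneous_mult mult.commute[of A])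
  moreover have "order \<alpha> (subst3 Q r1) < order \<alpha> (subst3 Q r)"
  proof -
    have "order \<alpha> (subst3 Q B) = 0" using Bq by (intro order_0I) simp
    moreover have "order \<alpha> (subst3 Q y) \<noteq> 0" 
      using y yq order_root[of "subst3 Q y" \<alpha>] by simp
    moreover have "order \<alpha> (subst3 Q B) + order \<alpha> (subst3 Q r) = order \<alpha> (subst3 Q y) + order \<alpha> (subst3 Q r1)"
      using order_mult[OF nz, of \<alpha>] er order_mult[of "subst3 Q y" "subst3 Q r1" \<alpha>] nz by simp
    ultimately show ?thesis by linarith
  qed
  ultimately show ?thesis using r1 by blast
qed

text \<open>At a smooth point the parameter \<open>t\<close> is a quotient \<open>s / r\<close> of forms with \<open>r\<close> not vanishing there:
  the maximal ideal is generated locally by one linear form, which can be cancelled from \<open>r\<close> and \<open>s\<close>.\<close>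

lemma smooth_point_regular:
  assumes sm: "\<not> singular_point F (pev Q \<alpha>)" and d: "d \<ge> 2"
  shows "\<exists>l r s. homogeneous l r \<and> homogeneous l s \<and>
    subst3 Q s = [:0, 1:] * subst3 Q r \<and> poly (subst3 Q r) \<alpha> \<noteq> 0"
proof -
  let ?q = "pev Q \<alpha>"
  have Fq: "eval3 F ?q = 0" using FQ by (metis poly_0 poly_subst3)
  obtain e1 e2 w0 w1 w2 where fr: "frame ?q e1 e2 w0 w1 w2" using frame_exists[OF pev_nz] by blast
  obtain n where n: "d = Suc n" using d by (cases d) auto
  obtain A B where AB: "homogeneous n A" "homogeneous n B" "F = lin w1 * A + lin w2 * B"
    using local_expansion_zero[OF fr homF[unfolded n] Fq] .
  have dual: "dot3 w1 ?q = 0" "dot3 w2 ?q = 0" "dot3 w1 e1 = 1" "dot3 w2 e2 = 1"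
    using fr unfolding frame_def by blast+
  then have w1: "dot3 w1 ?q = 0" "dot3 w2 ?q = 0" "lin w1 \<noteq> 0" "lin w2 \<noteq> 0"
    by (metis eval3_0 eval3_lin_dot3 zero_neq_one)+
  have sing: "eval3 A ?q \<noteq> 0 \<or> eval3 B ?q \<noteq> 0"
    using singular_point_ideal_square[OF pev_nz AB(3)] w1 sm
    unfolding eval3_lin_dot3 by blast
  have "\<exists>l r s. homogeneous l r \<and> homogeneous l s \<and>
    subst3 Q s = [:0, 1:] * subst3 Q r \<and> poly (subst3 Q r) \<alpha> \<noteq> 0"
    if "homogeneous l r" "homogeneous l s" "subst3 Q r \<noteq> 0" "subst3 Q s = [:0, 1:] * subst3 Q r" for l r s
    using that
  proof (induction "order \<alpha> (subst3 Q r)" arbitrary: l r s rule: less_induct)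
    case less
    show ?case
    proof (cases "poly (subst3 Q r) \<alpha> = 0")
      case False
      then show ?thesis using less.prems by blast
    next
      case True
      then have rq: "eval3 r ?q = 0" by simp
      then have sq: "eval3 s ?q = 0"
        using arg_cong[OF less.prems(4), of "\<lambda>p. poly p \<alpha>"] by simp
      have "l \<noteq> 0"
      proof
        assume "l = 0"
        then have "degree (subst3 Q r) = 0" using W_degree[OF subst3_in_W[OF less.prems(1)]] by simp
        then obtain a where a: "subst3 Q r = [:a:]" by (auto elim: degree_eq_zeroE)
        have "a = 0" using True unfolding a by simp
        then show False using a less.prems(3) by simp
      qed
      then obtain k where k: "l = Suc k" by (cases l) auto
      obtain A1 B1 where r: "homogeneous k A1" "homogeneous k B1" "r = lin w1 * A1 + lin w2 * B1"
        using local_expansion_zero[OF fr less.prems(1)[unfolded k] rq] .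
      obtain A2 B2 where s: "homogeneous k A2" "homogeneous k B2" "s = lin w1 * A2 + lin w2 * B2"
        using local_expansion_zero[OF fr less.prems(2)[unfolded k] sq] .
      have "\<exists>l r1 s1. homogeneous l r1 \<and> homogeneous l s1 \<and> subst3 Q r1 \<noteq> 0 \<and>
        subst3 Q s1 = [:0, 1:] * subst3 Q r1 \<and> order \<alpha> (subst3 Q r1) < order \<alpha> (subst3 Q r)"
      proof (cases "eval3 B ?q = 0")
        case False
        show ?thesis
          using descent_step[OF AB(3,1,2) homogeneous_lin w1(3) _ False d r(3,1,2) less.prems(3) s(3,1,2) less.prems(4)]
            w1(1) unfolding eval3_lin_dot3 by blast
      next
        case True
        then have A: "eval3 A ?q \<noteq> 0" using sing by blast
        have F': "F = lin w2 * B + lin w1 * A" using AB(3) by (simp only: add.commute)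
        have r': "r = lin w2 * B1 + lin w1 * A1" using r(3) by (simp only: add.commute)
        have s': "s = lin w2 * B2 + lin w1 * A2" using s(3) by (simp only: add.commute)
        show ?thesis
          using descent_step[OF F' AB(2,1) homogeneous_lin w1(4) _ A d r' r(2,1) less.prems(3) s' s(2,1) less.prems(4)]
            w1(2) unfolding eval3_lin_dot3 by blast
      qed
      then show ?thesis using less.hyps by blast
    qed
  qed
  from this[OF homv homu vQ uvQ] show ?thesis .
qed

text \<open>The restricted forms of degree \<open>l\<close> that serve as denominators of the
  function \<open>t\<close> within that degree.\<close>

definition J :: "nat \<Rightarrow> complex poly set" where
  "J l = {f \<in> W l. [:0, 1:] * f \<in> W l}"

lemma J_subspace: "poly_subspace (J l)"
  using W_subspace[of l] unfolding poly_subspace_def J_def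
  by (auto simp: distrib_left simp del: mult_pCons_left)

lemma J_mult_W: "f \<in> J k \<Longrightarrow> g \<in> W l \<Longrightarrow> f * g \<in> J (k + l)"
  unfolding J_def by (auto simp del: mult_pCons_left simp flip: mult.assoc intro: W_mult)

text \<open>Each factor \<open>t\<close> of a monomial of \<open>g\<close> is absorbed by one of the
  \<open>N\<close> factors \<open>r\<close>.\<close>

lemma J_power_mult:
  assumes "r \<in> J l" "degree g \<le> N"
  shows "r ^ N * g \<in> W (N * l)"
proof -
  have 1: "r ^ N * monom 1 i \<in> W (N * l)" if "i \<le> N" for i
  proof -
    have "r ^ (N - i) * ([:0, 1:] * r) ^ i \<in> W ((N - i) * l + i * l)"
      using assms(1) by (intro W_mult W_power) (auto simp: J_def)
    moreover have "(N - i) * l + i * l = N * l" using that by (simp flip: add_mult_distrib)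
    moreover have "r ^ (N - i) * ([:0, 1:] * r) ^ i = (r ^ (N - i) * r ^ i) * [:0, 1:] ^ i"
      by (simp only: power_mult_distrib mult_ac)
    moreover have "r ^ (N - i) * r ^ i = r ^ N" using that by (simp flip: power_add)
    ultimately show ?thesis by (simp add: monom_altdef)
  qed
  have "r ^ N * g = (\<Sum>i\<le>N. smult (coeff g i) (r ^ N * monom 1 i))"
    using poly_as_sum_of_monoms'[OF assms(2)]
    by (simp add: smult_monom flip: sum_distrib_left mult_smult_right)
  then show ?thesis using 1 W_subspace by (auto intro!: poly_subspace_sum simp: poly_subspace_def)
qed

text \<open>The elements for different points live in different degrees; powers of a linear form
  that is nonzero at all these points bring them to a common degree.\<close>

lemma J_avoid_zeros:
  assumes "finite Z" "\<And>z. z \<in> Z \<Longrightarrow> \<exists>l. \<exists>r\<in>J l. poly r z \<noteq> 0"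
  shows "\<exists>l. \<exists>r\<in>J l. \<forall>z\<in>Z. poly r z \<noteq> 0"
  using assms
proof (induction Z rule: finite_induct)
  case empty
  have "0 \<in> J 0" using J_subspace unfolding poly_subspace_def by blast
  then show ?case by blast
next
  case (insert z Z)
  obtain l r where r: "r \<in> J l" "\<forall>z\<in>Z. poly r z \<noteq> 0" using insert.IH insert.prems by blast
  obtain l' r' where r': "r' \<in> J l'" "poly r' z \<noteq> 0" using insert.prems by blast
  have "\<exists>f\<in>W 1. poly f x \<noteq> 0" for x
  proof -
    obtain w :: "complex^3" where "dot3 w (pev Q x) \<noteq> 0"
      using not_parallel_imp_separated[of "pev Q x"] frame_exists[OF pev_nz[of x]]
      unfolding frame_def by (metis zero_neq_one)
    then show ?thesis using subst3_in_W[OF homogeneous_lin, of w] poly_subst3_lin[of Q w x] by metis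
  qed
  then obtain L where L: "L \<in> W 1" "\<forall>x\<in>insert z Z. poly L x \<noteq> 0"
    using poly_subspace_avoid_zeros[OF W_subspace, of "insert z Z" 1] insert.hyps by blast
  have a: "r * L ^ l' \<in> J (l + l')" using J_mult_W[OF r(1) W_power[OF L(1), of l']] by simp
  have b: "r' * L ^ l \<in> J (l + l')" using J_mult_W[OF r'(1) W_power[OF L(1), of l]] by (simp add: add.commute)
  have "\<exists>f\<in>J (l + l'). poly f x \<noteq> 0" if "x \<in> insert z Z" for x
  proof (cases "x = z")
    case True
    then have "poly (r' * L ^ l) x \<noteq> 0" using r'(2) L(2) that by simp
    then show ?thesis using b by blast
  next
    case False
    then have "poly (r * L ^ l') x \<noteq> 0" using r(2) L(2) that by simp
    then show ?thesis using a by blast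
  qed
  then show ?case using poly_subspace_avoid_zeros[OF J_subspace, of "insert z Z" "l + l'"] insert.hyps by blast
qed

text \<open>Smoothness at every finite parameter provides denominators of \<open>t\<close> without
  common zero. Their \<open>e\<close>-th powers are coprime, and each of them times all polynomials
  of suitable degree lies in \<open>W l\<close>; Bezout then gives all polynomials up to a constant
  defect in the degree, left for the point at infinity.\<close>

lemma W_cofinite:
  assumes sm: "\<And>\<alpha>. \<not> singular_point F (pev Q \<alpha>)" and d: "d \<ge> 2"
  shows "\<exists>C l0. \<forall>l\<ge>l0. \<forall>f. degree f + C \<le> l * e \<longrightarrow> f \<in> W l"
proof -
  define r0 where "r0 = subst3 Q v"
  have r0: "r0 \<in> J m" "r0 \<noteq> 0"
    unfolding r0_def J_def using vQ subst3_in_W[OF homv] subst3_in_W[OF homu] uvQ by auto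
  have "finite {z. poly r0 z = 0}" using r0(2) by (rule poly_roots_finite)
  moreover have "\<exists>l. \<exists>r\<in>J l. poly r z \<noteq> 0" for z
    using smooth_point_regular[OF sm d, of z] subst3_in_W unfolding J_def
    by (metis (mono_tags, lifting) mem_Collect_eq)
  ultimately obtain l1 r1 where r1: "r1 \<in> J l1" "\<forall>z\<in>{z. poly r0 z = 0}. poly r1 z \<noteq> 0"
    using J_avoid_zeros by metis
  define A where "A = r0 ^ e"
  define B where "B = r1 ^ e"
  have A0: "A \<noteq> 0" using r0(2) by (simp add: A_def)
  have cop: "coprime A B"
    using r1(2) e_pos by (intro coprime_poly_if_no_common_root[OF A0]) (simp add: A_def B_def)
  define a b where "a = degree A" and "b = degree B"
  \<comment> \<open>The power \<open>r^e\<close> supplies all multipliers of degree up to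
    \<open>e\<close>, the bound from which \<open>W_mult_polys\<close> can enlarge the
    degree.\<close>
  have inW: "r ^ e * g \<in> W l" if "r \<in> J k" "e * k \<le> l" "degree g \<le> e + (l - e * k) * e" for r k l g
  proof -
    let ?V = "{g. r ^ e * g \<in> W l}"
    have "g \<in> ?V"
    proof (rule W_mult_polys[OF order_refl _ _ that(3)])
      show "poly_subspace ?V" using W_subspace[of l] unfolding poly_subspace_def
        by (simp add: distrib_left)
      fix w g' :: "complex poly" assume "w \<in> W (l - e * k)" "degree g' \<le> e"
      then have "(r ^ e * g') * w \<in> W (e * k + (l - e * k))"
        using J_power_mult[OF that(1)] by (intro W_mult) auto
      then show "w * g' \<in> ?V" using that(2) by (simp add: mult_ac)
    qed
    then show ?thesis by simp
  qed
  have "f \<in> W l" if l: "l \<ge> e * m + e * l1 + a + b" and f: "degree f + e * m * e \<le> l * e" for l f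
  proof -
    define n where "n = e + (l - e * m) * e"
    have le: "x \<le> x * e" for x using e_pos by simp
    have "degree f \<le> a + n"
      using f l by (simp add: n_def diff_mult_distrib)
    moreover have "b \<le> n + 1" using le[of "l - e * m"] l unfolding n_def by linarith
    ultimately obtain x y where xy: "f = x * A + y * B" "degree x \<le> n" "degree y \<le> a - 1"
      using bezout_degree_bound[OF cop refl A0, of b f n] unfolding a_def b_def by auto
    have "r0 ^ e * x \<in> W l" using xy(2) l by (intro inW[OF r0(1)]) (auto simp: n_def)
    moreover have "r1 ^ e * y \<in> W l"
      using xy(3) l le[of "l - e * l1"] by (intro inW[OF r1(1)]) linarith+
    ultimately show ?thesis using W_subspace[of l] unfolding xy(1) A_def B_def poly_subspace_def
      by (simp add: mult.commute)
  qed
  then show ?thesis by blast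
qed

text \<open>The number of degrees in \<open>W l\<close> is \<open>l * d\<close> up to a constant by
  the count of forms; by \<open>W_cofinite\<close> and the degree bound it is also
  \<open>l * e\<close> up to a constant.\<close>

lemma degree_eq:
  assumes sm: "\<And>\<alpha>. \<not> singular_point F (pev Q \<alpha>)" and d: "d \<ge> 2"
  shows "e = d"
proof -
  obtain C l0 where C: "\<And>l f. l \<ge> l0 \<Longrightarrow> degree f + C \<le> l * e \<Longrightarrow> f \<in> W l"
    using W_cofinite[OF assms] by blast
  define g where "g = (d - 1) * (d - 2)"
  have card: "2 * card (degs (W l)) + g = 2 * (l * d + 1)" if "l \<ge> d" for l
    using card_degs_W_large[of l] d that by (simp add: g_def)
  show "e = d"
  proof (rule antisym)
    show "e \<le> d"
    proof (rule ccontr)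
      assume "\<not> e \<le> d"
      then have ed: "e \<ge> d + 1" by simp
      define l where "l = l0 + d + C"
      have "l * e \<ge> l * (d + 1)" using ed by (rule mult_le_mono2)
      then have le: "l * e \<ge> l * d + l" by simp
      have "{..l * e - C} \<subseteq> degs (W l)"
      proof
        fix n assume "n \<in> {..l * e - C}"
        then have "monom 1 n \<in> W l" using le unfolding l_def
          by (intro C) (auto simp: degree_monom_eq)
        moreover have "monom 1 n \<noteq> (0 :: complex poly)" by (simp add: monom_eq_0_iff)
        ultimately show "n \<in> degs (W l)" unfolding degs_def
          by (intro image_eqI[of _ _ "monom 1 n"]) (auto simp: degree_monom_eq)
      qed
      then have "card {..l * e - C} \<le> card (degs (W l))" by (rule card_mono[OF finite_degs_W])
      then have "l * e + 1 \<le> card (degs (W l)) + C" by simp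
      moreover have "2 * card (degs (W l)) + g = 2 * (l * d + 1)" using card[of l] by (simp add: l_def)
      moreover have "l \<ge> C + d" by (simp add: l_def)
      moreover have False if "x + 1 \<le> n + C" "2 * n + g = 2 * (z + 1)" "l \<ge> C + d" "x \<ge> z + l" "d \<ge> 2"
        for x n z :: nat using that by presburger
      ultimately show False using le d by blast
    qed
    show "d \<le> e"
    proof (rule ccontr)
      assume "\<not> d \<le> e"
      then have "d \<ge> e + 1" by simp
      define l where "l = d + g"
      have "l * (e + 1) \<le> l * d" using \<open>d \<ge> e + 1\<close> by (rule mult_le_mono2)
      moreover have "card (degs (W l)) \<le> l * e + 1"
        using card_mono[OF _ degs_W_subset, of l] by simp
      moreover have "2 * card (degs (W l)) + g = 2 * (l * d + 1)" using card[of l] by (simp add: l_def)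
      moreover have "g < l" using d by (simp add: l_def)
      ultimately show False by simp
    qed
  qed
qed

end

section \<open>Holomorphic germs in two variables\<close>

text \<open>Holomorphy on a bidisc is expressed by continuity and holomorphy along all pairs of
  holomorphic functions of one variable, which makes algebraic operations and composition immediate.
  Osgood's lemma below leads back to power series.\<close>

definition hol2 :: "real \<Rightarrow> fun2 \<Rightarrow> bool" where
  "hol2 r g \<longleftrightarrow> r > 0 \<and> continuous_on (ball 0 r \<times> ball 0 r) g \<and>
     (\<forall>S u v. open S \<longrightarrow> u holomorphic_on S \<longrightarrow> v holomorphic_on S \<longrightarrow>
        u ` S \<subseteq> ball 0 r \<longrightarrow> v ` S \<subseteq> ball 0 r \<longrightarrow> (\<lambda>t. g (u t, v t)) holomorphic_on S)"

lemma hol2_curve: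
  assumes "hol2 r g" "open S" "u holomorphic_on S" "v holomorphic_on S"
    "u ` S \<subseteq> ball 0 r" "v ` S \<subseteq> ball 0 r"
  shows "(\<lambda>t. g (u t, v t)) holomorphic_on S"
  using assms unfolding hol2_def by blast

lemma hol2_mono:
  assumes "hol2 r g" "0 < s" "s \<le> r"
  shows "hol2 s g"
proof -
  have sub: "ball 0 s \<subseteq> (ball 0 r :: complex set)" using assms(3) by (rule subset_ball)
  then have "continuous_on (ball 0 s \<times> ball 0 s) g"
    using assms(1) unfolding hol2_def by (blast intro: continuous_on_subset Sigma_mono)
  then show ?thesis
    using assms(1,2) sub order_trans[OF _ sub] unfolding hol2_def by (meson)
qed

text \<open>Summability at the point \<open>(r, r)\<close> is absolute, so the terms there dominate
  the series on the closed bidisc and the Weierstrass test applies, also after holomorphic functions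
  are inserted.\<close>

lemma holo_germs_imp_hol2:
  assumes "g \<in> holo_germs"
  shows "\<exists>r. hol2 r g"
proof -
  obtain c R where R: "R > 0" and c: "\<And>x y. norm x < R \<Longrightarrow> norm y < R \<Longrightarrow>
      ((\<lambda>(i, j). c i j * x ^ i * y ^ j) has_sum g (x, y)) UNIV"
    using assms unfolding holo_germs_def by blast
  define r where "r = R / 2"
  have r: "r > 0" "r < R" using R by (simp_all add: r_def)
  define T where "T = (\<lambda>ij :: nat \<times> nat. \<lambda>z :: complex \<times> complex. case ij of (i, j) \<Rightarrow> c i j * fst z ^ i * snd z ^ j)"
  define M where "M = (\<lambda>ij. norm (T ij (of_real r, of_real r)))"
  have "(\<lambda>(i, j). c i j * of_real r ^ i * of_real r ^ j) summable_on UNIV"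
    using c[of "of_real r" "of_real r"] r by (auto simp: summable_on_def)
  then have M: "M summable_on UNIV"
    unfolding summable_on_iff_abs_summable_on_complex by (simp add: M_def T_def case_prod_unfold)
  have bound: "norm (T ij z) \<le> M ij" if "norm (fst z) \<le> r" "norm (snd z) \<le> r" for ij z
    using that r by (auto simp: M_def T_def norm_mult norm_power split: prod.split
        intro!: mult_mono power_mono mult_nonneg_nonneg)
  have val: "(\<Sum>\<^sub>\<infinity>ij. T ij z) = g z" if "norm (fst z) \<le> r" "norm (snd z) \<le> r" for z
    using c[of "fst z" "snd z"] that r by (intro infsumI) (simp add: T_def case_prod_unfold)
  have contT: "continuous_on A (\<lambda>z. \<Sum>ij\<in>X. T ij z)" for A X
    unfolding T_def case_prod_unfold by (intro continuous_intros)
  have cont: "continuous_on (cball 0 r \<times> cball 0 r) g"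
  proof -
    have "uniform_limit (cball 0 r \<times> cball 0 r) (\<lambda>X z. \<Sum>ij\<in>X. T ij z) (\<lambda>z. \<Sum>\<^sub>\<infinity>ij. T ij z) (finite_subsets_at_top UNIV)"
      by (rule Weierstrass_m_test_general[OF _ M]) (auto intro!: bound)
    then have "continuous_on (cball 0 r \<times> cball 0 r) (\<lambda>z. \<Sum>\<^sub>\<infinity>ij. T ij z)"
      by (rule uniform_limit_theorem[rotated]) (auto intro: always_eventually contT)
    then show ?thesis by (rule continuous_on_eq) (auto simp: val)
  qed
  have hol: "(\<lambda>t. g (u t, v t)) holomorphic_on S"
    if S: "open S" "u holomorphic_on S" "v holomorphic_on S" "u ` S \<subseteq> ball 0 r" "v ` S \<subseteq> ball 0 r" for S u v
    unfolding holomorphic_on_def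
  proof
    fix t0 assume t0: "t0 \<in> S"
    obtain \<epsilon> where e: "\<epsilon> > 0" "cball t0 \<epsilon> \<subseteq> S" using S(1) t0 open_contains_cball by blast
    have in_r: "norm (u t) \<le> r" "norm (v t) \<le> r" if "t \<in> cball t0 \<epsilon>" for t
      using that e(2) S(4,5) by (auto simp: image_subset_iff subset_iff less_imp_le)
    have ul: "uniform_limit (cball t0 \<epsilon>) (\<lambda>X t. \<Sum>ij\<in>X. T ij (u t, v t)) (\<lambda>t. \<Sum>\<^sub>\<infinity>ij. T ij (u t, v t)) (finite_subsets_at_top UNIV)"
      by (rule Weierstrass_m_test_general[OF _ M]) (auto intro!: bound in_r)
    have "(\<lambda>t. \<Sum>ij\<in>X. T ij (u t, v t)) holomorphic_on S" for X
      unfolding T_def case_prod_unfold fst_conv snd_conv using S by (intro holomorphic_intros)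
    then have ch: "continuous_on (cball t0 \<epsilon>) (\<lambda>t. \<Sum>ij\<in>X. T ij (u t, v t)) \<and>
        (\<lambda>t. \<Sum>ij\<in>X. T ij (u t, v t)) holomorphic_on ball t0 \<epsilon>" for X
      using e(2) by (meson ball_subset_cball holomorphic_on_imp_continuous_on holomorphic_on_subset order_trans)
    have "(\<lambda>t. \<Sum>\<^sub>\<infinity>ij. T ij (u t, v t)) holomorphic_on ball t0 \<epsilon>"
      by (rule holomorphic_uniform_limit[OF _ ul]) (use ch in \<open>auto intro: always_eventually\<close>)
    then have "(\<lambda>t. g (u t, v t)) holomorphic_on ball t0 \<epsilon>"
      by (rule holomorphic_transform) (use in_r in \<open>auto intro!: val\<close>)
    then have "(\<lambda>t. g (u t, v t)) field_differentiable at t0"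
      using e(1) by (simp add: holomorphic_on_imp_differentiable_at)
    then show "(\<lambda>t. g (u t, v t)) field_differentiable at t0 within S"
      by (rule field_differentiable_at_within)
  qed
  have "hol2 r g"
    unfolding hol2_def
    using r(1) hol continuous_on_subset[OF cont Sigma_mono[OF ball_subset_cball ball_subset_cball]] by blast
  then show ?thesis ..
qed

text \<open>Cauchy's inequalities on the circle of radius \<open>\<rho> / 2\<close> bound the
  coefficients of all \<open>q j\<close> at once; on the bidisc of radius \<open>\<rho> / 4\<close>
  a double geometric series dominates, and the order of summation may be changed.\<close>

lemma holo_germsI_sums:
  assumes \<rho>: "\<rho> > 0" and hol: "\<And>j. q j holomorphic_on ball 0 \<rho>"
    and bound: "\<And>j x. norm x < \<rho> \<Longrightarrow> norm (q j x) \<le> M / \<rho> ^ j"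
    and sums: "\<And>x y. norm x < \<rho> \<Longrightarrow> norm y < \<rho> \<Longrightarrow> (\<lambda>j. q j x * y ^ j) sums g (x, y)"
  shows "g \<in> holo_germs"
proof -
  define c where "c = (\<lambda>i j. (deriv ^^ i) (q j) 0 / fact i)"
  define r where "r = \<rho> / 4"
  have r: "r > 0" using \<rho> by (simp add: r_def)
  have "norm (q 0 0) \<le> M" using bound[of 0 0] \<rho> by simp
  then have M: "M \<ge> 0" by (rule order_trans[OF norm_ge_zero])
  have cb: "norm (c i j) \<le> (M / \<rho> ^ j) / (\<rho> / 2) ^ i" for i j
  proof -
    have "norm ((deriv ^^ i) (q j) 0) \<le> fact i * (M / \<rho> ^ j) / (\<rho> / 2) ^ i"
    proof (rule Cauchy_inequality)
      show "q j holomorphic_on ball 0 (\<rho> / 2)" using \<rho> by (intro holomorphic_on_subset[OF hol] subset_ball) simp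
      have "q j holomorphic_on cball 0 (\<rho> / 2)" using \<rho> by (intro holomorphic_on_subset[OF hol]) auto
      then show "continuous_on (cball 0 (\<rho> / 2)) (q j)" by (rule holomorphic_on_imp_continuous_on)
      show "0 < \<rho> / 2" using \<rho> by simp
      show "norm (q j x) \<le> M / \<rho> ^ j" if "norm (0 - x) = \<rho> / 2" for x
        using that \<rho> by (intro bound) simp
    qed
    then show ?thesis by (simp add: c_def norm_divide divide_le_eq mult.commute)
  qed
  have tb: "norm (c i j * x ^ i * y ^ j) \<le> M * (1/2) ^ i * (1/2) ^ j" if "norm x < r" "norm y < r" for i j x y
  proof -
    have "norm (c i j * x ^ i * y ^ j) \<le> ((M / \<rho> ^ j) / (\<rho> / 2) ^ i) * r ^ i * r ^ j"
      unfolding norm_mult norm_power using that cb[of i j] r \<rho> M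
      by (intro mult_mono power_mono mult_nonneg_nonneg divide_nonneg_nonneg) auto
    also have "\<dots> = M * (r / (\<rho> / 2)) ^ i * (r / \<rho>) ^ j" by (simp add: power_divide mult_ac)
    also have "\<dots> \<le> M * (1/2) ^ i * (1/2) ^ j"
      unfolding r_def using \<rho> M by (intro mult_mono power_mono) (auto simp: field_simps)
    finally show ?thesis .
  qed
  have geo: "((\<lambda>j. K * (1/2) ^ j) has_sum (K * 2)) UNIV" if "K \<ge> 0" for K :: real
  proof (rule norm_summable_imp_has_sum)
    show s: "(\<lambda>j. K * (1/2) ^ j) sums (K * 2)"
      using sums_mult[OF geometric_sums[of "1/2 :: real"], of K] by simp
    show "summable (\<lambda>j. norm (K * (1/2) ^ j))"
      using sums_summable[OF s] that by (simp add: abs_mult)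
  qed
  have geo2: "(\<lambda>(j, i). M * (1/2) ^ i * (1/2) ^ j) summable_on (UNIV :: (nat \<times> nat) set)"
  proof -
    have "(\<lambda>(j, i). M * (1/2) ^ i * (1/2) ^ j) summable_on Sigma (UNIV :: nat set) (\<lambda>_. UNIV :: nat set)"
    proof (rule summable_on_SigmaI)
      show "((\<lambda>i. case (j, i) of (j, i) \<Rightarrow> M * (1/2) ^ i * (1/2) ^ j) has_sum (M * (1/2) ^ j * 2)) UNIV" for j
        using geo[of "M * (1/2) ^ j"] M by (simp add: mult_ac)
      have "((\<lambda>j. M * 2 * (1/2) ^ j) has_sum (M * 2 * 2)) UNIV" using geo[of "M * 2"] M by simp
      then show "(\<lambda>j. M * (1/2) ^ j * 2) summable_on UNIV"
        by (auto simp: summable_on_def mult_ac)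
    qed (use M in auto)
    then show ?thesis by simp
  qed
  have "((\<lambda>(i, j). c i j * x ^ i * y ^ j) has_sum g (x, y)) UNIV" if xy: "norm x < r" "norm y < r" for x y
  proof -
    have xr: "norm x < \<rho>" "norm y < \<rho>" using xy \<rho> by (auto simp: r_def)
    have sm: "(\<lambda>(j, i). c i j * x ^ i * y ^ j) summable_on (UNIV \<times> UNIV)"
      unfolding UNIV_Times_UNIV
      by (rule Infinite_Sum.abs_summable_summable, rule Infinite_Sum.abs_summable_on_comparison_test'[OF geo2]) (use tb[OF xy] in auto)
    have "((\<lambda>(j, i). c i j * x ^ i * y ^ j) has_sum g (x, y)) (UNIV \<times> UNIV)"
    proof (rule has_sum_SigmaI[OF _ _ sm])
      fix j :: nat
      have "(\<lambda>i. c i j * x ^ i) sums q j x"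
        using holomorphic_power_series[OF hol, of x j] xr by (simp add: c_def)
      then have s: "(\<lambda>i. c i j * x ^ i * y ^ j) sums (q j x * y ^ j)" by (rule sums_mult2)
      have "summable (\<lambda>i. M * (1/2) ^ j * (1/2) ^ i)"
        by (intro summable_mult summable_geometric) simp
      then have "summable (\<lambda>i. norm (c i j * x ^ i * y ^ j))"
        by (rule summable_comparison_test_ev[rotated])
          (use tb[OF xy] in \<open>auto intro!: always_eventually simp: mult_ac\<close>)
      from norm_summable_imp_has_sum[OF this s]
      show "((\<lambda>i. case (j, i) of (j, i) \<Rightarrow> c i j * x ^ i * y ^ j) has_sum (q j x * y ^ j)) UNIV" by simp
    next
      have "summable (\<lambda>j. M * (1/4) ^ j)" by (intro summable_mult summable_geometric) simp
      then have "summable (\<lambda>j. norm (q j x * y ^ j))"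
      proof (rule summable_comparison_test_ev[rotated], intro always_eventually allI)
        fix j
        have "norm (q j x * y ^ j) \<le> (M / \<rho> ^ j) * r ^ j"
          unfolding norm_mult norm_power using bound[OF xr(1), of j] xy r \<rho> M
          by (intro mult_mono power_mono) auto
        also have "\<dots> = M * (1/4) ^ j" using \<rho> by (simp add: r_def power_divide)
        finally show "norm (norm (q j x * y ^ j)) \<le> M * (1/4) ^ j" by simp
      qed
      then show "((\<lambda>j. q j x * y ^ j) has_sum g (x, y)) UNIV"
        using sums[OF xr] by (rule norm_summable_imp_has_sum)
    qed
    then have "((\<lambda>(i, j). c i j * x ^ i * y ^ j) has_sum g (x, y)) (UNIV \<times> UNIV)"
      by (subst has_sum_swap) simp
    then show ?thesis by simp
  qed
  then show ?thesis unfolding holo_germs_def using r by blast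
qed

text \<open>Osgood's lemma. The coefficient functions of the expansion in \<open>y\<close> are holomorphic because each
  of them is, after subtraction of the previous terms, a uniform limit of functions of \<open>x\<close> at fixed \<open>y\<close>.\<close>

lemma hol2_expansion:
  assumes g: "hol2 r g"
  obtains \<rho> M q where "\<rho> > 0" "\<rho> < r" "\<And>j. q j holomorphic_on ball 0 \<rho>"
    "\<And>j x. norm x < \<rho> \<Longrightarrow> norm (q j x) \<le> M / \<rho> ^ j"
    "\<And>x y. norm x < \<rho> \<Longrightarrow> norm y < \<rho> \<Longrightarrow> (\<lambda>j. q j x * y ^ j) sums g (x, y)"
proof -
  define \<rho> where "\<rho> = r / 2"
  have r: "r > 0" using g by (simp add: hol2_def)
  then have \<rho>: "\<rho> > 0" "\<rho> < r" by (simp_all add: \<rho>_def)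
  have holy: "(\<lambda>y. g (x, y)) holomorphic_on ball 0 r" if "norm x < r" for x
    using that by (intro hol2_curve[OF g]) auto
  have holx: "(\<lambda>x. g (x, y)) holomorphic_on ball 0 r" if "norm y < r" for y
    using that by (intro hol2_curve[OF g]) auto
  have "continuous_on (cball 0 \<rho> \<times> cball 0 \<rho>) g"
    using g \<rho> unfolding hol2_def by (elim conjE continuous_on_subset) auto
  then have "bounded (g ` (cball 0 \<rho> \<times> cball 0 \<rho>))"
    by (intro compact_imp_bounded compact_continuous_image compact_Times compact_cball)
  then obtain M where M: "\<And>x y. norm x \<le> \<rho> \<Longrightarrow> norm y \<le> \<rho> \<Longrightarrow> norm (g (x, y)) \<le> M"
    unfolding bounded_iff by fastforce
  have "norm (g (0, 0)) \<le> M" using M[of 0 0] \<rho> by simp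
  then have M0: "M \<ge> 0" by (rule order_trans[OF norm_ge_zero])
  define q where "q = (\<lambda>j x. (deriv ^^ j) (\<lambda>y. g (x, y)) 0 / fact j)"
  have qb: "norm (q j x) \<le> M / \<rho> ^ j" if x: "norm x < \<rho>" for j x
  proof -
    have "norm ((deriv ^^ j) (\<lambda>y. g (x, y)) 0) \<le> fact j * M / \<rho> ^ j"
    proof (rule Cauchy_inequality)
      have h: "(\<lambda>y. g (x, y)) holomorphic_on ball 0 r" using x \<rho> by (intro holy) simp
      show "(\<lambda>y. g (x, y)) holomorphic_on ball 0 \<rho>" using \<rho> by (intro holomorphic_on_subset[OF h]) auto
      show "continuous_on (cball 0 \<rho>) (\<lambda>y. g (x, y))"
        using \<rho> by (intro holomorphic_on_imp_continuous_on holomorphic_on_subset[OF h]) auto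
      show "norm (g (x, y)) \<le> M" if "norm (0 - y) = \<rho>" for y using x that by (intro M) auto
    qed (use \<rho> in auto)
    then show ?thesis by (simp add: q_def norm_divide divide_le_eq mult.commute)
  qed
  have qs: "(\<lambda>j. q j x * y ^ j) sums g (x, y)" if "norm x < \<rho>" "norm y < \<rho>" for x y
    using holomorphic_power_series[OF holy, of x y] that \<rho> by (simp add: q_def)
  have qh: "q j holomorphic_on ball 0 \<rho>" for j
  proof (induction j rule: less_induct)
    case (less j)
    define Y where "Y = (\<lambda>k :: nat. of_real (\<rho> / (real k + 2)) :: complex)"
    have Y: "norm (Y k) = \<rho> / (real k + 2)" "Y k \<noteq> 0" "norm (Y k) < \<rho>" for k
    proof -
      show 1: "norm (Y k) = \<rho> / (real k + 2)" unfolding Y_def norm_of_real using \<rho> by simp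
      then show "Y k \<noteq> 0" using \<rho> by auto
      show "norm (Y k) < \<rho>" unfolding 1 using \<rho> by (simp add: divide_less_eq)
    qed
    define h where "h = (\<lambda>k x. (g (x, Y k) - (\<Sum>n<j. q n x * Y k ^ n)) / Y k ^ j)"
    have hh: "h k holomorphic_on ball 0 \<rho>" for k
      unfolding h_def using Y[of k] \<rho> less
      by (intro holomorphic_intros holomorphic_on_subset[OF holx]) auto
    have close: "norm (h k x - q j x) \<le> (M / \<rho> ^ j) / (real k + 1)" if x: "norm x < \<rho>" for k x
    proof -
      define s where "s = 1 / (real k + 2)"
      have s: "0 < s" "s < 1" by (simp_all add: s_def)
      have "(\<lambda>n. q (n + j) x * Y k ^ (n + j)) sums (g (x, Y k) - (\<Sum>n<j. q n x * Y k ^ n))"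
        using qs[OF x Y(3)] by (rule sums_split_initial_segment)
      then have "(\<lambda>n. q (n + j) x * Y k ^ (n + j) / Y k ^ j) sums h k x"
        unfolding h_def by (rule sums_divide)
      then have "(\<lambda>n. q (n + j) x * Y k ^ n) sums h k x"
        using Y(2)[of k] by (simp add: power_add)
      from sums_split_initial_segment[OF this, of 1]
      have s1: "(\<lambda>n. q (Suc n + j) x * Y k ^ Suc n) sums (h k x - q j x)" by simp
      have "(\<lambda>n. (M / \<rho> ^ j * s) * s ^ n) sums ((M / \<rho> ^ j * s) * (1 / (1 - s)))"
        using s by (intro sums_mult geometric_sums) simp
      from norm_sums_le[OF s1 this]
      have "norm (h k x - q j x) \<le> (M / \<rho> ^ j * s) * (1 / (1 - s))"
      proof -
        have "norm (q (Suc n + j) x * Y k ^ Suc n) \<le> M / \<rho> ^ j * s * s ^ n" for n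
        proof -
          have "norm (q (Suc n + j) x * Y k ^ Suc n) \<le> (M / \<rho> ^ (Suc n + j)) * (\<rho> * s) ^ Suc n"
            unfolding norm_mult norm_power Y(1) using qb[OF x, of "Suc n + j"] \<rho> M0 s
            by (intro mult_mono) (auto simp: s_def)
          also have "\<dots> = M / \<rho> ^ j * s * s ^ n"
            using \<rho> by (simp add: power_add power_mult_distrib field_simps)
          finally show ?thesis .
        qed
        then show ?thesis
          using \<open>(\<And>n. norm (q (Suc n + j) x * Y k ^ Suc n) \<le> M / \<rho> ^ j * s * s ^ n) \<Longrightarrow> _\<close> by blast
      qed
      also have "s * (1 / (1 - s)) = 1 / (real k + 1)" by (simp add: s_def field_simps)
      then have "(M / \<rho> ^ j * s) * (1 / (1 - s)) = (M / \<rho> ^ j) / (real k + 1)"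
        by (metis mult.assoc times_divide_eq_right mult.right_neutral)
      finally show ?thesis .
    qed
    have lim: "uniform_limit (ball 0 \<rho>) h (q j) sequentially"
    proof (rule uniform_limitI)
      fix \<epsilon> :: real assume e: "\<epsilon> > 0"
      have "(\<lambda>k. (M / \<rho> ^ j) / (real k + 1)) \<longlonglongrightarrow> 0" by real_asymp
      then have "\<forall>\<^sub>F k in sequentially. (M / \<rho> ^ j) / (real k + 1) < \<epsilon>"
        using e by (rule order_tendstoD)
      then show "\<forall>\<^sub>F k in sequentially. \<forall>x\<in>ball 0 \<rho>. dist (h k x) (q j x) < \<epsilon>"
        by eventually_elim (auto simp: dist_norm intro: le_less_trans[OF close])
    qed
    show ?case
    proof (rule holomorphic_uniform_sequence[OF open_ball hh])
      fix x :: complex assume "x \<in> ball 0 \<rho>"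
      then obtain d where "d > 0" "cball x d \<subseteq> ball 0 \<rho>" 
        using open_contains_cball[of "ball 0 \<rho>"] open_ball by blast
      then show "\<exists>d>0. cball x d \<subseteq> ball 0 \<rho> \<and> uniform_limit (cball x d) h (q j) sequentially"
        using uniform_limit_on_subset[OF lim] by blast
    qed
  qed
  show thesis using that[OF \<rho> qh qb qs] .
qed

lemma hol2_imp_holo_germs: "hol2 r g \<Longrightarrow> g \<in> holo_germs"
  by (erule hol2_expansion) (rule holo_germsI_sums)

lemma hol2_const [intro]: "r > 0 \<Longrightarrow> hol2 r (\<lambda>z. c)"
  by (auto simp: hol2_def)

lemma hol2_add: "hol2 r f \<Longrightarrow> hol2 r g \<Longrightarrow> hol2 r (\<lambda>z. f z + g z)"
  unfolding hol2_def by (auto intro!: continuous_intros holomorphic_intros)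

lemma hol2_diff: "hol2 r f \<Longrightarrow> hol2 r g \<Longrightarrow> hol2 r (\<lambda>z. f z - g z)"
  unfolding hol2_def by (auto intro!: continuous_intros holomorphic_intros)

lemma hol2_mult: "hol2 r f \<Longrightarrow> hol2 r g \<Longrightarrow> hol2 r (\<lambda>z. f z * g z)"
  unfolding hol2_def by (auto intro!: continuous_intros holomorphic_intros)

lemma hol2_prod: "r > 0 \<Longrightarrow> (\<And>b. b \<in> B \<Longrightarrow> hol2 r (f b)) \<Longrightarrow> hol2 r (\<lambda>z. \<Prod>b\<in>B. f b z)"
  by (induction B rule: infinite_finite_induct) (auto intro: hol2_mult)

lemma hol2_fst:
  assumes "h holomorphic_on ball 0 r" "r > 0"
  shows "hol2 r (\<lambda>z. h (fst z))"
  unfolding hol2_def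
proof (intro conjI allI impI)
  show "continuous_on (ball 0 r \<times> ball 0 r) (\<lambda>z. h (fst z))"
    by (rule continuous_on_compose2[OF holomorphic_on_imp_continuous_on[OF assms(1)]])
      (auto intro!: continuous_intros)
  show "(\<lambda>t. h (fst (u t, v t))) holomorphic_on S"
    if "open S" "u holomorphic_on S" "v holomorphic_on S" "u ` S \<subseteq> ball 0 r" for S u v
    using holomorphic_on_compose_gen[OF that(2) assms(1) that(4)] by (simp add: o_def)
qed (use assms in auto)

lemma hol2_snd:
  assumes "h holomorphic_on ball 0 r" "r > 0"
  shows "hol2 r (\<lambda>z. h (snd z))"
  unfolding hol2_def
proof (intro conjI allI impI)
  show "continuous_on (ball 0 r \<times> ball 0 r) (\<lambda>z. h (snd z))"
    by (rule continuous_on_compose2[OF holomorphic_on_imp_continuous_on[OF assms(1)]])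
      (auto intro!: continuous_intros)
  show "(\<lambda>t. h (snd (u t, v t))) holomorphic_on S"
    if "open S" "u holomorphic_on S" "v holomorphic_on S" "u ` S \<subseteq> ball 0 r" "v ` S \<subseteq> ball 0 r" for S u v
    using holomorphic_on_compose_gen[OF that(3) assms(1) that(5)] by (simp add: o_def)
qed (use assms in auto)

lemma hol2_compose:
  assumes f: "hol2 r f" and A: "hol2 s A" and B: "hol2 s B"
    and im: "\<And>z. z \<in> ball 0 s \<times> ball 0 s \<Longrightarrow> norm (A z) < r \<and> norm (B z) < r"
  shows "hol2 s (\<lambda>z. f (A z, B z))"
  unfolding hol2_def
proof (intro conjI allI impI)
  show "s > 0" using A by (simp add: hol2_def)
  show "continuous_on (ball 0 s \<times> ball 0 s) (\<lambda>z. f (A z, B z))"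
    by (rule continuous_on_compose2[of "ball 0 r \<times> ball 0 r" f])
      (use f A B im in \<open>auto simp: hol2_def intro!: continuous_intros\<close>)
  show "(\<lambda>t. f (A (u t, v t), B (u t, v t))) holomorphic_on S"
    if "open S" "u holomorphic_on S" "v holomorphic_on S" "u ` S \<subseteq> ball 0 s" "v ` S \<subseteq> ball 0 s" for S u v
  proof (rule hol2_curve[OF f that(1)])
    show "(\<lambda>t. A (u t, v t)) holomorphic_on S" by (rule hol2_curve[OF A that])
    show "(\<lambda>t. B (u t, v t)) holomorphic_on S" by (rule hol2_curve[OF B that])
    show "(\<lambda>t. A (u t, v t)) ` S \<subseteq> ball 0 r" "(\<lambda>t. B (u t, v t)) ` S \<subseteq> ball 0 r"
      using im that(4,5) by (auto simp: image_subset_iff)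
  qed
qed

lemma holo_germs_common_radius:
  assumes "f \<in> holo_germs" "g \<in> holo_germs" "R > 0"
  obtains r where "hol2 r f" "hol2 r g" "r \<le> R" "r > 0"
proof -
  obtain r1 r2 where r: "hol2 r1 f" "hol2 r2 g" using assms holo_germs_imp_hol2 by blast
  then have pos: "r1 > 0" "r2 > 0" by (auto simp: hol2_def)
  show thesis
    by (rule that[of "min (min r1 r2) R"]) (use r pos assms(3) in \<open>auto intro: hol2_mono\<close>)
qed

lemma holo_germs_const [simp]: "(\<lambda>z. c) \<in> holo_germs"
  using hol2_const[of 1 c] hol2_imp_holo_germs by simp

lemma holo_germs_add: "f \<in> holo_germs \<Longrightarrow> g \<in> holo_germs \<Longrightarrow> (\<lambda>z. f z + g z) \<in> holo_germs"
  by (erule (1) holo_germs_common_radius[of f g 1]) (auto intro: hol2_imp_holo_germs hol2_add)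

lemma holo_germs_diff: "f \<in> holo_germs \<Longrightarrow> g \<in> holo_germs \<Longrightarrow> (\<lambda>z. f z - g z) \<in> holo_germs"
  by (erule (1) holo_germs_common_radius[of f g 1]) (auto intro: hol2_imp_holo_germs hol2_diff)

lemma holo_germs_mult: "f \<in> holo_germs \<Longrightarrow> g \<in> holo_germs \<Longrightarrow> (\<lambda>z. f z * g z) \<in> holo_germs"
  by (erule (1) holo_germs_common_radius[of f g 1]) (auto intro: hol2_imp_holo_germs hol2_mult)

lemma holo_germs_cmult: "f \<in> holo_germs \<Longrightarrow> (\<lambda>z. c * f z) \<in> holo_germs"
  by (intro holo_germs_mult holo_germs_const)

lemma holo_germs_sum: "(\<And>b. b \<in> B \<Longrightarrow> f b \<in> holo_germs) \<Longrightarrow> (\<lambda>z. \<Sum>b\<in>B. f b z) \<in> holo_germs"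
  by (induction B rule: infinite_finite_induct) (auto intro: holo_germs_add)

lemma eventually_nhds_pair:
  "(\<forall>\<^sub>F z in nhds (0 :: complex \<times> complex). P z) \<longleftrightarrow>
     (\<exists>r>0. \<forall>x y. norm x < r \<longrightarrow> norm y < r \<longrightarrow> P (x, y))"
proof
  assume "\<forall>\<^sub>F z in nhds (0 :: complex \<times> complex). P z"
  then obtain r where r: "r > 0" "\<And>z. dist z 0 < r \<Longrightarrow> P z" unfolding eventually_nhds_metric by blast
  have "P (x, y)" if "norm x < r / 2" "norm y < r / 2" for x y
  proof (rule r(2))
    have "norm (x, y) \<le> norm x + norm y" by (rule norm_Pair_le)
    then show "dist (x, y) 0 < r" using that by simp
  qed
  then show "\<exists>r>0. \<forall>x y. norm x < r \<longrightarrow> norm y < r \<longrightarrow> P (x, y)" using r(1) by (intro exI[of _ "r / 2"]) auto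
next
  assume "\<exists>r>0. \<forall>x y. norm x < r \<longrightarrow> norm y < r \<longrightarrow> P (x, y)"
  then obtain r where r: "r > 0" "\<And>x y. norm x < r \<Longrightarrow> norm y < r \<Longrightarrow> P (x, y)" by blast
  have "P z" if "dist z 0 < r" for z
    using r(2)[of "fst z" "snd z"] that norm_fst_le[of "fst z" "snd z"] norm_snd_le[of "snd z" "fst z"] by simp
  then show "\<forall>\<^sub>F z in nhds (0 :: complex \<times> complex). P z" unfolding eventually_nhds_metric using r(1) by blast
qed

lemma eventually_nhds_0_norm: "(\<forall>\<^sub>F t in nhds (0 :: complex). P t) \<longleftrightarrow> (\<exists>r>0. \<forall>t. norm t < r \<longrightarrow> P t)"
  unfolding eventually_nhds_metric by (simp add: dist_norm)

section \<open>Division of a germ by the equation of a graph\<close>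

lemma holomorphic_small:
  assumes "y holomorphic_on ball 0 s" "s > 0" "y 0 = 0" "\<epsilon> > 0"
  obtains r where "r > 0" "r \<le> s" "r \<le> \<epsilon>" "\<And>t. norm t < r \<Longrightarrow> norm (y t) < \<epsilon>"
proof -
  have "continuous (at 0) y"
    using holomorphic_on_imp_continuous_on[OF assms(1)] assms(2) by (simp add: continuous_on_eq_continuous_at)
  then obtain d where d: "d > 0" "\<And>t. dist t 0 < d \<Longrightarrow> dist (y t) (y 0) < \<epsilon>"
    using assms(4) unfolding continuous_at_eps_delta by (auto simp: dist_norm)
  show thesis
    by (rule that[of "min (min d s) \<epsilon>"]) (use d assms in auto)
qed

text \<open>For \<open>a = 1\<close> the shear takes the axis to the graph of \<open>y\<close>, for
  \<open>a = -1\<close> it takes the graph back to the axis. The radius is shrunk until the sheared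
  bidisc lies in the domain of \<open>g\<close>.\<close>

lemma hol2_shear:
  assumes g: "hol2 r0 g" and y: "y holomorphic_on ball 0 s" "s > 0" "y 0 = 0"
  obtains r where "r > 0" "r \<le> s" "r \<le> r0" "hol2 r (\<lambda>z. g (fst z, snd z + a * y (fst z)))"
    "\<And>t. norm t < r \<Longrightarrow> norm (y t) < r0"
proof -
  have r0: "r0 > 0" using g by (simp add: hol2_def)
  define \<epsilon> where "\<epsilon> = (r0 / 2) / (1 + norm a)"
  have na: "1 + norm a > 0" by (simp add: add_pos_nonneg)
  have e: "\<epsilon> > 0" "\<epsilon> * (1 + norm a) = r0 / 2"
    unfolding \<epsilon>_def using r0 na by (simp, subst nonzero_eq_divide_eq[symmetric]) auto
  have el: "\<epsilon> \<le> r0 / 2" using mult_left_mono[of 1 "1 + norm a" \<epsilon>] e(1) unfolding e(2) by simp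
  obtain r where r: "r > 0" "r \<le> s" "r \<le> \<epsilon>" "\<And>t. norm t < r \<Longrightarrow> norm (y t) < \<epsilon>"
    using holomorphic_small[OF y e(1)] by blast
  have hy: "y holomorphic_on ball 0 r" using r by (intro holomorphic_on_subset[OF y(1)] subset_ball)
  have "hol2 r (\<lambda>z. g (fst z, snd z + a * y (fst z)))"
  proof (rule hol2_compose[OF g])
    show "hol2 r fst" using hol2_fst[of "\<lambda>x. x" r] r by simp
    show "hol2 r (\<lambda>z. snd z + a * y (fst z))"
      using hol2_snd[of "\<lambda>x. x" r] hol2_fst[OF hy] r by (intro hol2_add hol2_mult hol2_const) auto
    fix z :: "complex \<times> complex" assume z: "z \<in> ball 0 r \<times> ball 0 r"
    have "norm (snd z + a * y (fst z)) \<le> norm (snd z) + norm a * norm (y (fst z))"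
      by (metis norm_mult norm_triangle_ineq)
    also have "\<dots> \<le> \<epsilon> + norm a * \<epsilon>"
      using z r(3) r(4)[of "fst z"] by (intro add_mono mult_left_mono) (auto simp: mem_Times_iff)
    also have "\<dots> = r0 / 2" using e(2) by (simp add: algebra_simps)
    finally show "norm (fst z) < r0 \<and> norm (snd z + a * y (fst z)) < r0"
      using z r(3) el r0 by (auto simp: mem_Times_iff)
  qed
  moreover have "norm (y t) < r0" if "norm t < r" for t using r(4)[OF that] el r0 by simp
  moreover have "r \<le> r0" using r(3) el r0 by linarith
  ultimately show thesis using that[OF r(1,2)] by blast
qed

text \<open>After the graph of \<open>y\<close> is straightened to the axis, the zeroth coefficient
  of the expansion in \<open>Y\<close> vanishes and a factor \<open>Y\<close> can be split off;
  shearing back turns it into \<open>Y - y x\<close>.\<close>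

lemma germ_factor:
  assumes g: "g \<in> holo_germs" and y: "y holomorphic_on ball 0 s" "s > 0" "y 0 = 0"
    and zero: "\<forall>\<^sub>F t in nhds 0. g (t, y t) = 0"
  shows "\<exists>Q\<in>holo_germs. \<exists>r>0. \<forall>x Y. norm x < r \<longrightarrow> norm Y < r \<longrightarrow> g (x, Y) = (Y - y x) * Q (x, Y)"
proof -
  obtain r0 where g0: "hol2 r0 g" using holo_germs_imp_hol2[OF g] by blast
  obtain r1 where r1: "r1 > 0" "\<And>t. norm t < r1 \<Longrightarrow> g (t, y t) = 0"
    using zero unfolding eventually_nhds_0_norm by blast
  obtain r2 where r2: "r2 > 0" "r2 \<le> s" "hol2 r2 (\<lambda>z. g (fst z, snd z + 1 * y (fst z)))"
    using hol2_shear[OF g0 y, of 1] by blast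
  define r3 where "r3 = min r1 r2"
  define G where "G = (\<lambda>z. g (fst z, snd z + y (fst z)))"
  have "hol2 r3 G" unfolding G_def using hol2_mono[OF r2(3), of r3] r1 r2 by (simp add: r3_def)
  then obtain \<rho> M q where \<rho>: "\<rho> > 0" "\<rho> < r3" and qh: "\<And>j. q j holomorphic_on ball 0 \<rho>"
    and qb: "\<And>j x. norm x < \<rho> \<Longrightarrow> norm (q j x) \<le> M / \<rho> ^ j"
    and qs: "\<And>x Y. norm x < \<rho> \<Longrightarrow> norm Y < \<rho> \<Longrightarrow> (\<lambda>j. q j x * Y ^ j) sums G (x, Y)"
    by (rule hol2_expansion) blast
  have q0: "q 0 x = 0" if "norm x < \<rho>" for x
  proof -
    have "(\<lambda>j. q j x * 0 ^ j) sums G (x, 0)" using that \<rho> by (intro qs) auto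
    moreover have "(\<lambda>j. q j x * 0 ^ j) sums q 0 x" by (rule powser_sums_zero)
    ultimately have "q 0 x = G (x, 0)" using sums_unique2 by blast
    also have "\<dots> = 0" using r1(2)[of x] that \<rho> by (simp add: G_def r3_def)
    finally show ?thesis .
  qed
  define Q1 where "Q1 = (\<lambda>z. suminf (\<lambda>j. q (Suc j) (fst z) * snd z ^ j))"
  have Q1s: "(\<lambda>j. q (Suc j) x * Y ^ j) sums Q1 (x, Y)" if xY: "norm x < \<rho>" "norm Y < \<rho>" for x Y
  proof -
    have "summable (\<lambda>j. (M / \<rho>) * (norm Y / \<rho>) ^ j)"
      using xY \<rho> by (intro summable_mult summable_geometric) simp
    then have "summable (\<lambda>j. q (Suc j) x * Y ^ j)"
    proof (rule summable_comparison_test_ev[rotated], intro always_eventually allI)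
      fix j
      have "norm (q (Suc j) x * Y ^ j) \<le> (M / \<rho> ^ Suc j) * norm Y ^ j"
        unfolding norm_mult norm_power using qb[OF xY(1), of "Suc j"] by (intro mult_right_mono) auto
      then show "norm (q (Suc j) x * Y ^ j) \<le> (M / \<rho>) * (norm Y / \<rho>) ^ j"
        by (simp add: power_divide mult_ac)
    qed
    then show ?thesis unfolding Q1_def by (simp add: summable_sums)
  qed
  have "Q1 \<in> holo_germs"
  proof (rule holo_germsI_sums[OF \<rho>(1) _ _ Q1s])
    show "q (Suc j) holomorphic_on ball 0 \<rho>" for j by (rule qh)
    show "norm (q (Suc j) x) \<le> (M / \<rho>) / \<rho> ^ j" if "norm x < \<rho>" for j x
      using qb[OF that, of "Suc j"] by simp
  qed
  then obtain r4 where r4: "hol2 r4 Q1" using holo_germs_imp_hol2 by blast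
  have GQ: "G (x, Y) = Y * Q1 (x, Y)" if xY: "norm x < \<rho>" "norm Y < \<rho>" for x Y
  proof -
    have "(\<lambda>j. q (Suc j) x * Y ^ Suc j) sums (G (x, Y) - q 0 x)"
      using sums_split_initial_segment[OF qs[OF xY], of 1] by simp
    then have "(\<lambda>j. q (Suc j) x * Y ^ Suc j) sums G (x, Y)" using q0[OF xY(1)] by simp
    moreover have "(\<lambda>j. q (Suc j) x * Y ^ Suc j) sums (Y * Q1 (x, Y))"
      using sums_mult[OF Q1s[OF xY], of Y] by (simp add: mult_ac)
    ultimately show ?thesis using sums_unique2 by blast
  qed
  obtain r5 where r5: "r5 > 0" "hol2 r5 (\<lambda>z. Q1 (fst z, snd z + (-1) * y (fst z)))"
    using hol2_shear[OF r4 y, of "-1"] by blast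
  define Q where "Q = (\<lambda>z. Q1 (fst z, snd z + (-1) * y (fst z)))"
  have "Q \<in> holo_germs" unfolding Q_def using r5(2) by (rule hol2_imp_holo_germs)
  moreover obtain r6 where r6: "r6 > 0" "r6 \<le> s" "r6 \<le> \<rho> / 2" "\<And>t. norm t < r6 \<Longrightarrow> norm (y t) < \<rho> / 2"
    using holomorphic_small[OF y, of "\<rho> / 2"] \<rho> by auto
  have "g (x, Y) = (Y - y x) * Q (x, Y)" if "norm x < r6" "norm Y < r6" for x Y
  proof -
    have "norm (Y - y x) \<le> norm Y + norm (y x)" by (rule norm_triangle_ineq4)
    then have "norm (Y - y x) < \<rho>" using that r6(3) r6(4)[of x] by simp
    then show ?thesis using GQ[of x "Y - y x"] that r6(3) \<rho> by (simp add: G_def Q_def)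
  qed
  ultimately show ?thesis using r6(1) by blast
qed

section \<open>Averaging over roots of unity\<close>

text \<open>Multiplication by the primitive root \<open>\<omega>\<close> permutes the roots of unity
  and multiplies the sum by \<open>\<omega>^i\<close>, which differs from 1 unless \<open>k\<close>
  divides \<open>i\<close>.\<close>

lemma sum_roots_unity_power:
  assumes "k > 0"
  shows "(\<Sum>\<zeta> | \<zeta> ^ k = (1 :: complex). \<zeta> ^ i) = (if k dvd i then of_nat k else 0)"
proof (cases "k dvd i")
  case True
  then have "\<zeta> ^ i = 1" if "\<zeta> ^ k = 1" for \<zeta> :: complex
    using that by (auto elim!: dvdE simp: power_mult)
  then have "(\<Sum>\<zeta> | \<zeta> ^ k = (1 :: complex). \<zeta> ^ i) = (\<Sum>\<zeta> | \<zeta> ^ k = (1 :: complex). 1)"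
    by (intro sum.cong) auto
  then show ?thesis using True card_roots_unity_eq[OF assms] by simp
next
  case False
  define \<omega> where "\<omega> = exp (2 * of_real pi * \<i> * of_nat 1 / of_nat k)"
  have wk: "\<omega> ^ k = 1" unfolding \<omega>_def using complex_root_unity[of k 1] assms by simp
  have "\<omega> ^ i = exp (2 * of_real pi * \<i> * of_nat i / of_nat k)"
    unfolding \<omega>_def exp_of_nat_mult[symmetric] by (simp add: mult_ac)
  then have wi: "\<omega> ^ i \<noteq> 1" using complex_root_unity_eq_1[of k i] assms False by simp
  have w0: "\<omega> \<noteq> 0" using wk assms by (metis zero_neq_one zero_power)
  have "bij_betw (\<lambda>\<zeta>. \<omega> * \<zeta>) {\<zeta>. \<zeta> ^ k = 1} {\<zeta>. \<zeta> ^ k = 1}"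
    by (rule bij_betwI[of _ _ _ "\<lambda>\<zeta>. \<zeta> / \<omega>"]) (use wk w0 in \<open>auto simp: power_mult_distrib power_divide\<close>)
  then have "(\<Sum>\<zeta> | \<zeta> ^ k = (1 :: complex). \<zeta> ^ i) = (\<Sum>\<zeta> | \<zeta> ^ k = 1. (\<omega> * \<zeta>) ^ i)"
    by (intro sum.reindex_bij_betw[symmetric])
  also have "\<dots> = \<omega> ^ i * (\<Sum>\<zeta> | \<zeta> ^ k = 1. \<zeta> ^ i)"
    by (simp add: power_mult_distrib sum_distrib_left)
  finally show ?thesis using wi False by (simp add: mult_cancel_right1)
qed

lemma exists_small_root:
  assumes "k > 0" "norm (w :: complex) < r ^ k" "r > 0"
  shows "\<exists>x. x ^ k = w \<and> norm x < r"
proof -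
  obtain x where x: "x ^ k = w"
  proof (cases "w = 0")
    case True
    then show ?thesis using that[of 0] assms(1) by simp
  next
    case False
    have "exp (Ln w / of_nat k) ^ k = w"
      using False assms(1) by (simp flip: exp_of_nat_mult)
    then show ?thesis by (rule that)
  qed
  then have "norm x ^ k < r ^ k" using assms(2) by (simp flip: norm_power)
  then have "norm x < r" using assms(3) by (metis less_le power_less_imp_less_base)
  then show ?thesis using x by blast
qed

lemma has_sum_finite_sum:
  fixes f :: "'b \<Rightarrow> 'a \<Rightarrow> complex"
  assumes "\<And>b. b \<in> B \<Longrightarrow> (f b has_sum s b) A"
  shows "((\<lambda>x. \<Sum>b\<in>B. f b x) has_sum (\<Sum>b\<in>B. s b)) A"
  using assms by (induction B rule: infinite_finite_induct) (auto intro!: has_sum_add)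

text \<open>The sum over rotations of \<open>x\<close> kills all powers \<open>x^i\<close> with
  \<open>i\<close> not divisible by \<open>k\<close> and multiplies the others by \<open>k\<close>;
  what remains is a convergent series in \<open>x^k\<close>.\<close>

lemma germ_average:
  assumes q: "q \<in> holo_germs" and k: "k > 0"
  shows "\<exists>q'\<in>holo_germs. \<exists>r>0. \<forall>x y. norm x < r \<longrightarrow> norm y < r \<longrightarrow>
           (\<Sum>\<zeta> | \<zeta> ^ k = 1. q (\<zeta> * x, y)) = of_nat k * q' (x ^ k, y)"
proof -
  obtain c R where R: "R > 0" and c: "\<And>x y. norm x < R \<Longrightarrow> norm y < R \<Longrightarrow>
      ((\<lambda>(i, j). c i j * x ^ i * y ^ j) has_sum q (x, y)) UNIV"
    using q unfolding holo_germs_def by blast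
  define U where "U = {\<zeta> :: complex. \<zeta> ^ k = 1}"
  have nU: "norm \<zeta> = 1" if "\<zeta> \<in> U" for \<zeta>
  proof -
    have "norm \<zeta> ^ k = 1" using that by (simp add: U_def flip: norm_power)
    then show ?thesis using k power_eq_imp_eq_base[of "norm \<zeta>" k 1] by simp
  qed
  have key: "((\<lambda>(i, j). c (k * i) j * (x ^ k) ^ i * y ^ j) has_sum ((\<Sum>\<zeta>\<in>U. q (\<zeta> * x, y)) / of_nat k)) UNIV"
    if xy: "norm x < R" "norm y < R" for x y
  proof -
    have "((\<lambda>z. \<Sum>\<zeta>\<in>U. case z of (i, j) \<Rightarrow> c i j * (\<zeta> * x) ^ i * y ^ j) has_sum (\<Sum>\<zeta>\<in>U. q (\<zeta> * x, y))) UNIV"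
      using xy nU by (intro has_sum_finite_sum c) (auto simp: norm_mult)
    also have "(\<lambda>z. \<Sum>\<zeta>\<in>U. case z of (i, j) \<Rightarrow> c i j * (\<zeta> * x) ^ i * y ^ j) =
        (\<lambda>(i, j). if k dvd i then of_nat k * (c i j * x ^ i * y ^ j) else 0)"
    proof (rule ext)
      fix z :: "nat \<times> nat"
      obtain i j where z: "z = (i, j)" by (cases z)
      have "(\<Sum>\<zeta>\<in>U. c i j * (\<zeta> * x) ^ i * y ^ j) = c i j * x ^ i * y ^ j * (\<Sum>\<zeta>\<in>U. \<zeta> ^ i)"
        by (simp add: power_mult_distrib sum_distrib_left mult_ac)
      then show "(\<Sum>\<zeta>\<in>U. case z of (i, j) \<Rightarrow> c i j * (\<zeta> * x) ^ i * y ^ j) =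
          (case z of (i, j) \<Rightarrow> if k dvd i then of_nat k * (c i j * x ^ i * y ^ j) else 0)"
        using sum_roots_unity_power[OF k, of i] by (simp add: U_def z)
    qed
    finally have "((\<lambda>(i, j). if k dvd i then of_nat k * (c i j * x ^ i * y ^ j) else 0)
        has_sum (\<Sum>\<zeta>\<in>U. q (\<zeta> * x, y))) UNIV" .
    also have "?this \<longleftrightarrow> ((\<lambda>(i, j). if k dvd i then of_nat k * (c i j * x ^ i * y ^ j) else 0)
        has_sum (\<Sum>\<zeta>\<in>U. q (\<zeta> * x, y))) (range (\<lambda>(i, j). (k * i, j)))"
      by (rule has_sum_cong_neutral) (auto simp: image_iff elim!: dvdE)
    also have "\<dots> \<longleftrightarrow> (((\<lambda>(i, j). if k dvd i then of_nat k * (c i j * x ^ i * y ^ j) else 0) \<circ> (\<lambda>(i, j). (k * i, j)))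
        has_sum (\<Sum>\<zeta>\<in>U. q (\<zeta> * x, y))) UNIV"
      using k by (intro has_sum_reindex) (auto simp: inj_on_def)
    also have "((\<lambda>(i, j). if k dvd i then of_nat k * (c i j * x ^ i * y ^ j) else 0) \<circ> (\<lambda>(i, j). (k * i, j))) =
        (\<lambda>(i, j). of_nat k * (c (k * i) j * (x ^ k) ^ i * y ^ j))"
      by (auto simp: fun_eq_iff power_mult)
    finally have h: "((\<lambda>(i, j). of_nat k * (c (k * i) j * (x ^ k) ^ i * y ^ j)) has_sum (\<Sum>\<zeta>\<in>U. q (\<zeta> * x, y))) UNIV" .
    show ?thesis
      using has_sum_cmult_right[OF h, of "1 / of_nat k"] k by (simp add: case_prod_unfold)
  qed
  define q' where "q' = (\<lambda>z. \<Sum>\<^sub>\<infinity>(i, j). c (k * i) j * fst z ^ i * snd z ^ j)"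
  have q'x: "of_nat k * q' (x ^ k, y) = (\<Sum>\<zeta>\<in>U. q (\<zeta> * x, y))" if "norm x < R" "norm y < R" for x y
    using infsumI[OF key[OF that]] k by (simp add: q'_def)
  \<comment> \<open>The radius for the new variable \<open>w = x^k\<close>: below \<open>R^k\<close>
    every \<open>w\<close> has a \<open>k\<close>-th root of norm less than
    \<open>R\<close>.\<close>
  define r where "r = min R (R ^ k)"
  have "q' \<in> holo_germs"
    unfolding holo_germs_def
  proof (rule CollectI, intro exI conjI allI impI)
    show "r > 0" using R by (simp add: r_def)
    fix w y :: complex assume wy: "norm w < r" "norm y < r"
    then obtain x where x: "x ^ k = w" "norm x < R"
      using exists_small_root[OF k, of w R] R by (auto simp: r_def)
    have "norm y < R" using wy by (simp add: r_def)
    note ky = key[OF x(2) this, folded q'x[OF x(2) this], unfolded x(1)]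
    show "((\<lambda>(i, j). c (k * i) j * w ^ i * y ^ j) has_sum q' (w, y)) UNIV"
      using ky k by simp
  qed
  then show ?thesis using q'x R unfolding U_def by (intro bexI[of _ q'] exI[of _ R]) auto
qed

text \<open>\<open>c\<close> is the coefficient of \<open>t\<^sup>n\<close> in the expansion of \<open>h\<close> at \<open>0\<close>, and all previous coefficients vanish.\<close>

definition lc :: "(complex \<Rightarrow> complex) \<Rightarrow> nat \<Rightarrow> complex \<Rightarrow> bool" where
  "lc h n c \<longleftrightarrow> (\<exists>r>0. \<exists>u. u holomorphic_on ball 0 r \<and> u 0 = c \<and> (\<forall>t. norm t < r \<longrightarrow> h t = t ^ n * u t))"

lemma lcI:
  assumes "r > 0" "u holomorphic_on ball 0 r" "\<And>t. norm t < r \<Longrightarrow> h t = t ^ n * u t"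
  shows "lc h n (u 0)"
  using assms unfolding lc_def by blast

lemma lc_common_radius:
  assumes "lc f m c" "lc g n d"
  obtains r u v where "r > 0" "u holomorphic_on ball 0 r" "v holomorphic_on ball 0 r" "u 0 = c" "v 0 = d"
    "\<And>t. norm t < r \<Longrightarrow> f t = t ^ m * u t" "\<And>t. norm t < r \<Longrightarrow> g t = t ^ n * v t"
proof -
  obtain r1 u where 1: "r1 > 0" "u holomorphic_on ball 0 r1" "u 0 = c" "\<And>t. norm t < r1 \<Longrightarrow> f t = t ^ m * u t"
    using assms(1) unfolding lc_def by blast
  obtain r2 v where 2: "r2 > 0" "v holomorphic_on ball 0 r2" "v 0 = d" "\<And>t. norm t < r2 \<Longrightarrow> g t = t ^ n * v t"
    using assms(2) unfolding lc_def by blast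
  show thesis
    by (rule that[of "min r1 r2" u v]) (use 1 2 in \<open>auto intro: holomorphic_on_subset\<close>)
qed

lemma lc_add: "lc f n c \<Longrightarrow> lc g n d \<Longrightarrow> lc (\<lambda>t. f t + g t) n (c + d)"
  apply (erule (1) lc_common_radius)
  subgoal for r u v
    using lcI[of r "\<lambda>t. u t + v t" "\<lambda>t. f t + g t" n] by (auto intro: holomorphic_intros simp: algebra_simps)
  done

lemma lc_mult: "lc f m c \<Longrightarrow> lc g n d \<Longrightarrow> lc (\<lambda>t. f t * g t) (m + n) (c * d)"
  apply (erule (1) lc_common_radius)
  subgoal for r u v
    using lcI[of r "\<lambda>t. u t * v t" "\<lambda>t. f t * g t" "m + n"] by (auto intro: holomorphic_intros simp: power_add)
  done

lemma lc_const: "lc (\<lambda>t. c) 0 c"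
  using lcI[of 1 "\<lambda>t. c" "\<lambda>t. c" 0] by simp

lemma lc_cmult: "lc f m c \<Longrightarrow> lc (\<lambda>t. a * f t) m (a * c)"
  using lc_mult[OF lc_const[of a]] by simp

lemma lc_zero: "lc (\<lambda>t. 0) n 0"
  using lcI[of 1 "\<lambda>t. 0" "\<lambda>t. 0" n] by simp

lemma lc_cong:
  assumes "lc f n c" "\<forall>\<^sub>F t in nhds 0. f t = g t"
  shows "lc g n c"
proof -
  obtain r1 u where 1: "r1 > 0" "u holomorphic_on ball 0 r1" "u 0 = c" "\<And>t. norm t < r1 \<Longrightarrow> f t = t ^ n * u t"
    using assms(1) unfolding lc_def by blast
  obtain r2 where 2: "r2 > 0" "\<And>t. norm t < r2 \<Longrightarrow> f t = g t"
    using assms(2) unfolding eventually_nhds_0_norm by blast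
  have "lc g n (u 0)"
  proof (rule lcI)
    show "min r1 r2 > 0" using 1 2 by simp
    show "u holomorphic_on ball 0 (min r1 r2)" using 1(2) by (rule holomorphic_on_subset) auto
    show "g t = t ^ n * u t" if "norm t < min r1 r2" for t using 1(4)[of t] 2(2)[of t] that by simp
  qed
  then show ?thesis using 1(3) by simp
qed

lemma lc_lower:
  assumes "lc f n c" "m < n"
  shows "lc f m 0"
proof -
  obtain r u where 1: "r > 0" "u holomorphic_on ball 0 r" "\<And>t. norm t < r \<Longrightarrow> f t = t ^ n * u t"
    using assms(1) unfolding lc_def by blast
  have "lc f m ((\<lambda>t. t ^ (n - m) * u t) 0)"
  proof (rule lcI[OF 1(1)])
    show "(\<lambda>t. t ^ (n - m) * u t) holomorphic_on ball 0 r" using 1(2) by (intro holomorphic_intros)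
    show "f t = t ^ m * (t ^ (n - m) * u t)" if "norm t < r" for t
      using 1(3)[OF that] assms(2) by (simp flip: mult.assoc power_add)
  qed
  then show ?thesis using assms(2) by (simp add: power_0_left)
qed

lemma lc_sum:
  assumes "\<And>b. b \<in> B \<Longrightarrow> lc (f b) n (c b)"
  shows "lc (\<lambda>t. \<Sum>b\<in>B. f b t) n (\<Sum>b\<in>B. c b)"
  using assms by (induction B rule: infinite_finite_induct) (auto intro: lc_add lc_zero)

lemma equal_off_0_imp_equal:
  fixes f g :: "complex \<Rightarrow> complex"
  assumes "f holomorphic_on ball 0 r" "g holomorphic_on ball 0 r" "r > 0"
    and "\<And>t. norm t < r \<Longrightarrow> t \<noteq> 0 \<Longrightarrow> f t = g t"
  shows "f 0 = g 0"
proof -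
  have "(f \<longlongrightarrow> f 0) (at 0)" "(g \<longlongrightarrow> g 0) (at 0)"
    using assms(1-3)
    by (auto simp: isCont_def[symmetric] continuous_on_eq_continuous_at dest!: holomorphic_on_imp_continuous_on)
  moreover have "\<forall>\<^sub>F t in at 0. f t = g t"
    unfolding eventually_at using assms(3,4) by (intro exI[of _ r]) (auto simp: dist_norm)
  ultimately show ?thesis
    using tendsto_unique[OF trivial_limit_at Lim_transform_eventually] by blast
qed

lemma lc_unique: "lc f n c \<Longrightarrow> lc f n d \<Longrightarrow> c = d"
proof (erule (1) lc_common_radius)
  fix r u v assume *: "r > 0" "u holomorphic_on ball 0 r" "v holomorphic_on ball 0 r" "u 0 = c" "v 0 = d"
    "\<And>t. norm t < r \<Longrightarrow> f t = t ^ n * u t" "\<And>t. norm t < r \<Longrightarrow> f t = t ^ n * v t"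
  have "u 0 = v 0"
  proof (rule equal_off_0_imp_equal[OF *(2,3,1)])
    show "u t = v t" if "norm t < r" "t \<noteq> 0" for t
      using *(6)[OF that(1)] *(7)[OF that(1)] that(2) by simp
  qed
  then show "c = d" using * by simp
qed

lemma lc_order_unique: "lc f m c \<Longrightarrow> lc f n d \<Longrightarrow> c \<noteq> 0 \<Longrightarrow> d \<noteq> 0 \<Longrightarrow> m = n"
  by (metis lc_lower lc_unique linorder_neqE_nat)

lemma lc_exists:
  assumes "h holomorphic_on ball 0 r" "r > 0"
  shows "(\<forall>\<^sub>F t in nhds 0. h t = 0) \<or> (\<exists>n c. c \<noteq> 0 \<and> lc h n c)"
proof (cases "h 0 = 0")
  case False
  then show ?thesis using lcI[OF assms(2,1), of h 0] by auto
next
  case h0: True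
  show ?thesis
  proof (cases "h constant_on ball 0 r")
    case True
    then obtain a where a: "\<And>t. t \<in> ball 0 r \<Longrightarrow> h t = a" unfolding constant_on_def by blast
    have "h t = 0" if "norm t < r" for t
      using a[of t] a[of 0] that h0 assms(2) by simp
    then show ?thesis unfolding eventually_nhds_0_norm using assms(2) by blast
  next
    case False
    have c0: "0 \<in> ball (0 :: complex) r" using assms(2) by simp
    show ?thesis
    proof (rule holomorphic_factor_zero_nonconstant[OF assms(1) open_ball connected_ball c0 h0 False])
      fix g s n
      assume g: "0 < n" "0 < s" "ball 0 s \<subseteq> ball 0 r" "g holomorphic_on ball 0 s"
        "\<And>w. w \<in> ball 0 s \<Longrightarrow> h w = (w - 0) ^ n * g w" "\<And>w. w \<in> ball 0 s \<Longrightarrow> g w \<noteq> 0"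
      have "lc h n (g 0)" by (rule lcI[OF g(2,4)]) (use g(5) in auto)
      then show ?thesis using g(6)[of 0] g(2) by auto
    qed
  qed
qed

text \<open>A vanishing coefficient allows another factor \<open>t\<close> to be split off. The next
  coefficient may vanish again, as it does when \<open>f\<close> is zero near
  \<open>0\<close>.\<close>

lemma lc_Suc:
  assumes "lc f n 0"
  shows "\<exists>d. lc f (Suc n) d"
proof -
  obtain r u where r: "r > 0" and u: "u holomorphic_on ball 0 r" "u 0 = 0"
    and f: "\<And>t. norm t < r \<Longrightarrow> f t = t ^ n * u t"
    using assms unfolding lc_def by blast
  have fu: "lc f (n + m) d" if "lc u m d" for m d
  proof -
    have "lc (\<lambda>t. t ^ n) n 1" using lcI[of 1 "\<lambda>t. 1" "\<lambda>t. t ^ n" n] by simp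
    from lc_mult[OF this that] have "lc (\<lambda>t. t ^ n * u t) (n + m) d" by simp
    then show ?thesis by (rule lc_cong) (use f r in \<open>auto simp: eventually_nhds_0_norm\<close>)
  qed
  from lc_exists[OF u(1) r] show ?thesis
  proof
    assume "\<forall>\<^sub>F t in nhds 0. u t = 0"
    then have "\<forall>\<^sub>F t in nhds 0. 0 = u t" by (rule eventually_mono) simp
    then have "lc u 1 0" by (rule lc_cong[OF lc_zero])
    then show ?thesis using fu by fastforce
  next
    assume "\<exists>m c. c \<noteq> 0 \<and> lc u m c"
    then obtain m c where m: "c \<noteq> 0" "lc u m c" by blast
    have "lc u 0 0" using lcI[OF r u(1), of u 0] u(2) by simp
    then have "m \<noteq> 0" using m lc_unique by metis
    then have "lc u 1 c \<or> lc u 1 0" using m(2) lc_lower[OF m(2), of 1] by (cases "m = 1") auto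
    then show ?thesis using fu[of 1] by auto
  qed
qed

section \<open>Intersection multiplicity along a branch\<close>

lemma curve_small:
  assumes "u holomorphic_on ball 0 s" "v holomorphic_on ball 0 s" "s > 0" "u 0 = 0" "v 0 = 0" "\<epsilon> > 0"
  obtains r where "r > 0" "r \<le> s" "\<And>t. norm t < r \<Longrightarrow> norm (u t) < \<epsilon> \<and> norm (v t) < \<epsilon>"
proof -
  obtain r1 where 1: "r1 > 0" "r1 \<le> s" "\<And>t. norm t < r1 \<Longrightarrow> norm (u t) < \<epsilon>"
    using holomorphic_small[OF assms(1,3,4,6)] by blast
  obtain r2 where 2: "r2 > 0" "r2 \<le> s" "\<And>t. norm t < r2 \<Longrightarrow> norm (v t) < \<epsilon>"
    using holomorphic_small[OF assms(2,3,5,6)] by blast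
  show thesis by (rule that[of "min r1 r2"]) (use 1 2 in auto)
qed

lemma curve_eventually:
  assumes "u holomorphic_on ball 0 s" "v holomorphic_on ball 0 s" "s > 0" "u 0 = 0" "v 0 = 0"
    and "\<forall>\<^sub>F z in nhds 0. P z"
  shows "\<forall>\<^sub>F t in nhds 0. P (u t, v t)"
proof -
  obtain \<epsilon> where e: "\<epsilon> > 0" "\<And>x y. norm x < \<epsilon> \<Longrightarrow> norm y < \<epsilon> \<Longrightarrow> P (x, y)"
    using assms(6) unfolding eventually_nhds_pair by blast
  obtain r where "r > 0" "\<And>t. norm t < r \<Longrightarrow> norm (u t) < \<epsilon> \<and> norm (v t) < \<epsilon>"
    using curve_small[OF assms(1-5) e(1)] by blast
  then show ?thesis unfolding eventually_nhds_0_norm using e(2) by blast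
qed

lemma curve_holomorphic:
  assumes "g \<in> holo_germs" "u holomorphic_on ball 0 s" "v holomorphic_on ball 0 s" "s > 0" "u 0 = 0" "v 0 = 0"
  obtains r where "r > 0" "r \<le> s" "(\<lambda>t. g (u t, v t)) holomorphic_on ball 0 r"
proof -
  obtain R where R: "hol2 R g" using holo_germs_imp_hol2[OF assms(1)] by blast
  then have "R > 0" by (simp add: hol2_def)
  then obtain r where r: "r > 0" "r \<le> s" "\<And>t. norm t < r \<Longrightarrow> norm (u t) < R \<and> norm (v t) < R"
    using curve_small[OF assms(2-6)] by blast
  have sub: "ball 0 r \<subseteq> (ball 0 s :: complex set)" using r(2) by (rule subset_ball)
  have "(\<lambda>t. g (u t, v t)) holomorphic_on ball 0 r"
    by (rule hol2_curve[OF R]) (use r(3) sub assms(2,3) in \<open>auto intro: holomorphic_on_subset\<close>)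
  then show thesis using that r by blast
qed

lemma holo_germs_power_fst:
  assumes "g \<in> holo_germs" "k > 0"
  shows "(\<lambda>z. g (fst z ^ k, snd z)) \<in> holo_germs"
proof -
  obtain R where R: "hol2 R g" using holo_germs_imp_hol2[OF assms(1)] by blast
  then have "R > 0" by (simp add: hol2_def)
  define r where "r = min R 1"
  have r: "r > 0" "r \<le> R" "r \<le> 1" using \<open>R > 0\<close> by (auto simp: r_def)
  have "hol2 r (\<lambda>z. g (fst z ^ k, snd z))"
  proof (rule hol2_compose[OF R])
    show "hol2 r (\<lambda>z. fst z ^ k)" using hol2_fst[of "\<lambda>x. x ^ k" r] r by (simp add: holomorphic_intros)
    show "hol2 r snd" using hol2_snd[of "\<lambda>x. x" r] r by simp
    fix z :: "complex \<times> complex" assume z: "z \<in> ball 0 r \<times> ball 0 r"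
    have "norm (fst z) ^ k \<le> norm (fst z) ^ 1"
      using z r(3) assms(2) by (intro power_decreasing) (auto simp: mem_Times_iff)
    then show "norm (fst z ^ k) < R \<and> norm (snd z) < R"
      using z r(2) by (auto simp: mem_Times_iff norm_power)
  qed
  then show ?thesis by (rule hol2_imp_holo_germs)
qed

section \<open>Branches in Puiseux form\<close>

text \<open>Injectivity makes the parametrization primitive: the conjugates
  \<open>y (\<zeta> * t)\<close> over the \<open>k\<close>-th roots of unity are distinct for small
  \<open>t \<noteq> 0\<close>.\<close>

locale puiseux_branch =
  fixes f :: fun2 and k :: nat and y :: "complex \<Rightarrow> complex" and s :: real
  assumes k: "k > 0" and hol: "y holomorphic_on ball 0 s" and s: "s > 0" and y0: "y 0 = 0"
    and inj: "\<And>a b. norm a < s \<Longrightarrow> norm b < s \<Longrightarrow> a ^ k = b ^ k \<Longrightarrow> y a = y b \<Longrightarrow> a = b"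
    and irr: "germ_irreducible f" and f0: "\<forall>\<^sub>F t in nhds 0. f (t ^ k, y t) = 0"
begin

definition pull :: "fun2 \<Rightarrow> complex \<Rightarrow> complex" where
  "pull g = (\<lambda>t. g (t ^ k, y t))"

definition U :: "complex set" where "U = {\<zeta>. \<zeta> ^ k = 1}"

text \<open>For \<open>V = U\<close> this is the Weierstrass polynomial of the branch after
  substitution of \<open>x^k\<close> for \<open>x\<close>; smaller sets occur while factors are
  split off, and \<open>U - {1}\<close> gives the different.\<close>

definition rootfac :: "complex set \<Rightarrow> fun2" where
  "rootfac V = (\<lambda>z. \<Prod>\<zeta>\<in>V. (snd z - y (\<zeta> * fst z)))"

lemma finite_U: "finite U"
  unfolding U_def using k by (intro finite_roots_unity) simp

lemma card_U: "card U = k"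
  unfolding U_def using k by (rule card_roots_unity_eq)

lemma norm_U: "\<zeta> \<in> U \<Longrightarrow> norm \<zeta> = 1"
proof -
  assume "\<zeta> \<in> U"
  then have "norm \<zeta> ^ k = 1" by (simp add: U_def flip: norm_power)
  then show ?thesis using k power_eq_imp_eq_base[of "norm \<zeta>" k 1] by simp
qed

lemma hol_rot: "\<zeta> \<in> U \<Longrightarrow> (\<lambda>t. y (\<zeta> * t)) holomorphic_on ball 0 s"
proof -
  assume "\<zeta> \<in> U"
  then have "(\<lambda>t. \<zeta> * t) ` ball 0 s \<subseteq> ball 0 s" using norm_U by (auto simp: norm_mult)
  moreover have "(\<lambda>t. \<zeta> * t) holomorphic_on ball 0 s" by (intro holomorphic_intros)
  ultimately show ?thesis using holomorphic_on_compose_gen[OF _ hol] by (simp add: o_def)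
qed

lemma power_holomorphic: "(\<lambda>t. t ^ k) holomorphic_on ball (0 :: complex) s"
  by (intro holomorphic_intros)

lemma rootfac_holo: "V \<subseteq> U \<Longrightarrow> rootfac V \<in> holo_germs"
proof -
  assume V: "V \<subseteq> U"
  have "hol2 s (rootfac V)"
    unfolding rootfac_def using V s hol2_snd[of "\<lambda>x. x" s]
    by (intro hol2_prod hol2_diff hol2_fst[of "\<lambda>x. y (_ * x)"] hol_rot) auto
  then show ?thesis by (rule hol2_imp_holo_germs)
qed

lemma rootfac_rotate:
  assumes "\<omega> \<in> U"
  shows "rootfac U (\<omega> * x, Y) = rootfac U (x, Y)"
proof -
  have w0: "\<omega> \<noteq> 0" using norm_U[OF assms] by auto
  have "bij_betw (\<lambda>\<zeta>. \<zeta> * \<omega>) U U"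
    by (rule bij_betwI[of _ _ _ "\<lambda>\<zeta>. \<zeta> / \<omega>"]) (use assms w0 in \<open>auto simp: U_def power_mult_distrib power_divide\<close>)
  then have "(\<Prod>\<zeta>\<in>U. (Y - y (\<zeta> * x))) = (\<Prod>\<zeta>\<in>U. (Y - y (\<zeta> * \<omega> * x)))"
    by (intro prod.reindex_bij_betw[symmetric])
  then show ?thesis by (simp add: rootfac_def mult.assoc)
qed

lemma pull_eventually: "(\<forall>\<^sub>F z in nhds 0. P z) \<Longrightarrow> \<forall>\<^sub>F t in nhds 0. P (t ^ k, y t)"
  using curve_eventually[OF power_holomorphic hol s _ y0] k by simp

lemma pull_cong: "(\<forall>\<^sub>F z in nhds 0. g z = h z) \<Longrightarrow> \<forall>\<^sub>F t in nhds 0. pull g t = pull h t"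
  unfolding pull_def by (rule pull_eventually)

lemma pull_holomorphic:
  assumes "g \<in> holo_germs"
  obtains r where "r > 0" "r \<le> s" "pull g holomorphic_on ball 0 r"
  using curve_holomorphic[OF assms power_holomorphic hol s _ y0] k unfolding pull_def by (metis zero_power)

lemma pull_lc_exists:
  assumes "g \<in> holo_germs"
  shows "(\<forall>\<^sub>F t in nhds 0. pull g t = 0) \<or> (\<exists>n c. c \<noteq> 0 \<and> lc (pull g) n c)"
  using pull_holomorphic[OF assms] lc_exists by metis

lemma eventually_rotate:
  assumes "\<forall>\<^sub>F t in nhds 0. P t" "\<omega> \<in> U"
  shows "\<forall>\<^sub>F t in nhds 0. P (\<omega> * t)"
proof -
  obtain r where "r > 0" "\<And>t. norm t < r \<Longrightarrow> P t" using assms(1) unfolding eventually_nhds_0_norm by blast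
  moreover have "norm (\<omega> * t) = norm t" for t using norm_U[OF assms(2)] by (simp add: norm_mult)
  ultimately show ?thesis unfolding eventually_nhds_0_norm by metis
qed

text \<open>After the substitution of \<open>x^k\<close> the germ \<open>g\<close> vanishes along
  every conjugate graph. These are split off one at a time by \<open>germ_factor\<close>: on the
  next graph the factors already removed are nonzero off the origin, so the cofactor vanishes
  there.\<close>

lemma vanishing_factor:
  assumes g: "g \<in> holo_germs" and g0: "\<forall>\<^sub>F t in nhds 0. pull g t = 0" and V: "finite V" "V \<subseteq> U"
  shows "\<exists>Q\<in>holo_germs. \<forall>\<^sub>F z in nhds 0. g (fst z ^ k, snd z) = rootfac V z * Q z"
  using V
proof (induction V rule: finite_induct)
  case empty
  show ?case using holo_germs_power_fst[OF g k] by (intro bexI) (auto simp: rootfac_def)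
next
  case (insert \<omega> V)
  then have \<omega>: "\<omega> \<in> U" and VU: "V \<subseteq> U" by auto
  obtain Q where Q: "Q \<in> holo_germs" "\<forall>\<^sub>F z in nhds 0. g (fst z ^ k, snd z) = rootfac V z * Q z"
    using insert.IH VU by blast
  have rot0: "y (\<omega> * 0) = 0" using y0 by simp
  have id_hol: "(\<lambda>t. t) holomorphic_on ball (0 :: complex) s" by (intro holomorphic_intros)
  have e1: "\<forall>\<^sub>F t in nhds 0. g (t ^ k, y (\<omega> * t)) = rootfac V (t, y (\<omega> * t)) * Q (t, y (\<omega> * t))"
    using curve_eventually[OF id_hol hol_rot[OF \<omega>] s refl rot0 Q(2)] by simp
  have e2: "\<forall>\<^sub>F t in nhds 0. g (t ^ k, y (\<omega> * t)) = 0"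
    using eventually_rotate[OF g0 \<omega>] \<omega> by (simp add: pull_def power_mult_distrib U_def)
  obtain r1 where r1: "r1 > 0" "r1 \<le> s" "(\<lambda>t. Q (t, y (\<omega> * t))) holomorphic_on ball 0 r1"
    using curve_holomorphic[OF Q(1) id_hol hol_rot[OF \<omega>] s refl rot0] by blast
  obtain r2 where r2: "r2 > 0" "\<And>t. norm t < r2 \<Longrightarrow> 0 = rootfac V (t, y (\<omega> * t)) * Q (t, y (\<omega> * t))"
    using eventually_conj[OF e1 e2] unfolding eventually_nhds_0_norm by metis
  define r where "r = min r1 r2"
  have nz: "Q (t, y (\<omega> * t)) = 0" if t: "norm t < r" "t \<noteq> 0" for t
  proof -
    have ts: "norm t < s" using t(1) r1(2) by (simp add: r_def)
    have "y (\<omega> * t) - y (\<zeta> * t) \<noteq> 0" if \<zeta>: "\<zeta> \<in> V" for \<zeta>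
    proof
      assume "y (\<omega> * t) - y (\<zeta> * t) = 0"
      then have yy: "y (\<omega> * t) = y (\<zeta> * t)" by simp
      have \<zeta>U: "\<zeta> \<in> U" using \<zeta> VU by blast
      have "(\<omega> * t) ^ k = (\<zeta> * t) ^ k" using \<omega> \<zeta>U by (simp add: U_def power_mult_distrib)
      moreover have "norm (\<omega> * t) < s" "norm (\<zeta> * t) < s"
        using ts by (simp_all add: norm_mult norm_U[OF \<omega>] norm_U[OF \<zeta>U])
      ultimately have "\<omega> * t = \<zeta> * t" using inj yy by blast
      then show False using t(2) \<zeta> insert.hyps by simp
    qed
    then have "rootfac V (t, y (\<omega> * t)) \<noteq> 0" using insert.hyps by (simp add: rootfac_def)
    then show ?thesis using r2(2)[of t] t(1) by (simp add: r_def)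
  qed
  \<comment> \<open>At the origin the removed factors vanish too; continuity supplies the
    value.\<close>
  have "Q (0, y (\<omega> * 0)) = 0"
  proof (rule equal_off_0_imp_equal[of "\<lambda>t. Q (t, y (\<omega> * t))" r "\<lambda>t. 0"])
    show "(\<lambda>t. Q (t, y (\<omega> * t))) holomorphic_on ball 0 r"
      using r1(3) by (rule holomorphic_on_subset) (auto simp: r_def)
  qed (use nz r1 r2 in \<open>auto simp: r_def\<close>)
  then have "Q (t, y (\<omega> * t)) = 0" if "norm t < r" for t using nz[of t] that by (cases "t = 0") auto
  then have "\<forall>\<^sub>F t in nhds 0. Q (t, y (\<omega> * t)) = 0"
    unfolding eventually_nhds_0_norm using r1(1) r2(1) by (intro exI[of _ r]) (auto simp: r_def)
  from germ_factor[OF Q(1) hol_rot[OF \<omega>] s rot0 this]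
  obtain Q' where Q': "Q' \<in> holo_germs" "\<forall>\<^sub>F z in nhds 0. Q z = (snd z - y (\<omega> * fst z)) * Q' z"
    unfolding eventually_nhds_pair by auto
  have "\<forall>\<^sub>F z in nhds 0. g (fst z ^ k, snd z) = rootfac (insert \<omega> V) z * Q' z"
    using Q(2) Q'(2) by eventually_elim (use insert.hyps in \<open>simp add: rootfac_def mult_ac\<close>)
  then show ?case using Q'(1) by blast
qed

text \<open>Rotations of \<open>x\<close> permute the factors, so the product is its own average and
  hence a germ in \<open>x^k\<close>.\<close>

lemma branch_polynomial:
  obtains P where "P \<in> holo_germs" "\<forall>\<^sub>F z in nhds 0. P (fst z ^ k, snd z) = rootfac U z"
proof -
  obtain P r where P: "P \<in> holo_germs" "r > 0" "\<And>x Y. norm x < r \<Longrightarrow> norm Y < r \<Longrightarrow>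
      (\<Sum>\<zeta> | \<zeta> ^ k = 1. rootfac U (\<zeta> * x, Y)) = of_nat k * P (x ^ k, Y)"
    using germ_average[OF rootfac_holo[OF order_refl] k] by blast
  have "P (x ^ k, Y) = rootfac U (x, Y)" if "norm x < r" "norm Y < r" for x Y
  proof -
    have "of_nat k * P (x ^ k, Y) = (\<Sum>\<zeta>\<in>U. rootfac U (\<zeta> * x, Y))" using P(3)[OF that] by (simp add: U_def)
    also have "\<dots> = of_nat k * rootfac U (x, Y)" using rootfac_rotate by (simp add: card_U)
    finally show ?thesis using k by simp
  qed
  then have "\<forall>\<^sub>F z in nhds 0. P (fst z ^ k, snd z) = rootfac U z"
    unfolding eventually_nhds_pair using P(2) by (intro exI[of _ r]) simp
  then show thesis using that P(1) by blast
qed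

lemma eventually_power_fst:
  assumes "\<forall>\<^sub>F z in nhds 0. A (fst z ^ k, snd z)"
  shows "\<forall>\<^sub>F z in nhds (0 :: complex \<times> complex). A z"
proof -
  obtain r where r: "r > 0" "\<And>x Y. norm x < r \<Longrightarrow> norm Y < r \<Longrightarrow> A (x ^ k, Y)"
    using assms unfolding eventually_nhds_pair by auto
  show ?thesis unfolding eventually_nhds_pair
  proof (intro exI conjI allI impI)
    show "min r (r ^ k) > 0" using r by simp
    fix w Y :: complex assume w: "norm w < min r (r ^ k)" "norm Y < min r (r ^ k)"
    then obtain x where "x ^ k = w" "norm x < r" using exists_small_root[OF k, of w r] r by auto
    then show "A (w, Y)" using r(2)[of x Y] w by auto
  qed
qed

text \<open>Since \<open>g (x^k, Y)\<close> and the product are invariant under rotations of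
  \<open>x\<close>, the cofactor may be replaced by its average, which descends to a germ in
  \<open>x^k\<close>.\<close>

lemma kernel_generator:
  assumes P: "\<forall>\<^sub>F z in nhds 0. P (fst z ^ k, snd z) = rootfac U z"
    and g: "g \<in> holo_germs" and g0: "\<forall>\<^sub>F t in nhds 0. pull g t = 0"
  shows "\<exists>q\<in>holo_germs. \<forall>\<^sub>F z in nhds 0. g z = P z * q z"
proof -
  obtain Q where Q: "Q \<in> holo_germs" "\<forall>\<^sub>F z in nhds 0. g (fst z ^ k, snd z) = rootfac U z * Q z"
    using vanishing_factor[OF g g0 finite_U order_refl] by blast
  obtain r1 where r1: "r1 > 0" "\<And>x Y. norm x < r1 \<Longrightarrow> norm Y < r1 \<Longrightarrow> g (x ^ k, Y) = rootfac U (x, Y) * Q (x, Y)"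
    using Q(2) unfolding eventually_nhds_pair by auto
  obtain q r2 where q: "q \<in> holo_germs" "r2 > 0" "\<And>x Y. norm x < r2 \<Longrightarrow> norm Y < r2 \<Longrightarrow>
      (\<Sum>\<zeta> | \<zeta> ^ k = 1. Q (\<zeta> * x, Y)) = of_nat k * q (x ^ k, Y)"
    using germ_average[OF Q(1) k] by blast
  obtain r3 where r3: "r3 > 0" "\<And>x Y. norm x < r3 \<Longrightarrow> norm Y < r3 \<Longrightarrow> P (x ^ k, Y) = rootfac U (x, Y)"
    using P unfolding eventually_nhds_pair by auto
  define r where "r = min r1 (min r2 r3)"
  have "g (x ^ k, Y) = P (x ^ k, Y) * q (x ^ k, Y)" if xY: "norm x < r" "norm Y < r" for x Y
  proof -
    have "g (x ^ k, Y) = rootfac U (x, Y) * Q (\<zeta> * x, Y)" if z: "\<zeta> \<in> U" for \<zeta>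
    proof -
      have "g ((\<zeta> * x) ^ k, Y) = rootfac U (\<zeta> * x, Y) * Q (\<zeta> * x, Y)"
        using xY norm_U[OF z] by (intro r1(2)) (auto simp: r_def norm_mult)
      then show ?thesis using z rootfac_rotate[OF z] by (simp add: U_def power_mult_distrib)
    qed
    then have "(\<Sum>\<zeta>\<in>U. g (x ^ k, Y)) = (\<Sum>\<zeta>\<in>U. rootfac U (x, Y) * Q (\<zeta> * x, Y))" by (intro sum.cong) auto
    then have "of_nat k * g (x ^ k, Y) = rootfac U (x, Y) * (\<Sum>\<zeta>\<in>U. Q (\<zeta> * x, Y))"
      by (simp add: card_U sum_distrib_left)
    also have "\<dots> = of_nat k * (P (x ^ k, Y) * q (x ^ k, Y))"
      using q(3)[of x Y] r3(2)[of x Y] xY by (simp add: U_def r_def)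
    finally show ?thesis using k by simp
  qed
  then have "\<forall>\<^sub>F z in nhds 0. g (fst z ^ k, snd z) = P (fst z ^ k, snd z) * q (fst z ^ k, snd z)"
    unfolding eventually_nhds_pair using r1(1) q(2) r3(1) by (intro exI[of _ r]) (auto simp: r_def)
  then have "\<forall>\<^sub>F z in nhds 0. g z = P z * q z"
    by (rule eventually_power_fst[of "\<lambda>z. g z = P z * q z"])
  then show ?thesis using q(1) by blast
qed

lemma f_holo: "f \<in> holo_germs"
  using irr by (simp add: germ_irreducible_def)

text \<open>\<open>P\<close> vanishes at the origin and is no unit, so irreducibility of
  \<open>f\<close> makes the other factor a unit: \<open>f\<close> and \<open>P\<close> are
  associated.\<close>

lemma branch_equation:
  obtains P q q' where "P \<in> holo_germs" "\<forall>\<^sub>F z in nhds 0. P (fst z ^ k, snd z) = rootfac U z"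
    "q' \<in> holo_germs" "\<forall>\<^sub>F z in nhds 0. f z = P z * q z" "\<forall>\<^sub>F z in nhds 0. q z * q' z = 1"
proof -
  obtain P where P: "P \<in> holo_germs" "\<forall>\<^sub>F z in nhds 0. P (fst z ^ k, snd z) = rootfac U z"
    using branch_polynomial by blast
  obtain q where q: "q \<in> holo_germs" "\<forall>\<^sub>F z in nhds 0. f z = P z * q z"
    using kernel_generator[OF P(2) f_holo] f0 unfolding pull_def by blast
  have "P (0 ^ k, 0) = rootfac U 0" using eventually_nhds_x_imp_x[OF P(2)] by simp
  moreover have "(0 :: complex) ^ k = 0" using k by simp
  ultimately have P0: "P 0 = 0" using y0 by (simp add: rootfac_def zero_prod_def card_U)
  have "\<not> germ_unit P"
  proof
    assume "germ_unit P"
    then obtain h where "germ_eq (\<lambda>z. P z * h z) (\<lambda>z. 1)" unfolding germ_unit_def by blast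
    then have "P 0 * h 0 = 1" unfolding germ_eq_def by (rule eventually_nhds_x_imp_x)
    then show False using P0 by simp
  qed
  then have "germ_unit q"
    using irr P(1) q unfolding germ_irreducible_def germ_eq_def by blast
  then show thesis using that[OF P _ q(2)] unfolding germ_unit_def germ_eq_def by blast
qed

lemma kernel_f:
  assumes g: "g \<in> holo_germs" and g0: "\<forall>\<^sub>F t in nhds 0. pull g t = 0"
  shows "\<exists>a\<in>holo_germs. germ_eq g (\<lambda>z. a z * f z)"
proof -
  obtain P q q' where P: "P \<in> holo_germs" "\<forall>\<^sub>F z in nhds 0. P (fst z ^ k, snd z) = rootfac U z"
    and q: "q' \<in> holo_germs" "\<forall>\<^sub>F z in nhds 0. f z = P z * q z" "\<forall>\<^sub>F z in nhds 0. q z * q' z = 1"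
    by (rule branch_equation)
  obtain h where h: "h \<in> holo_germs" "\<forall>\<^sub>F z in nhds 0. g z = P z * h z"
    using kernel_generator[OF P(2) g g0] by blast
  have "\<forall>\<^sub>F z in nhds 0. g z = (q' z * h z) * f z"
    using h(2) q(2,3)
  proof eventually_elim
    case (elim z)
    have "(q' z * h z) * f z = P z * h z * (q z * q' z)" unfolding elim(2) by (simp only: mult_ac)
    then show ?case unfolding elim(1,3) mult_1_right by (rule sym)
  qed
  then show ?thesis
    unfolding germ_eq_def by (rule bexI[where x = "\<lambda>z. q' z * h z"]) (rule holo_germs_mult[OF q(1) h(1)])
qed

text \<open>Near the origin the zeros of \<open>f\<close> are those of \<open>P\<close>. For a
  \<open>k\<close>-th root \<open>x\<close> of the first coordinate some factor
  \<open>Y - y (\<zeta> * x)\<close> vanishes, and then \<open>\<zeta> * x\<close> is a parameter of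
  the point.\<close>

lemma zeros_on_branch:
  assumes "\<epsilon> > 0"
  shows "\<forall>\<^sub>F z in nhds 0. f z = 0 \<longrightarrow> (\<exists>t. norm t < \<epsilon> \<and> z = (t ^ k, y t))"
proof -
  obtain P q q' where P: "P \<in> holo_germs" "\<forall>\<^sub>F z in nhds 0. P (fst z ^ k, snd z) = rootfac U z"
    and q: "q' \<in> holo_germs" "\<forall>\<^sub>F z in nhds 0. f z = P z * q z" "\<forall>\<^sub>F z in nhds 0. q z * q' z = 1"
    by (rule branch_equation)
  obtain r where r: "r > 0" "\<And>x Y. norm x < r \<Longrightarrow> norm Y < r \<Longrightarrow> P (x ^ k, Y) = rootfac U (x, Y)"
    using P(2) unfolding eventually_nhds_pair by auto
  define \<delta> where "\<delta> = min r \<epsilon>"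
  have \<delta>: "\<delta> > 0" using r assms by (simp add: \<delta>_def)
  have "\<forall>\<^sub>F z in nhds (0 :: complex \<times> complex). norm (fst z) < \<delta> ^ k \<and> norm (snd z) < \<delta>"
    unfolding eventually_nhds_pair using \<delta> by (intro exI[of _ "min \<delta> (\<delta> ^ k)"]) auto
  then show ?thesis
    using q(2,3)
  proof eventually_elim
    case (elim z)
    show ?case
    proof
      assume "f z = 0"
      then have "P z = 0" using elim by auto
      obtain x where x: "x ^ k = fst z" "norm x < \<delta>" using exists_small_root[OF k _ \<delta>] elim by blast
      have "P (x ^ k, snd z) = rootfac U (x, snd z)" using x elim by (intro r(2)) (auto simp: \<delta>_def)
      then have "rootfac U (x, snd z) = 0" using \<open>P z = 0\<close> x(1) by simp
      then obtain \<zeta> where \<zeta>: "\<zeta> \<in> U" "snd z = y (\<zeta> * x)" using finite_U by (auto simp: rootfac_def)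
      have "z = ((\<zeta> * x) ^ k, y (\<zeta> * x))" using \<zeta> x(1) by (simp add: prod_eq_iff power_mult_distrib U_def)
      moreover have "norm (\<zeta> * x) < \<epsilon>" using norm_U[OF \<zeta>(1)] x(2) by (simp add: norm_mult \<delta>_def)
      ultimately show "\<exists>t. norm t < \<epsilon> \<and> z = (t ^ k, y t)" by blast
    qed
  qed
qed

text \<open>By Lagrange interpolation at the conjugates \<open>y (\<zeta> t)\<close>, the different
  \<open>D(t) = \<Prod> (y t - y (\<zeta> t))\<close>, taken over \<open>\<zeta> \<noteq> 1\<close>, multiplies every holomorphic germ into the
  local ring of the branch.\<close>

lemma conductor:
  obtains c where "\<And>h n a. lc h n a \<Longrightarrow> n \<ge> c \<Longrightarrow> \<exists>g\<in>holo_germs. \<forall>\<^sub>F t in nhds 0. pull g t = h t"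
proof -
  define D where "D = (\<lambda>t. rootfac (U - {1}) (t, y t))"
  have oneU: "(1 :: complex) \<in> U" by (simp add: U_def)
  have "(\<lambda>t. \<Prod>\<zeta>\<in>U - {1}. (y t - y (\<zeta> * t))) holomorphic_on ball 0 s"
    using hol hol_rot by (intro holomorphic_intros) auto
  then have Dh: "D holomorphic_on ball 0 s" by (simp add: D_def rootfac_def)
  have Dnz: "D t \<noteq> 0" if t: "norm t < s" "t \<noteq> 0" for t
  proof -
    have "y t - y (\<zeta> * t) \<noteq> 0" if \<zeta>: "\<zeta> \<in> U - {1}" for \<zeta>
    proof
      assume "y t - y (\<zeta> * t) = 0"
      then have yy: "y t = y (\<zeta> * t)" by simp
      have \<zeta>U: "\<zeta> \<in> U" using \<zeta> by blast
      have "t ^ k = (\<zeta> * t) ^ k" using \<zeta>U by (simp add: U_def power_mult_distrib)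
      moreover have "norm (\<zeta> * t) < s" using t(1) by (simp add: norm_mult norm_U[OF \<zeta>U])
      ultimately have "t = \<zeta> * t" using inj t(1) yy by blast
      then show False using t(2) \<zeta> by auto
    qed
    then show ?thesis using finite_U by (simp add: D_def rootfac_def)
  qed
  have "\<not> (\<forall>\<^sub>F t in nhds 0. D t = 0)"
  proof
    assume "\<forall>\<^sub>F t in nhds 0. D t = 0"
    then obtain r where r: "r > 0" "\<And>t. norm t < r \<Longrightarrow> D t = 0" unfolding eventually_nhds_0_norm by blast
    define t :: complex where "t = of_real (min r s / 2)"
    have "norm t < r" "norm t < s" "t \<noteq> 0" using r(1) s by (auto simp: t_def)
    then show False using r(2) Dnz by blast
  qed
  then obtain c d where c: "d \<noteq> 0" "lc D c d" using lc_exists[OF Dh s] by blast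
  have "\<exists>g\<in>holo_germs. \<forall>\<^sub>F t in nhds 0. pull g t = h t" if h: "lc h n a" "n \<ge> c" for h n a
  proof -
    obtain r u v where ruv: "r > 0" "u holomorphic_on ball 0 r" "v holomorphic_on ball 0 r" "v 0 = d"
      "\<And>t. norm t < r \<Longrightarrow> h t = t ^ n * u t" "\<And>t. norm t < r \<Longrightarrow> D t = t ^ c * v t"
      using lc_common_radius[OF h(1) c(2)] by metis
    have "continuous (at 0) v"
      using holomorphic_on_imp_continuous_on[OF ruv(3)] ruv(1) by (simp add: continuous_on_eq_continuous_at)
    then obtain e where e: "e > 0" "\<And>t. dist t 0 < e \<Longrightarrow> v t \<noteq> 0"
      using continuous_at_avoid[of 0 v 0] ruv(4) c(1) by (auto simp: dist_commute)
    define r' where "r' = min e (min r s)"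
    have r': "r' > 0" using e ruv(1) s by (simp add: r'_def)
    have sub: "ball 0 r' \<subseteq> (ball 0 r :: complex set)" by (auto simp: r'_def)
    \<comment> \<open>This is \<open>h / D\<close>, holomorphic near \<open>0\<close> because
      \<open>n >= c\<close>.\<close>
    define w where "w = (\<lambda>t. t ^ (n - c) * u t / v t)"
    have wh: "w holomorphic_on ball 0 r'"
      unfolding w_def using e(2) ruv(2,3) sub
      by (intro holomorphic_intros) (auto simp: r'_def intro: holomorphic_on_subset)
    have Dw: "D t * w t = h t" if "norm t < r'" for t
    proof -
      have "v t \<noteq> 0" using e(2)[of t] that by (simp add: r'_def)
      have "D t * w t = (t ^ c * v t) * (t ^ (n - c) * u t / v t)" using ruv(6)[of t] that by (simp add: w_def r'_def)
      also have "\<dots> = (t ^ c * t ^ (n - c)) * u t" using \<open>v t \<noteq> 0\<close> by (simp add: mult_ac)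
      also have "\<dots> = h t" using h(2) ruv(5)[of t] that by (simp add: r'_def flip: power_add)
      finally show ?thesis .
    qed
    \<comment> \<open>The rotations of \<open>q\<close> are the Lagrange terms for the nodes
      \<open>y (\<zeta> * t)\<close>; at \<open>Y = y t\<close> only the unrotated one survives,
      with value \<open>D t * w t = h t\<close>.\<close>
    define q where "q = (\<lambda>z. w (fst z) * rootfac (U - {1}) z)"
    have "(\<lambda>z. w (fst z)) \<in> holo_germs" using hol2_fst[OF wh r'] by (rule hol2_imp_holo_germs)
    then have "q \<in> holo_germs" unfolding q_def using rootfac_holo[of "U - {1}"] by (intro holo_germs_mult) auto
    then obtain g r3 where g: "g \<in> holo_germs" "r3 > 0" "\<And>x Y. norm x < r3 \<Longrightarrow> norm Y < r3 \<Longrightarrow>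
        (\<Sum>\<zeta> | \<zeta> ^ k = 1. q (\<zeta> * x, Y)) = of_nat k * g (x ^ k, Y)"
      using germ_average[OF _ k] by metis
    obtain r4 where r4: "r4 > 0" "r4 \<le> s" "r4 \<le> r3" "\<And>t. norm t < r4 \<Longrightarrow> norm (y t) < r3"
      using holomorphic_small[OF hol s y0 g(2)] by blast
    have "of_nat k * g (t ^ k, y t) = h t" if t: "norm t < min r4 r'" for t
    proof -
      have "of_nat k * g (t ^ k, y t) = (\<Sum>\<zeta>\<in>U. q (\<zeta> * t, y t))"
        using g(3)[of t "y t"] r4 t by (simp add: U_def)
      also have "\<dots> = (\<Sum>\<zeta>\<in>{1}. q (\<zeta> * t, y t))"
      proof (rule sum.mono_neutral_right[OF finite_U])
        show "\<forall>\<omega>\<in>U - {1}. q (\<omega> * t, y t) = 0"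
        proof
          fix \<omega> assume w: "\<omega> \<in> U - {1}"
          have w0: "\<omega> \<noteq> 0" using norm_U[of \<omega>] w by auto
          have "1 / \<omega> \<in> U - {1}" using w w0 by (auto simp: U_def power_divide)
          moreover have "y t - y (1 / \<omega> * (\<omega> * t)) = 0" using w0 by simp
          ultimately have "\<exists>\<zeta>\<in>U - {1}. y t - y (\<zeta> * (\<omega> * t)) = 0" by blast
          then have "rootfac (U - {1}) (\<omega> * t, y t) = 0"
            unfolding rootfac_def fst_conv snd_conv by (rule prod_zero[rotated]) (use finite_U in blast)
          then show "q (\<omega> * t, y t) = 0" by (simp add: q_def)
        qed
      qed (use oneU in auto)
      also have "\<dots> = D t * w t" by (simp add: q_def D_def)
      also have "\<dots> = h t" using Dw t by simp
      finally show ?thesis .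
    qed
    then have "\<forall>\<^sub>F t in nhds 0. pull (\<lambda>z. of_nat k * g z) t = h t"
      unfolding eventually_nhds_0_norm pull_def using r4(1) r' by (intro exI[of _ "min r4 r'"]) auto
    then show ?thesis using holo_germs_cmult[OF g(1)] by blast
  qed
  then show thesis by (rule that)
qed

end

lemma lc_divide:
  assumes "lc f m c" "lc g n d" "d \<noteq> 0" "n \<le> m"
  shows "\<exists>w a. lc w (m - n) a \<and> (\<forall>\<^sub>F t in nhds 0. f t = w t * g t)"
proof -
  obtain r u v where ruv: "r > 0" "u holomorphic_on ball 0 r" "v holomorphic_on ball 0 r" "v 0 = d"
    "\<And>t. norm t < r \<Longrightarrow> f t = t ^ m * u t" "\<And>t. norm t < r \<Longrightarrow> g t = t ^ n * v t"
    using lc_common_radius[OF assms(1,2)] by metis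
  have "continuous (at 0) v"
    using holomorphic_on_imp_continuous_on[OF ruv(3)] ruv(1) by (simp add: continuous_on_eq_continuous_at)
  then obtain e where e: "e > 0" "\<And>t. dist t 0 < e \<Longrightarrow> v t \<noteq> 0"
    using continuous_at_avoid[of 0 v 0] ruv(4) assms(3) by (auto simp: dist_commute)
  define r' where "r' = min e r"
  have r': "r' > 0" using e ruv(1) by (simp add: r'_def)
  have "(\<lambda>t. u t / v t) holomorphic_on ball 0 r'"
    using e(2) ruv(2,3) by (intro holomorphic_intros) (auto simp: r'_def intro: holomorphic_on_subset)
  then have "lc (\<lambda>t. t ^ (m - n) * (u t / v t)) (m - n) (u 0 / v 0)"
    using lcI[OF r', of "\<lambda>t. u t / v t" "\<lambda>t. t ^ (m - n) * (u t / v t)" "m - n"] by simp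
  moreover have "f t = t ^ (m - n) * (u t / v t) * g t" if "norm t < r'" for t
  proof -
    have v: "v t \<noteq> 0" using e(2)[of t] that by (simp add: r'_def)
    have "t ^ (m - n) * (u t / v t) * g t = t ^ (m - n) * (u t / v t) * (t ^ n * v t)"
      using ruv(6)[of t] that by (simp add: r'_def)
    also have "\<dots> = (t ^ (m - n) * t ^ n) * u t" using v by (simp add: mult_ac)
    also have "\<dots> = f t" using ruv(5)[of t] that assms(4) by (simp add: r'_def flip: power_add)
    finally show ?thesis by simp
  qed
  then have "\<forall>\<^sub>F t in nhds 0. f t = t ^ (m - n) * (u t / v t) * g t"
    unfolding eventually_nhds_0_norm using r' by blast
  ultimately show ?thesis by blast
qed

lemma lc_sub: "lc f m c \<Longrightarrow> lc g m d \<Longrightarrow> lc (\<lambda>t. f t - a * g t) m (c - a * d)"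
  using lc_add[OF _ lc_cmult[of g m d "- a"], of f c] by simp

section \<open>Ideals of germs and the dimension of the quotient\<close>

lemma germ_ideal_add:
  assumes "p \<in> germ_ideal f h" "q \<in> germ_ideal f h"
  shows "(\<lambda>z. p z + q z) \<in> germ_ideal f h"
proof -
  obtain a b where ab: "a \<in> holo_germs" "b \<in> holo_germs" "\<forall>\<^sub>F z in nhds 0. p z = a z * f z + b z * h z"
    using assms(1) unfolding germ_ideal_def germ_eq_def by blast
  obtain a' b' where ab': "a' \<in> holo_germs" "b' \<in> holo_germs" "\<forall>\<^sub>F z in nhds 0. q z = a' z * f z + b' z * h z"
    using assms(2) unfolding germ_ideal_def germ_eq_def by blast
  have "\<forall>\<^sub>F z in nhds 0. p z + q z = (a z + a' z) * f z + (b z + b' z) * h z"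
    using ab(3) ab'(3) by eventually_elim (simp add: algebra_simps)
  then show ?thesis
    unfolding germ_ideal_def germ_eq_def using holo_germs_add[OF ab(1) ab'(1)] holo_germs_add[OF ab(2) ab'(2)]
    by (intro CollectI bexI[of _ "\<lambda>z. a z + a' z"] bexI[of _ "\<lambda>z. b z + b' z"]) auto
qed

lemma germ_ideal_mult:
  assumes "p \<in> germ_ideal f h" "c \<in> holo_germs"
  shows "(\<lambda>z. c z * p z) \<in> germ_ideal f h"
proof -
  obtain a b where ab: "a \<in> holo_germs" "b \<in> holo_germs" "\<forall>\<^sub>F z in nhds 0. p z = a z * f z + b z * h z"
    using assms(1) unfolding germ_ideal_def germ_eq_def by blast
  have "\<forall>\<^sub>F z in nhds 0. c z * p z = (c z * a z) * f z + (c z * b z) * h z"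
    using ab(3) by eventually_elim (simp add: algebra_simps)
  then show ?thesis
    unfolding germ_ideal_def germ_eq_def using holo_germs_mult[OF assms(2) ab(1)] holo_germs_mult[OF assms(2) ab(2)]
    by (intro CollectI bexI[of _ "\<lambda>z. c z * a z"] bexI[of _ "\<lambda>z. c z * b z"]) auto
qed

lemma germ_ideal_zero: "(\<lambda>z. 0) \<in> germ_ideal f h"
  unfolding germ_ideal_def germ_eq_def
  by (intro CollectI bexI[of _ "\<lambda>z. 0"]) auto

lemma germ_ideal_generator: "h \<in> germ_ideal f h"
  unfolding germ_ideal_def germ_eq_def
  by (intro CollectI bexI[of _ "\<lambda>z. 0"] bexI[of _ "\<lambda>z. 1"]) auto

lemma germ_ideal_diff:
  assumes "p \<in> germ_ideal f h" "q \<in> germ_ideal f h"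
  shows "(\<lambda>z. p z - q z) \<in> germ_ideal f h"
  using germ_ideal_add[OF assms(1) germ_ideal_mult[OF assms(2) holo_germs_const[of "-1"]]] by simp

lemma germ_ideal_sum:
  assumes "\<And>b. b \<in> B \<Longrightarrow> p b \<in> germ_ideal f h"
  shows "(\<lambda>z. \<Sum>b\<in>B. c b * p b z) \<in> germ_ideal f h"
  using assms
proof (induction B rule: infinite_finite_induct)
  case (insert b B)
  then show ?case
    using germ_ideal_add[OF germ_ideal_mult[OF _ holo_germs_const[of "c b"]], of "p b"] by simp
qed (auto intro: germ_ideal_zero)

text \<open>The elements of \<open>\<Gamma>\<close> below \<open>n + C\<close> are counted twice: as
  \<open>E\<close> together with the translates by \<open>n\<close> of those below \<open>C\<close>,
  and as those below \<open>C\<close> together with the full interval from \<open>C\<close> to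
  \<open>n + C\<close>.\<close>

lemma card_semigroup_quotient:
  fixes \<Gamma> :: "nat set"
  assumes add: "\<And>a b. a \<in> \<Gamma> \<Longrightarrow> b \<in> \<Gamma> \<Longrightarrow> a + b \<in> \<Gamma>" and n: "n \<in> \<Gamma>" and C: "\<And>m. m \<ge> C \<Longrightarrow> m \<in> \<Gamma>"
  defines "E \<equiv> \<Gamma> - (\<lambda>\<gamma>. n + \<gamma>) ` \<Gamma>"
  shows "finite E" "card E = n"
proof -
  have E: "E \<subseteq> {..<n + C}"
  proof
    fix x assume x: "x \<in> E"
    show "x \<in> {..<n + C}"
    proof (rule ccontr)
      assume "x \<notin> {..<n + C}"
      then have "x - n \<in> \<Gamma>" "x = n + (x - n)" using C[of "x - n"] by auto
      then show False using x unfolding E_def by blast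
    qed
  qed
  then show fin: "finite E" by (rule finite_subset) simp
  let ?A = "\<Gamma> \<inter> {..<C}"
  have split: "\<Gamma> \<inter> {..<n + C} = E \<union> (\<lambda>\<gamma>. n + \<gamma>) ` ?A"
  proof
    show "\<Gamma> \<inter> {..<n + C} \<subseteq> E \<union> (\<lambda>\<gamma>. n + \<gamma>) ` ?A"
    proof
      fix x assume x: "x \<in> \<Gamma> \<inter> {..<n + C}"
      show "x \<in> E \<union> (\<lambda>\<gamma>. n + \<gamma>) ` ?A"
      proof (cases "x \<in> (\<lambda>\<gamma>. n + \<gamma>) ` \<Gamma>")
        case True
        then obtain \<gamma> where "\<gamma> \<in> \<Gamma>" "x = n + \<gamma>" by blast
        then show ?thesis using x by simp
      next
        case False
        then show ?thesis using x by (simp add: E_def)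
      qed
    qed
    show "E \<union> (\<lambda>\<gamma>. n + \<gamma>) ` ?A \<subseteq> \<Gamma> \<inter> {..<n + C}"
    proof
      fix x assume "x \<in> E \<union> (\<lambda>\<gamma>. n + \<gamma>) ` ?A"
      then consider "x \<in> E" | \<gamma> where "x = n + \<gamma>" "\<gamma> \<in> \<Gamma>" "\<gamma> < C" by blast
      then show "x \<in> \<Gamma> \<inter> {..<n + C}"
      proof cases
        case 1
        then show ?thesis using E unfolding E_def by blast
      next
        case 2
        then show ?thesis using add[OF n 2(2)] by simp
      qed
    qed
  qed
  have "card (\<Gamma> \<inter> {..<n + C}) = card E + card ?A"
  proof -
    have "E \<inter> (\<lambda>\<gamma>. n + \<gamma>) ` ?A = {}" unfolding E_def by blast
    then show ?thesis unfolding split using fin by (simp add: card_Un_disjoint card_image)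
  qed
  moreover have "\<Gamma> \<inter> {..<n + C} = ?A \<union> {C..<n + C}"
  proof
    show "\<Gamma> \<inter> {..<n + C} \<subseteq> ?A \<union> {C..<n + C}" by auto
    show "?A \<union> {C..<n + C} \<subseteq> \<Gamma> \<inter> {..<n + C}" using C by (simp add: subset_iff)
  qed
  then have "card (\<Gamma> \<inter> {..<n + C}) = card ?A + card {C..<n + C}"
    using card_Un_disjoint[of ?A "{C..<n + C}"] by (simp add: disjoint_iff)
  then have "card (\<Gamma> \<inter> {..<n + C}) = card ?A + n" by simp
  ultimately show "card E = n" by simp
qed

context puiseux_branch
begin

definition vals :: "nat set" where
  "vals = {n. \<exists>g\<in>holo_germs. \<exists>c. c \<noteq> 0 \<and> lc (pull g) n c}"

lemma vals_add: "a \<in> vals \<Longrightarrow> b \<in> vals \<Longrightarrow> a + b \<in> vals"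
proof -
  assume "a \<in> vals" "b \<in> vals"
  then obtain g h c d where g: "g \<in> holo_germs" "c \<noteq> 0" "lc (pull g) a c"
    and h: "h \<in> holo_germs" "d \<noteq> 0" "lc (pull h) b d" unfolding vals_def by blast
  have "lc (pull (\<lambda>z. g z * h z)) (a + b) (c * d)" using lc_mult[OF g(3) h(3)] by (simp add: pull_def)
  moreover have "c * d \<noteq> 0" using g(2) h(2) by simp
  ultimately show ?thesis unfolding vals_def using holo_germs_mult[OF g(1) h(1)] by blast
qed

lemma vals_cofinite: "\<exists>C. \<forall>n\<ge>C. n \<in> vals"
proof -
  obtain C where C: "\<And>h n a. lc h n a \<Longrightarrow> n \<ge> C \<Longrightarrow> \<exists>g\<in>holo_germs. \<forall>\<^sub>F t in nhds 0. pull g t = h t"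
    by (rule conductor) blast
  have "n \<in> vals" if n: "n \<ge> C" for n
  proof -
    have l: "lc (\<lambda>t. t ^ n) n 1" using lcI[of 1 "\<lambda>t. 1" "\<lambda>t. t ^ n" n] by simp
    then obtain g where g: "g \<in> holo_germs" "\<forall>\<^sub>F t in nhds 0. pull g t = t ^ n" using C[OF l n] by blast
    have "\<forall>\<^sub>F t in nhds 0. t ^ n = pull g t" using g(2) by (rule eventually_mono) simp
    then have "lc (pull g) n 1" by (rule lc_cong[OF l])
    then have "1 \<noteq> (0 :: complex) \<and> lc (pull g) n 1" by simp
    then show ?thesis unfolding vals_def using g(1) by (intro CollectI bexI[of _ g] exI[of _ 1])
  qed
  then show ?thesis by blast
qed

text \<open>The pullback of \<open>f\<close> is zero and, by \<open>kernel_f\<close>,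
  \<open>f\<close> generates the kernel, so membership in the ideal can be tested on the
  branch.\<close>

lemma in_germ_ideal_iff:
  assumes "g \<in> holo_germs" "h \<in> holo_germs"
  shows "g \<in> germ_ideal f h \<longleftrightarrow> (\<exists>b\<in>holo_germs. \<forall>\<^sub>F t in nhds 0. pull g t = pull b t * pull h t)"
proof
  assume "g \<in> germ_ideal f h"
  then obtain a b where ab: "a \<in> holo_germs" "b \<in> holo_germs" "\<forall>\<^sub>F z in nhds 0. g z = a z * f z + b z * h z"
    unfolding germ_ideal_def germ_eq_def by blast
  have "\<forall>\<^sub>F t in nhds 0. pull g t = pull (\<lambda>z. a z * f z + b z * h z) t" using ab(3) by (rule pull_cong)
  then have "\<forall>\<^sub>F t in nhds 0. pull g t = pull b t * pull h t"
    using f0 by eventually_elim (simp add: pull_def)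
  then show "\<exists>b\<in>holo_germs. \<forall>\<^sub>F t in nhds 0. pull g t = pull b t * pull h t" using ab(2) by blast
next
  assume "\<exists>b\<in>holo_germs. \<forall>\<^sub>F t in nhds 0. pull g t = pull b t * pull h t"
  then obtain b where b: "b \<in> holo_germs" "\<forall>\<^sub>F t in nhds 0. pull g t = pull b t * pull h t" by blast
  have "\<forall>\<^sub>F t in nhds 0. pull (\<lambda>z. g z - b z * h z) t = 0"
    using b(2) by eventually_elim (simp add: pull_def)
  moreover have "(\<lambda>z. g z - b z * h z) \<in> holo_germs" using assms b(1) by (intro holo_germs_diff holo_germs_mult)
  ultimately obtain a where a: "a \<in> holo_germs" "\<forall>\<^sub>F z in nhds 0. g z - b z * h z = a z * f z"
    using kernel_f unfolding germ_eq_def by blast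
  have "\<forall>\<^sub>F z in nhds 0. g z = a z * f z + b z * h z"
    using a(2) by eventually_elim (simp add: algebra_simps)
  then show "g \<in> germ_ideal f h" unfolding germ_ideal_def germ_eq_def using a(1) b(1) by blast
qed

lemma pull_lc_0: "g \<in> holo_germs \<Longrightarrow> \<exists>c. lc (pull g) 0 c"
proof -
  assume "g \<in> holo_germs"
  then obtain r where "r > 0" "pull g holomorphic_on ball 0 r" using pull_holomorphic by blast
  then show ?thesis using lcI[of r "pull g" "pull g" 0] by auto
qed

text \<open>The orders of germs that are not orders of multiples of \<open>h\<close> form the set
  \<open>E\<close>, which has \<open>n\<close> elements. Germs with these orders span the quotient
  because leading terms can be removed successively, and are independent because a multiple of
  \<open>h\<close> with finite order has it in \<open>n + vals\<close>.\<close>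

theorem branch_intersection_mult:
  assumes h: "h \<in> holo_germs" and hn: "lc (pull h) n c0" "c0 \<noteq> 0"
  shows "intersection_mult f h = enat n"
proof -
  let ?I = "germ_ideal f h"
  obtain C where C: "\<And>h n a. lc h n a \<Longrightarrow> n \<ge> C \<Longrightarrow> \<exists>g\<in>holo_germs. \<forall>\<^sub>F t in nhds 0. pull g t = h t"
    by (rule conductor) blast
  define E where "E = vals - (\<lambda>\<gamma>. n + \<gamma>) ` vals"
  have nvals: "n \<in> vals" unfolding vals_def using h hn by blast
  obtain C' where C': "\<And>m. m \<ge> C' \<Longrightarrow> m \<in> vals" using vals_cofinite by blast
  have finE: "finite E" and cardE: "card E = n"
    unfolding E_def using card_semigroup_quotient[OF vals_add nvals C'] by blast+
  have "\<forall>\<gamma>\<in>vals. \<exists>g c. g \<in> holo_germs \<and> c \<noteq> 0 \<and> lc (pull g) \<gamma> c" unfolding vals_def by blast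
  then obtain G cf where G: "\<And>\<gamma>. \<gamma> \<in> vals \<Longrightarrow> G \<gamma> \<in> holo_germs \<and> cf \<gamma> \<noteq> 0 \<and> lc (pull (G \<gamma>)) \<gamma> (cf \<gamma>)"
    by metis
  have GE: "G \<gamma> \<in> holo_germs" "cf \<gamma> \<noteq> 0" "lc (pull (G \<gamma>)) \<gamma> (cf \<gamma>)" if "\<gamma> \<in> E" for \<gamma>
    using G that by (auto simp: E_def)
  \<comment> \<open>The induction raises the order \<open>j\<close> to \<open>n + C\<close>, from
    where on the quotient by \<open>h\<close> has order at least \<open>C\<close> and is therefore
    the pullback of a germ. Below, the leading term is removed with \<open>G j\<close> if
    \<open>j\<close> is in \<open>E\<close> and with \<open>h * G \<gamma>\<close> if
    \<open>j = n + \<gamma>\<close>; other orders do not occur.\<close>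
  have span: "\<exists>a. (\<lambda>z. g z - (\<Sum>\<gamma>\<in>E. a \<gamma> * G \<gamma> z)) \<in> ?I" if "g \<in> holo_germs" "lc (pull g) j c" for g j c
    using that
  proof (induction "n + C - j" arbitrary: g j c rule: less_induct)
    case less
    show ?case
    proof (cases "j \<ge> n + C")
      case True
      then obtain w a where w: "lc w (j - n) a" "\<forall>\<^sub>F t in nhds 0. pull g t = w t * pull h t"
        using lc_divide[OF less.prems(2) hn] by auto
      have "j - n \<ge> C" using True by simp
      then obtain b where b: "b \<in> holo_germs" "\<forall>\<^sub>F t in nhds 0. pull b t = w t" using C[OF w(1)] by blast
      have "\<forall>\<^sub>F t in nhds 0. pull g t = pull b t * pull h t" using w(2) b(2) by eventually_elim simp
      then have "g \<in> ?I" using in_germ_ideal_iff[OF less.prems(1) h] b(1) by blast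
      then show ?thesis by (intro exI[of _ "\<lambda>_. 0"]) simp
    next
      case False
      then have dec: "n + C - Suc j < n + C - j" by simp
      have step: "\<exists>a. (\<lambda>z. g' z - (\<Sum>\<gamma>\<in>E. a \<gamma> * G \<gamma> z)) \<in> ?I" if g': "g' \<in> holo_germs" "lc (pull g') j 0" for g'
      proof -
        obtain d where "lc (pull g') (Suc j) d" using lc_Suc[OF g'(2)] by blast
        then show ?thesis using less.hyps[OF dec g'(1)] by blast
      qed
      show ?thesis
      proof (cases "c = 0")
        case True
        then show ?thesis using step less.prems by blast
      next
        case c: False
        then have jv: "j \<in> vals" unfolding vals_def using less.prems by blast
        show ?thesis
        proof (cases "j \<in> E")
          case True
          define k where "k = c / cf j"
          define g' where "g' = (\<lambda>z. g z - k * G j z)"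
          have "g' \<in> holo_germs" unfolding g'_def using less.prems(1) GE(1)[OF True]
            by (intro holo_germs_diff holo_germs_cmult)
          moreover have "lc (pull g') j 0"
            using lc_sub[OF less.prems(2) GE(3)[OF True], of k] GE(2)[OF True] by (simp add: k_def g'_def pull_def)
          ultimately obtain a where a: "(\<lambda>z. g' z - (\<Sum>\<gamma>\<in>E. a \<gamma> * G \<gamma> z)) \<in> ?I" using step by blast
          have "(\<Sum>\<gamma>\<in>E. (a \<gamma> + (if \<gamma> = j then k else 0)) * G \<gamma> z) = (\<Sum>\<gamma>\<in>E. a \<gamma> * G \<gamma> z) + k * G j z" for z
          proof -
            have "(\<Sum>\<gamma>\<in>E. (if \<gamma> = j then k else 0) * G \<gamma> z) = (\<Sum>\<gamma>\<in>E. if \<gamma> = j then k * G j z else 0)"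
              by (intro sum.cong) auto
            then show ?thesis using True finE by (simp add: distrib_right sum.distrib)
          qed
          then have "(\<lambda>z. g z - (\<Sum>\<gamma>\<in>E. (a \<gamma> + (if \<gamma> = j then k else 0)) * G \<gamma> z)) =
              (\<lambda>z. g' z - (\<Sum>\<gamma>\<in>E. a \<gamma> * G \<gamma> z))" by (simp add: g'_def fun_eq_iff)
          then show ?thesis using a by (intro exI[of _ "\<lambda>\<gamma>. a \<gamma> + (if \<gamma> = j then k else 0)"]) simp
        next
          case False
          then obtain \<gamma> where \<gamma>: "\<gamma> \<in> vals" "j = n + \<gamma>" using jv unfolding E_def by blast
          have G\<gamma>: "G \<gamma> \<in> holo_germs" "cf \<gamma> \<noteq> 0" "lc (pull (G \<gamma>)) \<gamma> (cf \<gamma>)" using G[OF \<gamma>(1)] by auto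
          define k where "k = c / (c0 * cf \<gamma>)"
          define g' where "g' = (\<lambda>z. g z - k * (h z * G \<gamma> z))"
          have "g' \<in> holo_germs" unfolding g'_def using less.prems(1) G\<gamma>(1) h
            by (intro holo_germs_diff holo_germs_cmult holo_germs_mult)
          moreover have "lc (pull g') j 0"
            using lc_sub[OF less.prems(2) lc_mult[OF hn(1) G\<gamma>(3), folded \<gamma>(2)], of k] G\<gamma>(2) hn(2)
            by (simp add: k_def g'_def pull_def)
          ultimately obtain a where a: "(\<lambda>z. g' z - (\<Sum>\<gamma>\<in>E. a \<gamma> * G \<gamma> z)) \<in> ?I" using step by blast
          have "(\<lambda>z. k * G \<gamma> z * h z) \<in> ?I"
            using germ_ideal_mult[OF germ_ideal_generator holo_germs_cmult[OF G\<gamma>(1), of k]] by simp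
          from germ_ideal_add[OF a this]
          have "(\<lambda>z. g z - (\<Sum>\<gamma>\<in>E. a \<gamma> * G \<gamma> z)) \<in> ?I" by (simp add: g'_def mult_ac)
          then show ?thesis by blast
        qed
      qed
    qed
  qed
  \<comment> \<open>The orders of the \<open>G \<gamma>\<close> are distinct, so the least index
    with nonzero coefficient is the order of the combination.\<close>
  have indep: "\<forall>\<gamma>\<in>E. a \<gamma> = 0" if a: "(\<lambda>z. \<Sum>\<gamma>\<in>E. a \<gamma> * G \<gamma> z) \<in> ?I" for a
  proof (rule ccontr)
    assume "\<not> (\<forall>\<gamma>\<in>E. a \<gamma> = 0)"
    define S where "S = {\<gamma>\<in>E. a \<gamma> \<noteq> 0}"
    have S: "finite S" "S \<noteq> {}" using finE \<open>\<not> (\<forall>\<gamma>\<in>E. a \<gamma> = 0)\<close> by (auto simp: S_def)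
    define m where "m = Min S"
    have m: "m \<in> S" "\<And>\<gamma>. \<gamma> \<in> S \<Longrightarrow> m \<le> \<gamma>" using S by (auto simp: m_def)
    then have mE: "m \<in> E" "a m \<noteq> 0" by (auto simp: S_def)
    let ?g = "\<lambda>z. \<Sum>\<gamma>\<in>E. a \<gamma> * G \<gamma> z"
    have "lc (\<lambda>t. a \<gamma> * pull (G \<gamma>) t) m (if \<gamma> = m then a m * cf m else 0)" if \<gamma>: "\<gamma> \<in> E" for \<gamma>
    proof -
      have "\<gamma> = m \<or> (a \<gamma> = 0 \<and> \<gamma> \<noteq> m) \<or> m < \<gamma>" 
      proof (cases "a \<gamma> = 0")
        case False
        then have "m \<le> \<gamma>" using m(2)[of \<gamma>] \<gamma> unfolding S_def by blast
        then show ?thesis by linarith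
      qed blast
      then consider "\<gamma> = m" | "a \<gamma> = 0" "\<gamma> \<noteq> m" | "m < \<gamma>" by blast
      then show ?thesis
      proof cases
        case 1
        then show ?thesis using lc_cmult[OF GE(3)[OF mE(1)]] by simp
      next
        case 2
        then show ?thesis using lc_zero by simp
      next
        case 3
        then show ?thesis using lc_cmult[OF lc_lower[OF GE(3)[OF \<gamma>] 3], of "a \<gamma>"] by simp
      qed
    qed
    then have "lc (\<lambda>t. \<Sum>\<gamma>\<in>E. a \<gamma> * pull (G \<gamma>) t) m (\<Sum>\<gamma>\<in>E. if \<gamma> = m then a m * cf m else 0)" by (rule lc_sum)
    then have lcg: "lc (pull ?g) m (a m * cf m)" using mE(1) finE by (simp add: pull_def)
    have nz: "a m * cf m \<noteq> 0" using mE(2) GE(2)[OF mE(1)] by simp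
    have "?g \<in> holo_germs" using GE(1) by (intro holo_germs_sum holo_germs_cmult)
    then obtain b where b: "b \<in> holo_germs" "\<forall>\<^sub>F t in nhds 0. pull ?g t = pull b t * pull h t"
      using in_germ_ideal_iff[OF _ h] a by blast
    have lcb: "lc (\<lambda>t. pull b t * pull h t) m (a m * cf m)" by (rule lc_cong[OF lcg b(2)])
    from pull_lc_exists[OF b(1)] show False
    proof
      assume b0: "\<forall>\<^sub>F t in nhds 0. pull b t = 0"
      have "\<forall>\<^sub>F t in nhds 0. pull b t * pull h t = 0" using b0 by eventually_elim simp
      from lc_cong[OF lcb this] have "a m * cf m = 0" by (rule lc_unique[OF _ lc_zero])
      then show False using nz by contradiction
    next
      assume "\<exists>j c. c \<noteq> 0 \<and> lc (pull b) j c"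
      then obtain j c where j: "c \<noteq> 0" "lc (pull b) j c" by blast
      have "m = j + n" using lc_order_unique[OF lcb lc_mult[OF j(2) hn(1)] nz] j(1) hn(2) by simp
      moreover have "j \<in> vals" unfolding vals_def using b(1) j by blast
      ultimately have "m \<in> (\<lambda>\<gamma>. n + \<gamma>) ` vals" by (simp add: add.commute)
      then show False using mE(1) by (simp add: E_def)
    qed
  qed
  have injG: "inj_on G E"
  proof (rule inj_onI)
    fix x x' assume x: "x \<in> E" "x' \<in> E" "G x = G x'"
    then show "x = x'" using lc_order_unique[of "pull (G x)" x "cf x" x' "cf x'"] GE[OF x(1)] GE[OF x(2)] by simp
  qed
  let ?B = "G ` E"
  have sumB: "(\<Sum>b\<in>?B. c b * b z) = (\<Sum>\<gamma>\<in>E. c (G \<gamma>) * G \<gamma> z)" for c :: "fun2 \<Rightarrow> complex" and z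
    by (simp add: sum.reindex[OF injG])
  have basis: "quotient_basis ?I ?B"
    unfolding quotient_basis_def
  proof (intro conjI ballI)
    show "finite ?B" using finE by simp
    show "?B \<subseteq> holo_germs" using GE(1) by auto
    fix g assume g: "g \<in> holo_germs"
    obtain c where "lc (pull g) 0 c" using pull_lc_0[OF g] by blast
    then obtain a where a: "(\<lambda>z. g z - (\<Sum>\<gamma>\<in>E. a \<gamma> * G \<gamma> z)) \<in> ?I" using span[OF g] by blast
    show "\<exists>!c. c \<in> extensional ?B \<and> (\<lambda>z. g z - (\<Sum>b\<in>?B. c b * b z)) \<in> ?I"
    proof (rule ex_ex1I)
      define c where "c = restrict (\<lambda>b. a (the_inv_into E G b)) ?B"
      have "(\<Sum>b\<in>?B. c b * b z) = (\<Sum>\<gamma>\<in>E. a \<gamma> * G \<gamma> z)" for z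
        unfolding sumB by (intro sum.cong) (auto simp: c_def the_inv_into_f_f[OF injG])
      then have "c \<in> extensional ?B \<and> (\<lambda>z. g z - (\<Sum>b\<in>?B. c b * b z)) \<in> ?I" using a by (simp add: c_def)
      then show "\<exists>c. c \<in> extensional ?B \<and> (\<lambda>z. g z - (\<Sum>b\<in>?B. c b * b z)) \<in> ?I" by blast
    next
      fix c c' assume c: "c \<in> extensional ?B \<and> (\<lambda>z. g z - (\<Sum>b\<in>?B. c b * b z)) \<in> ?I"
        and c': "c' \<in> extensional ?B \<and> (\<lambda>z. g z - (\<Sum>b\<in>?B. c' b * b z)) \<in> ?I"
      have "(\<lambda>z. (g z - (\<Sum>b\<in>?B. c' b * b z)) - (g z - (\<Sum>b\<in>?B. c b * b z))) \<in> ?I"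
        using germ_ideal_diff c c' by blast
      also have "(\<lambda>z. (g z - (\<Sum>b\<in>?B. c' b * b z)) - (g z - (\<Sum>b\<in>?B. c b * b z))) =
          (\<lambda>z. \<Sum>\<gamma>\<in>E. (c (G \<gamma>) - c' (G \<gamma>)) * G \<gamma> z)"
        unfolding sumB by (simp add: left_diff_distrib sum_subtractf)
      finally have "\<forall>\<gamma>\<in>E. c (G \<gamma>) - c' (G \<gamma>) = 0" by (rule indep)
      then show "c = c'" using c c' by (intro extensionalityI[of c ?B c']) auto
    qed
  qed
  \<comment> \<open>The multiplicity is an infimum over bases, so the basis of \<open>n\<close>
    elements is complemented by a lower bound for all bases.\<close>
  have minimal: "n \<le> card B'" if B': "quotient_basis ?I B'" for B'
  proof (rule ccontr)
    assume "\<not> n \<le> card B'"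
    then have less: "card B' < card E" using cardE by simp
    have finB': "finite B'" using B' by (simp add: quotient_basis_def)
    have "\<forall>\<gamma>\<in>E. \<exists>c. (\<lambda>z. G \<gamma> z - (\<Sum>b\<in>B'. c b * b z)) \<in> ?I"
      using B' GE(1) unfolding quotient_basis_def by blast
    from bchoice[OF this] obtain c
      where c: "\<And>\<gamma>. \<gamma> \<in> E \<Longrightarrow> (\<lambda>z. G \<gamma> z - (\<Sum>b\<in>B'. c \<gamma> b * b z)) \<in> ?I" by blast
    obtain v where v: "\<exists>\<gamma>\<in>E. v \<gamma> \<noteq> 0" "\<forall>b\<in>B'. (\<Sum>\<gamma>\<in>E. c \<gamma> b * v \<gamma>) = 0"
      using linear_system_nontrivial[OF finB' finE less, of "\<lambda>b \<gamma>. c \<gamma> b"] by blast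
    have "(\<lambda>z. \<Sum>\<gamma>\<in>E. v \<gamma> * (G \<gamma> z - (\<Sum>b\<in>B'. c \<gamma> b * b z))) \<in> ?I" by (rule germ_ideal_sum[OF c])
    also have "(\<lambda>z. \<Sum>\<gamma>\<in>E. v \<gamma> * (G \<gamma> z - (\<Sum>b\<in>B'. c \<gamma> b * b z))) = (\<lambda>z. \<Sum>\<gamma>\<in>E. v \<gamma> * G \<gamma> z)"
    proof
      fix z
      have "(\<Sum>\<gamma>\<in>E. v \<gamma> * (\<Sum>b\<in>B'. c \<gamma> b * b z)) = (\<Sum>b\<in>B'. (\<Sum>\<gamma>\<in>E. c \<gamma> b * v \<gamma>) * b z)"
        unfolding sum_distrib_left sum_distrib_right by (subst sum.swap) (simp add: mult_ac)
      also have "\<dots> = 0" using v(2) by simp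
      finally show "(\<Sum>\<gamma>\<in>E. v \<gamma> * (G \<gamma> z - (\<Sum>b\<in>B'. c \<gamma> b * b z))) = (\<Sum>\<gamma>\<in>E. v \<gamma> * G \<gamma> z)"
        by (simp add: right_diff_distrib sum_subtractf)
    qed
    finally have "\<forall>\<gamma>\<in>E. v \<gamma> = 0" by (rule indep)
    then show False using v(1) by blast
  qed
  show ?thesis unfolding intersection_mult_def
  proof (rule antisym)
    have "card ?B = n" using card_image[OF injG] cardE by simp
    then show "(INF B\<in>{B. quotient_basis ?I B}. enat (card B)) \<le> enat n"
      using INF_lower[of ?B "{B. quotient_basis ?I B}" "\<lambda>B. enat (card B)"] basis by simp
    show "enat n \<le> (INF B\<in>{B. quotient_basis ?I B}. enat (card B))"
      using minimal by (intro INF_greatest) simp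
  qed
qed

end

section \<open>Change of parameter on a branch\<close>

lemma lc_compose:
  assumes f: "lc f n c" and g: "lc g 1 e"
  shows "lc (\<lambda>t. f (g t)) n (c * e ^ n)"
proof -
  obtain r u where u: "r > 0" "u holomorphic_on ball 0 r" "u 0 = c" "\<And>t. norm t < r \<Longrightarrow> f t = t ^ n * u t"
    using f unfolding lc_def by blast
  obtain s v where v: "s > 0" "v holomorphic_on ball 0 s" "v 0 = e" "\<And>t. norm t < s \<Longrightarrow> g t = t ^ 1 * v t"
    using g unfolding lc_def by blast
  have gh: "(\<lambda>t. t * v t) holomorphic_on ball 0 s" using v(2) by (intro holomorphic_intros)
  obtain r' where r': "r' > 0" "r' \<le> s" "\<And>t. norm t < r' \<Longrightarrow> norm (t * v t) < r"
    using holomorphic_small[OF gh v(1) _ u(1)] by auto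
  have sub: "ball 0 r' \<subseteq> (ball 0 s :: complex set)" using r'(2) by (rule subset_ball)
  have "(u \<circ> (\<lambda>t. t * v t)) holomorphic_on ball 0 r'"
    by (rule holomorphic_on_compose_gen[OF holomorphic_on_subset[OF gh sub] u(2)]) (use r'(3) in auto)
  then have "(\<lambda>t. v t ^ n * u (t * v t)) holomorphic_on ball 0 r'"
    using holomorphic_on_subset[OF v(2) sub] by (intro holomorphic_intros) (simp_all add: o_def)
  moreover have "f (g t) = t ^ n * (v t ^ n * u (t * v t))" if "norm t < r'" for t
    using that r'(2) r'(3)[of t] v(4)[of t] u(4)[of "t * v t"] by (simp add: power_mult_distrib)
  ultimately have "lc (\<lambda>t. f (g t)) n (v 0 ^ n * u (0 * v 0))"
    using lcI[OF r'(1), of "\<lambda>t. v t ^ n * u (t * v t)" "\<lambda>t. f (g t)" n] by blast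
  then show ?thesis using u(3) v(3) by (simp add: mult.commute)
qed

text \<open>Division by \<open>u 0\<close> moves the values near 1, where the principal logarithm is
  holomorphic; \<open>b\<close> is a root of the constant divided out.\<close>

lemma holomorphic_nonzero_root:
  assumes u: "u holomorphic_on ball 0 r" "r > 0" "u 0 \<noteq> 0" and k: "k > 0"
  obtains s w where "s > 0" "s \<le> r" "w holomorphic_on ball 0 s" "w 0 \<noteq> 0"
    "\<And>t. norm t < s \<Longrightarrow> w t ^ k = u t"
proof -
  define g where "g = (\<lambda>t. u t / u 0 - 1)"
  have gh: "g holomorphic_on ball 0 r" unfolding g_def using u by (intro holomorphic_intros) auto
  have "g 0 = 0" using u(3) by (simp add: g_def)
  then obtain s where s: "s > 0" "s \<le> r" "\<And>t. norm t < s \<Longrightarrow> norm (g t) < 1"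
    using holomorphic_small[OF gh u(2), of 1] by auto
  have pos: "u t / u 0 \<notin> \<real>\<^sub>\<le>\<^sub>0" if "norm t < s" for t
  proof
    assume "u t / u 0 \<in> \<real>\<^sub>\<le>\<^sub>0"
    then have "Re (u t / u 0) \<le> 0" by (auto simp: complex_nonpos_Reals_iff)
    moreover have "\<bar>Re (g t)\<bar> < 1" using abs_Re_le_cmod[of "g t"] s(3)[OF that] by linarith
    ultimately show False by (simp add: g_def)
  qed
  obtain b where b: "b ^ k = u 0" using exists_small_root[OF k, of "u 0" "norm (u 0) + 1"]
  proof -
    have "norm (u 0) + 1 \<le> (norm (u 0) + 1) ^ k" using k by (intro self_le_power) auto
    then show ?thesis using exists_small_root[OF k, of "u 0" "norm (u 0) + 1"] that
      by (metis add_nonneg_pos less_add_one norm_ge_zero order_less_le_trans zero_less_one)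
  qed
  define w where "w = (\<lambda>t. b * exp (Ln (u t / u 0) / of_nat k))"
  have "w holomorphic_on ball 0 s"
    unfolding w_def using pos u(3) k holomorphic_on_subset[OF u(1) subset_ball[OF s(2)]]
    by (intro holomorphic_intros) auto
  moreover have "w t ^ k = u t" if "norm t < s" for t
  proof -
    have "u t / u 0 \<noteq> 0" using pos[OF that] by auto
    then have "exp (Ln (u t / u 0) / of_nat k) ^ k = u t / u 0" using k by (simp flip: exp_of_nat_mult)
    then show ?thesis using u(3) b by (simp add: w_def power_mult_distrib)
  qed
  moreover have "w 0 \<noteq> 0"
  proof
    assume "w 0 = 0"
    then have "u 0 = 0" using \<open>\<And>t. norm t < s \<Longrightarrow> w t ^ k = u t\<close>[of 0] s(1) k by (simp add: power_0_left)
    then show False using u(3) by simp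
  qed
  ultimately show thesis using that s(1,2) by blast
qed

text \<open>The parameter \<open>\<sigma>\<close> with \<open>\<sigma>\<^sup>k = X\<close> brings a branch into the form \<open>(\<sigma>\<^sup>k, y(\<sigma>))\<close>.\<close>

locale holomorphic_branch =
  fixes f :: fun2 and X Y :: "complex \<Rightarrow> complex" and s :: real
  assumes X: "X holomorphic_on ball 0 s" and Y: "Y holomorphic_on ball 0 s" and s: "s > 0"
    and X0: "X 0 = 0" and Y0: "Y 0 = 0"
    and inj: "\<And>a b. norm a < s \<Longrightarrow> norm b < s \<Longrightarrow> X a = X b \<Longrightarrow> Y a = Y b \<Longrightarrow> a = b"
    and Xnz: "\<not> (\<forall>\<^sub>F t in nhds 0. X t = 0)"
    and irr: "germ_irreducible f" and f0: "\<forall>\<^sub>F t in nhds 0. f (X t, Y t) = 0"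
begin

lemma reparametrization:
  obtains k \<theta> \<rho> a where "k > 0" "\<rho> > 0" "\<theta> holomorphic_on ball 0 \<rho>" "\<theta> 0 = 0"
    "\<And>t. norm t < \<rho> \<Longrightarrow> norm (\<theta> t) < s \<and> X (\<theta> t) = t ^ k"
    "\<And>a b. norm a < \<rho> \<Longrightarrow> norm b < \<rho> \<Longrightarrow> \<theta> a = \<theta> b \<Longrightarrow> a = b"
    "lc \<theta> 1 a" "a \<noteq> 0"
proof -
  obtain k d where k: "d \<noteq> 0" "lc X k d" using lc_exists[OF X s] Xnz by blast
  have "lc X 0 0" using lcI[OF s X, of X 0] X0 by simp
  then have "k \<noteq> 0" using k lc_unique by metis
  then have kpos: "k > 0" by simp
  obtain r u where u: "r > 0" "u holomorphic_on ball 0 r" "u 0 = d" "\<And>t. norm t < r \<Longrightarrow> X t = t ^ k * u t"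
    using k(2) unfolding lc_def by blast
  obtain r1 w where w: "r1 > 0" "r1 \<le> r" "w holomorphic_on ball 0 r1" "w 0 \<noteq> 0"
    "\<And>t. norm t < r1 \<Longrightarrow> w t ^ k = u t"
    using holomorphic_nonzero_root[OF u(2,1) _ kpos] u(3) k(1) by metis
  define r2 where "r2 = min r1 s"
  have r2: "r2 > 0" "r2 \<le> r1" "r2 \<le> s" using w s by (auto simp: r2_def)
  define \<sigma> where "\<sigma> = (\<lambda>t. t * w t)"
  have wh: "w holomorphic_on ball 0 r2" using w(3) by (rule holomorphic_on_subset) (rule subset_ball[OF r2(2)])
  then have sh: "\<sigma> holomorphic_on ball 0 r2" unfolding \<sigma>_def by (intro holomorphic_intros)
  have sk: "\<sigma> t ^ k = X t" if "norm t < r2" for t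
    using that r2(2) w(2) w(5)[of t] u(4)[of t] by (simp add: \<sigma>_def power_mult_distrib)
  have lcs: "lc \<sigma> 1 (w 0)" using lcI[OF r2(1) wh, of \<sigma> 1] by (simp add: \<sigma>_def)
  have "(w has_field_derivative deriv w 0) (at 0)"
    using holomorphic_derivI[OF wh open_ball] r2(1) by simp
  then have "(\<sigma> has_field_derivative w 0) (at 0)"
    unfolding \<sigma>_def using DERIV_mult[OF DERIV_ident, of w "deriv w 0" 0] by simp
  then have nz: "deriv \<sigma> 0 \<noteq> 0" using w(4) DERIV_imp_deriv by metis
  have zr: "0 \<in> ball (0 :: complex) r2" using r2(1) by simp
  obtain r3 where r3: "r3 > 0" "ball (0 :: complex) r3 \<subseteq> ball 0 r2" "open (\<sigma> ` ball 0 r3)" "inj_on \<sigma> (ball 0 r3)"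
    by (rule has_complex_derivative_locally_invertible[OF sh zr open_ball nz], rule that)
  obtain \<theta> where \<theta>: "\<theta> holomorphic_on \<sigma> ` ball 0 r3" "\<And>z. z \<in> ball 0 r3 \<Longrightarrow> \<theta> (\<sigma> z) = z"
    using holomorphic_has_inverse[OF holomorphic_on_subset[OF sh r3(2)] open_ball r3(4)] by metis
  have "\<sigma> 0 = 0" by (simp add: \<sigma>_def)
  then have "0 \<in> \<sigma> ` ball 0 r3" using r3(1) by (metis centre_in_ball image_eqI)
  then obtain \<rho> where \<rho>: "\<rho> > 0" "ball 0 \<rho> \<subseteq> \<sigma> ` ball 0 r3" using r3(3) open_contains_ball by blast
  have im: "\<theta> t \<in> ball 0 r3 \<and> \<sigma> (\<theta> t) = t" if "norm t < \<rho>" for t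
  proof -
    have "t \<in> \<sigma> ` ball 0 r3" using that \<rho>(2) by auto
    then show ?thesis using \<theta>(2) by auto
  qed
  have in_r2: "norm (\<theta> t) < r2" if "norm t < \<rho>" for t
    using im[OF that] r3(2) by (meson mem_ball_0 subsetD)
  have \<theta>0: "\<theta> 0 = 0" using \<theta>(2)[of 0] r3(1) \<open>\<sigma> 0 = 0\<close> by simp
  have th: "\<theta> holomorphic_on ball 0 \<rho>" using \<theta>(1) \<rho>(2) by (rule holomorphic_on_subset)
  have "lc \<theta> 0 0" using lcI[OF \<rho>(1) th, of \<theta> 0] \<theta>0 by simp
  then obtain a where a: "lc \<theta> 1 a" using lc_Suc by fastforce
  \<comment> \<open>The composite of \<open>\<sigma>\<close> and \<open>\<theta>\<close> is the
    identity and has order one, which a higher order of \<open>\<theta>\<close> would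
    prevent.\<close>
  have "a \<noteq> 0"
  proof
    assume "a = 0"
    then have "lc (\<lambda>t. \<sigma> (\<theta> t)) 1 0" using lc_compose[OF lcs a] by simp
    moreover have "\<forall>\<^sub>F t in nhds 0. \<sigma> (\<theta> t) = t" unfolding eventually_nhds_0_norm using im \<rho>(1) by blast
    ultimately have "lc (\<lambda>t. t) 1 0" by (rule lc_cong)
    moreover have "lc (\<lambda>t. t) 1 1" using lcI[of 1 "\<lambda>t. 1" "\<lambda>t. t" 1] by simp
    ultimately show False using lc_unique by fastforce
  qed
  show thesis
  proof (rule that[OF kpos \<rho>(1) th \<theta>0 _ _ a \<open>a \<noteq> 0\<close>])
    show "norm (\<theta> t) < s \<and> X (\<theta> t) = t ^ k" if "norm t < \<rho>" for t
      using in_r2[OF that] r2(3) sk[of "\<theta> t"] im[OF that] by simp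
    show "b = c" if "norm b < \<rho>" "norm c < \<rho>" "\<theta> b = \<theta> c" for b c
      using im[OF that(1)] im[OF that(2)] that(3) by metis
  qed
qed

text \<open>A change of parameter of order one preserves orders, so the result for the form
  \<open>(t^k, y t)\<close> carries over. The description of the zeros is transported along the same
  reparametrization.\<close>

theorem intersection_mult_eq_order:
  assumes h: "h \<in> holo_germs" "lc (\<lambda>t. h (X t, Y t)) n c" "c \<noteq> 0"
  shows "intersection_mult f h = enat n"
    and "\<epsilon> > 0 \<Longrightarrow> \<forall>\<^sub>F z in nhds 0. f z = 0 \<longrightarrow> (\<exists>t. norm t < \<epsilon> \<and> z = (X t, Y t))"
proof -
  obtain k \<theta> \<rho> a where k: "k > 0" and \<rho>: "\<rho> > 0" and th: "\<theta> holomorphic_on ball 0 \<rho>" "\<theta> 0 = 0"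
    and Xt: "\<And>t. norm t < \<rho> \<Longrightarrow> norm (\<theta> t) < s \<and> X (\<theta> t) = t ^ k"
    and ti: "\<And>a b. norm a < \<rho> \<Longrightarrow> norm b < \<rho> \<Longrightarrow> \<theta> a = \<theta> b \<Longrightarrow> a = b"
    and a: "lc \<theta> 1 a" "a \<noteq> 0"
    by (rule reparametrization, rule that)
  define y where "y = (\<lambda>t. Y (\<theta> t))"
  have "\<theta> ` ball 0 \<rho> \<subseteq> ball 0 s" using Xt by auto
  then have yh: "y holomorphic_on ball 0 \<rho>"
    unfolding y_def using holomorphic_on_compose_gen[OF th(1) Y] by (simp add: o_def)
  have ev\<theta>: "\<forall>\<^sub>F t in nhds 0. P (\<theta> t)" if P: "\<forall>\<^sub>F t in nhds 0. P t" for P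
  proof -
    obtain r where r: "r > 0" "\<And>t. norm t < r \<Longrightarrow> P t" using P unfolding eventually_nhds_0_norm by blast
    obtain r' where "r' > 0" "\<And>t. norm t < r' \<Longrightarrow> norm (\<theta> t) < r" using holomorphic_small[OF th(1) \<rho> th(2) r(1)] by blast
    then show ?thesis unfolding eventually_nhds_0_norm using r(2) by blast
  qed
  have ev\<rho>: "\<forall>\<^sub>F t in nhds (0 :: complex). norm t < \<rho>" unfolding eventually_nhds_0_norm using \<rho> by blast
  have y0: "y 0 = 0" using Y0 th(2) unfolding y_def by metis
  have yinj: "b = c" if b: "norm b < \<rho>" and c: "norm c < \<rho>" and e: "b ^ k = c ^ k" "y b = y c" for b c
  proof (rule ti[OF b c])
    have "X (\<theta> b) = X (\<theta> c)" using Xt[OF b] Xt[OF c] e(1) by metis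
    moreover have "Y (\<theta> b) = Y (\<theta> c)" using e(2) unfolding y_def .
    ultimately show "\<theta> b = \<theta> c" using inj Xt[OF b] Xt[OF c] by blast
  qed
  have yf: "\<forall>\<^sub>F t in nhds 0. f (t ^ k, y t) = 0"
    using ev\<theta>[OF f0] ev\<rho>
  proof eventually_elim
    case (elim t)
    then show ?case using Xt[of t] unfolding y_def by metis
  qed
  interpret puiseux_branch f k y \<rho>
    by (rule puiseux_branch.intro[OF k yh \<rho> y0 yinj irr yf])
  have "lc (\<lambda>t. h (X (\<theta> t), Y (\<theta> t))) n (c * a ^ n)" using lc_compose[OF h(2) a(1)] .
  moreover have "\<forall>\<^sub>F t in nhds 0. h (X (\<theta> t), Y (\<theta> t)) = pull h t"
    using ev\<rho>
  proof eventually_elim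
    case (elim t)
    have "h (X (\<theta> t), Y (\<theta> t)) = h (t ^ k, y t)" using Xt[OF elim] unfolding y_def by metis
    then show ?case by (simp only: pull_def)
  qed
  ultimately have "lc (pull h) n (c * a ^ n)" by (rule lc_cong)
  moreover have "c * a ^ n \<noteq> 0" using h(3) a(2) by simp
  ultimately show "intersection_mult f h = enat n" by (rule branch_intersection_mult[OF h(1)])
  assume e: "\<epsilon> > 0"
  obtain r' where r': "r' > 0" "r' \<le> \<rho>" "\<And>t. norm t < r' \<Longrightarrow> norm (\<theta> t) < \<epsilon>"
    using holomorphic_small[OF th(1) \<rho> th(2) e] by blast
  show "\<forall>\<^sub>F z in nhds 0. f z = 0 \<longrightarrow> (\<exists>t. norm t < \<epsilon> \<and> z = (X t, Y t))"
    using zeros_on_branch[OF r'(1)]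
  proof eventually_elim
    case (elim z)
    show ?case
    proof
      assume "f z = 0"
      then obtain t where t: "norm t < r'" "z = (t ^ k, y t)" using elim by blast
      then have "z = (X (\<theta> t), Y (\<theta> t))" using Xt[of t] r'(2) by (simp add: y_def)
      then show "\<exists>t. norm t < \<epsilon> \<and> z = (X t, Y t)" using r'(3)[OF t(1)] by blast
    qed
  qed
qed

end

section \<open>Numerical semigroups\<close>

text \<open>In \<open>x = i + (x - i)\<close> one summand must be a gap, so the gaps and their
  mirror images cover the \<open>x + 1\<close> numbers up to \<open>x\<close>.\<close>

lemma gap_bound:
  fixes \<Gamma> :: "nat set"
  assumes add: "\<And>a b. a \<in> \<Gamma> \<Longrightarrow> b \<in> \<Gamma> \<Longrightarrow> a + b \<in> \<Gamma>" and fin: "finite (- \<Gamma>)" and x: "x \<notin> \<Gamma>"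
  shows "x + 1 \<le> 2 * card (- \<Gamma>)"
proof -
  have "{..x} \<subseteq> - \<Gamma> \<union> (\<lambda>i. x - i) ` (- \<Gamma>)"
  proof
    fix i assume "i \<in> {..x}"
    then have i: "i \<le> x" by simp
    then have "i \<notin> \<Gamma> \<or> x - i \<notin> \<Gamma>" using add[of i "x - i"] x by auto
    moreover have "i = x - (x - i)" using i by simp
    ultimately show "i \<in> - \<Gamma> \<union> (\<lambda>i. x - i) ` (- \<Gamma>)" by blast
  qed
  then have "card {..x} \<le> card (- \<Gamma> \<union> (\<lambda>i. x - i) ` (- \<Gamma>))" using fin by (intro card_mono) auto
  also have "\<dots> \<le> card (- \<Gamma>) + card ((\<lambda>i. x - i) ` (- \<Gamma>))" by (rule card_Un_le)
  also have "card ((\<lambda>i. x - i) ` (- \<Gamma>)) \<le> card (- \<Gamma>)" using fin by (rule card_image_le)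
  finally show ?thesis by simp
qed

text \<open>The interval counts are differences of the cumulative counts \<open>c l\<close>. In the
  return direction, the counts outside the given range follow from the number of gaps: the intervals
  from \<open>l = d - 1\<close> on lie above the bound of \<open>gap_bound\<close>, and
  \<open>l = d - 2\<close> is settled because all gaps are at most \<open>l * d\<close>.\<close>

lemma semigroup_distribution_iff:
  fixes \<Gamma> :: "nat set" and S :: "nat \<Rightarrow> nat set"
  assumes d: "d \<ge> 2" and zero: "0 \<in> \<Gamma>" and add: "\<And>a b. a \<in> \<Gamma> \<Longrightarrow> b \<in> \<Gamma> \<Longrightarrow> a + b \<in> \<Gamma>"
    and S: "\<And>l. l < d \<Longrightarrow> S l \<subseteq> \<Gamma> \<inter> {0..l * d}"
    and cS: "\<And>l. l < d \<Longrightarrow> 2 * card (S l) = (l + 1) * (l + 2)"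
    and stable: "\<And>l. l \<ge> l0 \<Longrightarrow> 2 * card (\<Gamma> \<inter> {0..l * d}) + (d - 1) * (d - 2) = 2 * (l * d + 1)"
  shows "(\<forall>l::nat. l > 0 \<longrightarrow> card (\<Gamma> \<inter> {(l - 1) * d<..l * d}) = min (l + 1) d) \<longleftrightarrow>
         (\<forall>l::nat. l + 3 \<le> d \<longrightarrow> \<Gamma> \<inter> {0..l * d} \<subseteq> S l)"
proof -
  define c where "c = (\<lambda>l. card (\<Gamma> \<inter> {0..l * d}))"
  have step: "c (Suc l) = c l + card (\<Gamma> \<inter> {l * d<..Suc l * d})" for l
  proof -
    have "\<Gamma> \<inter> {0..Suc l * d} = (\<Gamma> \<inter> {0..l * d}) \<union> (\<Gamma> \<inter> {l * d<..Suc l * d})" by auto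
    then show ?thesis unfolding c_def by (simp only:) (subst card_Un_disjoint, auto)
  qed
  have "\<Gamma> \<inter> {0..0 * d} = {0}" using zero by auto
  then have c0: "c 0 = 1" unfolding c_def by simp
  show ?thesis
  proof
    assume 1: "\<forall>l::nat. l > 0 \<longrightarrow> card (\<Gamma> \<inter> {(l - 1) * d<..l * d}) = min (l + 1) d"
    have "2 * c l = (l + 1) * (l + 2)" if "l < d" for l
      using that
    proof (induction l)
      case (Suc l)
      then have "card (\<Gamma> \<inter> {l * d<..Suc l * d}) = l + 2" using 1[rule_format, of "Suc l"] by simp
      then show ?case using step[of l] Suc by simp
    qed (simp add: c0)
    then have "card (S l) = c l" if "l < d" for l using cS[OF that] that by (metis mult_left_cancel zero_neq_numeral)
    then have "S l = \<Gamma> \<inter> {0..l * d}" if "l < d" for l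
      using S[OF that] that unfolding c_def by (intro card_subset_eq) auto
    then show "\<forall>l::nat. l + 3 \<le> d \<longrightarrow> \<Gamma> \<inter> {0..l * d} \<subseteq> S l" by simp
  next
    assume 2: "\<forall>l::nat. l + 3 \<le> d \<longrightarrow> \<Gamma> \<inter> {0..l * d} \<subseteq> S l"
    have small: "2 * c l = (l + 1) * (l + 2)" if "l + 3 \<le> d" for l
    proof -
      have "S l = \<Gamma> \<inter> {0..l * d}" using 2 S[of l] that by (intro equalityI) auto
      then show ?thesis using cS[of l] that by (simp add: c_def)
    qed
    have gaps: "2 * card (- \<Gamma> \<inter> {0..l * d}) = (d - 1) * (d - 2)" if "l \<ge> l0" for l
    proof -
      have "{0..l * d} = (\<Gamma> \<inter> {0..l * d}) \<union> (- \<Gamma> \<inter> {0..l * d})" by auto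
      then have "card {0..l * d} = card ((\<Gamma> \<inter> {0..l * d}) \<union> (- \<Gamma> \<inter> {0..l * d}))"
        by (rule arg_cong)
      also have "\<dots> = card (\<Gamma> \<inter> {0..l * d}) + card (- \<Gamma> \<inter> {0..l * d})"
        by (rule card_Un_disjoint) auto
      finally have "card {0..l * d} = card (\<Gamma> \<inter> {0..l * d}) + card (- \<Gamma> \<inter> {0..l * d})" .
      then show ?thesis using stable[OF that] by simp
    qed
    \<comment> \<open>A gap beyond \<open>l0 * d\<close> would raise the number of gaps, which is
      constant for \<open>l >= l0\<close>.\<close>
    have bound: "- \<Gamma> \<subseteq> {0..l0 * d}"
    proof
      fix x assume x: "x \<in> - \<Gamma>"
      show "x \<in> {0..l0 * d}"
      proof (rule ccontr)
        assume nx: "x \<notin> {0..l0 * d}"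
        have "l0 \<le> l0 * d" using d by simp
        moreover have "l0 * d < x" using nx by simp
        ultimately have xl: "x \<ge> l0" by (rule order.trans[OF _ less_imp_le])
        have "x \<in> {0..x * d}" using d by simp
        moreover have "{0..l0 * d} \<subseteq> {0..x * d}" using xl by simp
        ultimately have "insert x (- \<Gamma> \<inter> {0..l0 * d}) \<subseteq> - \<Gamma> \<inter> {0..x * d}"
          using x by blast
        then have "card (insert x (- \<Gamma> \<inter> {0..l0 * d})) \<le> card (- \<Gamma> \<inter> {0..x * d})" by (intro card_mono) auto
        then show False using nx gaps[OF order_refl] gaps[OF xl] by simp
      qed
    qed
    then have finG: "finite (- \<Gamma>)" by (rule finite_subset) simp
    have "- \<Gamma> \<inter> {0..l0 * d} = - \<Gamma>" using bound by blast
    then have cG: "2 * card (- \<Gamma>) = (d - 1) * (d - 2)" using gaps[OF order_refl] by simp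
    have cond: "x \<in> \<Gamma>" if "x \<ge> (d - 1) * (d - 2)" for x
      using gap_bound[OF add finG, of x] cG that by linarith
    obtain e where e: "d = e + 2" using d by (metis add.commute le_Suc_ex)
    have full: "card (\<Gamma> \<inter> {(l - 1) * d<..l * d}) = d" if l: "l \<ge> e + 1" for l
    proof -
      obtain x where x: "l = Suc (e + x)" using l by (metis Suc_eq_plus1 add_Suc le_Suc_ex)
      \<comment> \<open>At \<open>l = d - 1\<close> the right-hand side is \<open>(d - 1)^2\<close>,
        so already the first of these intervals lies beyond the last gap.\<close>
      have "(d - 1) * (d - 2) \<le> (l - 1) * d + 1" unfolding e x by (simp add: algebra_simps)
      then have "\<Gamma> \<inter> {(l - 1) * d<..l * d} = {(l - 1) * d<..l * d}" using cond by auto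
      then show ?thesis by (simp add: x)
    qed
    show "\<forall>l::nat. l > 0 \<longrightarrow> card (\<Gamma> \<inter> {(l - 1) * d<..l * d}) = min (l + 1) d"
    proof (intro allI impI)
      fix l :: nat assume l: "l > 0"
      then obtain j where j: "l = Suc j" by (cases l) auto
      consider "l \<ge> e + 1" | "l = e" | "l < e" by linarith
      then show "card (\<Gamma> \<inter> {(l - 1) * d<..l * d}) = min (l + 1) d"
      proof cases
        case 1
        then show ?thesis using full e by simp
      next
        case 2
        have "2 * c j = (j + 1) * (j + 2)" using small[of j] j 2 e by simp
        moreover have "2 * c l = (l + 1) * (l + 2)"
        proof -
          have sub: "- \<Gamma> \<subseteq> {0..l * d}"
          proof
            fix x assume "x \<in> - \<Gamma>"
            then have "x + 1 \<le> (d - 1) * (d - 2)" using gap_bound[OF add finG, of x] cG by simp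
            then show "x \<in> {0..l * d}" using 2 e by (simp add: algebra_simps)
          qed
          have D: "\<Gamma> \<inter> {0..l * d} = {0..l * d} - (- \<Gamma>)" by auto
          have "c l = card {0..l * d} - card (- \<Gamma>)"
            unfolding c_def D by (rule card_Diff_subset[OF finG sub])
          then have "2 * c l = 2 * (l * d + 1) - (d - 1) * (d - 2)" using cG by (simp add: diff_mult_distrib2)
          also have "\<dots> = (l + 1) * (l + 2)" using 2 e by (simp add: algebra_simps)
          finally show ?thesis .
        qed
        ultimately show ?thesis using step[of j] j 2 e by simp
      next
        case 3
        have "2 * c j = (j + 1) * (j + 2)" "2 * c l = (l + 1) * (l + 2)"
          using small[of j] small[of l] j 3 e by simp_all
        then show ?thesis using step[of j] j 3 e by simp
      qed
    qed
  qed
qed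

section \<open>The cusp at infinity\<close>

text \<open>A form of degree 0 with a zero is the zero polynomial, and the gradient of a linear form
  is its coefficient vector.\<close>

lemma homogeneous_singular_degree_ge_2:
  assumes "homogeneous d F" "F \<noteq> 0" "singular_point F p"
  shows "d \<ge> 2"
proof (rule ccontr)
  assume "\<not> d \<ge> 2"
  then consider "d = 0" | "d = 1" by linarith
  then show False
  proof cases
    case 1
    have "F = scal (coeff3 F 0 0 0)"
      using assms(1) 1 by (intro poly3_eqI) (auto simp: coeff3_scal homogeneous_def)
    then have "eval3 F p = coeff3 F 0 0 0" by (metis eval3_scal)
    then have "F = 0" using assms(3) \<open>F = scal _\<close> by (simp add: singular_point_def)
    then show False using assms(2) by simp
  next
    case 2
    define w :: "complex^3" where "w = vector [coeff3 F 1 0 0, coeff3 F 0 1 0, coeff3 F 0 0 1]"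
    have F: "F = lin w"
    proof (rule poly3_eqI)
      fix i j k
      show "coeff3 F i j k = coeff3 (lin w) i j k"
      proof (cases "i + j + k = 1")
        case True
        then have "(i = 1 \<and> j = 0 \<and> k = 0) \<or> (i = 0 \<and> j = 1 \<and> k = 0) \<or> (i = 0 \<and> j = 0 \<and> k = 1)" by linarith
        then show ?thesis by (auto simp: lin_def coeff3_mon w_def)
      next
        case False
        then have "coeff3 F i j k = 0" using assms(1) 2 by (auto simp: homogeneous_def)
        moreover have "coeff3 (lin w) i j k = 0" using False by (auto simp: lin_def coeff3_mon)
        ultimately show ?thesis by simp
      qed
    qed
    have "partial_X (lin w) = scal (w $ 1)" "partial_Y (lin w) = scal (w $ 2)" "partial_Z (lin w) = scal (w $ 3)"
      unfolding lin_def scal_def mon_def partial_X_def partial_Y_def partial_Z_def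
      by (simp_all add: monom_0 monom_Suc map_poly_pCons pderiv_pCons)
    then have "w $ 1 = 0" "w $ 2 = 0" "w $ 3 = 0" using assms(3) unfolding F singular_point_def by simp_all
    then have "w = 0" by (simp add: vec3_eq_iff)
    then show False using F assms(2) lin_eq_0_iff by simp
  qed
qed

lemma poly_nonzero_near:
  assumes "(g :: complex poly) \<noteq> 0"
  obtains r where "r > 0" "\<And>t. t \<noteq> 0 \<Longrightarrow> norm t < r \<Longrightarrow> poly g t \<noteq> 0"
proof -
  have "finite {t. poly g t = 0}" using assms by (rule poly_roots_finite)
  then obtain r where r: "r > 0" "\<forall>x\<in>{t. poly g t = 0}. x \<noteq> 0 \<longrightarrow> r \<le> dist 0 x"
    using finite_set_avoid by metis
  then show thesis by (intro that[of r]) (auto simp: not_le[symmetric])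
qed

text \<open>The polynomial \<open>t^N * g (1 / t)\<close>, that is, \<open>g\<close> as a section of
  degree \<open>N\<close> in the coordinate at infinity; the monomial pads when \<open>g\<close> has
  smaller degree.\<close>

definition rv :: "nat \<Rightarrow> complex poly \<Rightarrow> complex poly" where
  "rv N g = monom 1 (N - degree g) * reflect_poly g"

lemma poly_rv:
  assumes "degree g \<le> N" "t \<noteq> 0"
  shows "poly (rv N g) t = t ^ N * poly g (1 / t)"
proof -
  have "poly (rv N g) t = (t ^ (N - degree g) * t ^ degree g) * poly g (inverse t)"
    using assms(2) by (simp add: rv_def poly_monom poly_reflect_poly_nz)
  also have "t ^ (N - degree g) * t ^ degree g = t ^ N" using assms(1) by (simp flip: power_add)
  finally show ?thesis by (simp add: inverse_eq_divide)
qed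

lemma poly_rv_0: "degree g \<le> N \<Longrightarrow> poly (rv N g) 0 = coeff g N"
  by (cases "degree g = N") (auto simp: rv_def poly_monom coeff_eq_0)

lemma rv_eq_0_iff: "rv N g = 0 \<longleftrightarrow> g = 0"
  by (simp add: rv_def monom_eq_0_iff)

text \<open>The difference \<open>h (x, y) - h (x, 0)\<close> is divisible by \<open>y\<close>, and
  \<open>h (x, 0) - h (0, 0)\<close> by \<open>x\<close>. Iteration of this step replaces a Taylor
  expansion in two variables.\<close>

lemma germ_decomposition:
  assumes h: "h \<in> holo_germs"
  obtains c A B where "A \<in> holo_germs" "B \<in> holo_germs"
    "\<forall>\<^sub>F z in nhds 0. h z = c + fst z * A z + snd z * B z"
proof -
  obtain r where r: "hol2 r h" using holo_germs_imp_hol2[OF h] by blast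
  then have r0: "r > 0" by (simp add: hol2_def)
  have h0: "(\<lambda>x. h (x, 0)) holomorphic_on ball 0 r"
    using hol2_curve[OF r open_ball, where u="\<lambda>x. x" and v="\<lambda>x. 0", of 0 r] r0 by (simp add: image_subset_iff)
  have g1: "(\<lambda>z. h z - h (fst z, 0)) \<in> holo_germs"
    using hol2_diff[OF r hol2_fst[OF h0 r0]] by (rule hol2_imp_holo_germs)
  have zh: "(\<lambda>t. 0 :: complex) holomorphic_on ball 0 1" by simp
  obtain B r1 where B: "B \<in> holo_germs" "r1 > 0"
    "\<And>x Y. norm x < r1 \<Longrightarrow> norm Y < r1 \<Longrightarrow> h (x, Y) - h (x, 0) = Y * B (x, Y)"
    using germ_factor[OF g1 zh zero_less_one refl] by auto
  have h1: "(\<lambda>x. h (x, 0) - h (0, 0)) holomorphic_on ball 0 r"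
    by (rule holomorphic_on_diff[OF h0 holomorphic_on_const])
  have "lc (\<lambda>x. h (x, 0) - h (0, 0)) 0 0"
    using lcI[OF r0 h1, of "\<lambda>x. h (x, 0) - h (0, 0)" 0] by simp
  then obtain d where "lc (\<lambda>x. h (x, 0) - h (0, 0)) (Suc 0) d" using lc_Suc by blast
  then obtain r2 a where a: "r2 > 0" "a holomorphic_on ball 0 r2"
    "\<And>x. norm x < r2 \<Longrightarrow> h (x, 0) - h (0, 0) = x ^ Suc 0 * a x" unfolding lc_def by blast
  have A: "(\<lambda>z. a (fst z)) \<in> holo_germs" using hol2_fst[OF a(2,1)] by (rule hol2_imp_holo_germs)
  have "\<forall>\<^sub>F z in nhds 0. h z = h (0, 0) + fst z * a (fst z) + snd z * B z"
    unfolding eventually_nhds_pair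
  proof (intro exI conjI allI impI)
    show "min r1 r2 > 0" using B(2) a(1) by simp
    fix x y :: complex assume xy: "norm x < min r1 r2" "norm y < min r1 r2"
    have "h (x, y) - h (x, 0) = y * B (x, y)" "h (x, 0) - h (0, 0) = x * a x"
      using B(3)[of x y] a(3)[of x] xy by simp_all
    then show "h (x, y) = h (0, 0) + fst (x, y) * a (fst (x, y)) + snd (x, y) * B (x, y)"
      by (simp add: algebra_simps)
  qed
  then show thesis using that[OF A B(1)] by blast
qed

lemma holo_germs_power: "g \<in> holo_germs \<Longrightarrow> (\<lambda>z. g z ^ n) \<in> holo_germs"
  by (induction n) (auto intro: holo_germs_mult)

lemma holo_germs_fst: "(\<lambda>z. fst z) \<in> holo_germs" and holo_germs_snd: "(\<lambda>z. snd z) \<in> holo_germs"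
  using hol2_fst[of "\<lambda>x. x" 1] hol2_snd[of "\<lambda>x. x" 1] hol2_imp_holo_germs by auto

text \<open>The vector \<open>q\<close> represents the cusp as normalized by the chart, and
  \<open>top\<close> says that the parameter \<open>\<infinity>\<close> is sent to it.\<close>

locale unicuspidal_parametrization = reduced_parametrization +
  fixes p q e1 e2 w0 w1 w2 :: "complex^3" and \<mu> \<nu> :: complex
  assumes fr: "frame q e1 e2 w0 w1 w2" and top: "top_coeffs Q e = \<mu> *s q" and pq: "p = \<nu> *s q"
    and chart: "\<And>x y. affine_chart p (x, y) = q + x *s e1 + y *s e2"
    and d2: "d \<ge> 2" and Fq: "eval3 F q = 0" and irr: "germ_irreducible (local_equation F p)"
    and uniq: "\<And>z. singular_point F z \<Longrightarrow> \<exists>\<mu>. z = \<mu> *s p"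
begin

abbreviation "a0 \<equiv> subst3 Q (lin w0)"
abbreviation "a1 \<equiv> subst3 Q (lin w1)"
abbreviation "a2 \<equiv> subst3 Q (lin w2)"

text \<open>Chart coordinates of the branch in the parameter \<open>t\<close> centred at infinity:
  for small \<open>t \<noteq> 0\<close> they describe the point with original parameter
  \<open>1 / t\<close>.\<close>

definition X :: "complex \<Rightarrow> complex" where "X t = poly (rv e a1) t / poly (rv e a0) t"
definition Y :: "complex \<Rightarrow> complex" where "Y t = poly (rv e a2) t / poly (rv e a0) t"

lemma dual: "dot3 w0 q = 1" "dot3 w0 e1 = 0" "dot3 w0 e2 = 0" "dot3 w1 q = 0" "dot3 w1 e1 = 1"
    "dot3 w1 e2 = 0" "dot3 w2 q = 0" "dot3 w2 e1 = 0" "dot3 w2 e2 = 1"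
  using fr unfolding frame_def by blast+

lemma frame_expand: "x = dot3 w0 x *s q + dot3 w1 x *s e1 + dot3 w2 x *s e2"
  using fr unfolding frame_def by blast

lemma dot3_add: "dot3 w (x + y) = dot3 w x + dot3 w y" and dot3_scale: "dot3 w (c *s x) = c * dot3 w x"
  by (simp_all add: dot3_def algebra_simps)

lemma dot3_top: "dot3 w (top_coeffs Q e) = \<mu> * dot3 w q"
  unfolding top dot3_scale ..

lemma mu_nz: "\<mu> \<noteq> 0"
  using top_nz unfolding top by auto

lemma rv_at_0: "poly (rv e a0) 0 = \<mu>" "poly (rv e a1) 0 = 0" "poly (rv e a2) 0 = 0"
proof -
  have "poly (rv e (subst3 Q (lin w))) 0 = \<mu> * dot3 w q" for w
    using poly_rv_0[OF degree_subst3_lin_le] unfolding coeff_subst3_lin dot3_top .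
  then show "poly (rv e a0) 0 = \<mu>" "poly (rv e a1) 0 = 0" "poly (rv e a2) 0 = 0" by (simp_all only: dual mult_1_right mult_zero_right)
qed

lemma a1_nz: "a1 \<noteq> 0"
proof
  assume "a1 = 0"
  then have "F dvd lin w1" by (rule kernel[OF homogeneous_lin])
  moreover have "w1 \<noteq> 0" using dual(5) by (auto simp: dot3_def)
  ultimately have "d \<le> 1" using homogeneous_dvd_degree_le[OF homF homogeneous_lin] lin_eq_0_iff by blast
  then show False using d2 by simp
qed

lemma uv_eval: "eval3 u (pev Q t) = t * eval3 v (pev Q t)"
  using arg_cong[OF uvQ, of "\<lambda>p. poly p t"] by simp

lemma F_pev: "eval3 F (pev Q t) = 0"
  using arg_cong[OF FQ, of "\<lambda>p. poly p t"] by simp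

lemma pev_chart:
  assumes "poly a0 t \<noteq> 0"
  shows "pev Q t = poly a0 t *s affine_chart p (poly a1 t / poly a0 t, poly a2 t / poly a0 t)"
proof -
  have "pev Q t = poly a0 t *s q + poly a1 t *s e1 + poly a2 t *s e2"
    using frame_expand[of "pev Q t"] unfolding poly_subst3_lin .
  then show ?thesis unfolding chart using assms by (simp add: vec_eq_iff algebra_simps del: poly_subst3)
qed

lemma eval3_chart:
  assumes "homogeneous l h" "poly a0 t \<noteq> 0"
  shows "eval3 h (pev Q t) = poly a0 t ^ l * local_equation h p (poly a1 t / poly a0 t, poly a2 t / poly a0 t)"
  unfolding pev_chart[OF assms(2)] local_equation_def by (rule eval3_homogeneous_scale[OF assms(1)])

text \<open>A point of the chart determines its parameter through \<open>u / v\<close> wherever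
  \<open>v\<close> does not vanish. Injectivity of the branch and uniqueness of the parameter at the
  cusp both come from this.\<close>

lemma parameter_from_point:
  assumes "poly a0 t \<noteq> 0" "(poly a1 t / poly a0 t, poly a2 t / poly a0 t) = z"
  shows "local_equation u p z = t * local_equation v p z"
    and "eval3 v (pev Q t) \<noteq> 0 \<Longrightarrow> local_equation v p z \<noteq> 0"
  using uv_eval[of t] eval3_chart[OF homu assms(1)] eval3_chart[OF homv assms(1)] assms by auto

lemma radius_exists:
  "\<exists>s>0. \<forall>t. norm t < s \<longrightarrow> poly (rv e a0) t \<noteq> 0 \<and>
     (t \<noteq> 0 \<longrightarrow> poly (rv e a1) t \<noteq> 0 \<and> eval3 v (pev Q (1 / t)) \<noteq> 0)"
proof -
  have "rv e a0 \<noteq> 0" using rv_at_0(1) mu_nz by auto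
  then obtain r0 where r0: "r0 > 0" "\<And>t. t \<noteq> 0 \<Longrightarrow> norm t < r0 \<Longrightarrow> poly (rv e a0) t \<noteq> 0"
    using poly_nonzero_near by blast
  obtain r1 where r1: "r1 > 0" "\<And>t. t \<noteq> 0 \<Longrightarrow> norm t < r1 \<Longrightarrow> poly (rv e a1) t \<noteq> 0"
    using poly_nonzero_near[of "rv e a1"] a1_nz rv_eq_0_iff by metis
  obtain r2 where r2: "r2 > 0" "\<And>t. t \<noteq> 0 \<Longrightarrow> norm t < r2 \<Longrightarrow> poly (rv (m * e) (subst3 Q v)) t \<noteq> 0"
    using poly_nonzero_near[of "rv (m * e) (subst3 Q v)"] vQ rv_eq_0_iff by metis
  have "eval3 v (pev Q (1 / t)) \<noteq> 0" if "t \<noteq> 0" "norm t < r2" for t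
    using r2(2)[OF that] poly_rv[OF W_degree[OF subst3_in_W[OF homv]] that(1)] by simp
  moreover have "poly (rv e a0) t \<noteq> 0" if "norm t < r0" for t
    using r0(2)[OF _ that] rv_at_0(1) mu_nz by (cases "t = 0") auto
  ultimately show ?thesis using r0(1) r1 r2(1) by (intro exI[of _ "min r0 (min r1 r2)"]) auto
qed

text \<open>A fixed choice, so that the radius can be an argument of the sublocale declaration
  below.\<close>

definition s :: real where
  "s = (SOME s. s > 0 \<and> (\<forall>t. norm t < s \<longrightarrow> poly (rv e a0) t \<noteq> 0 \<and>
     (t \<noteq> 0 \<longrightarrow> poly (rv e a1) t \<noteq> 0 \<and> eval3 v (pev Q (1 / t)) \<noteq> 0)))"

lemma s: "s > 0" "\<And>t. norm t < s \<Longrightarrow> poly (rv e a0) t \<noteq> 0"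
    "\<And>t. norm t < s \<Longrightarrow> t \<noteq> 0 \<Longrightarrow> poly (rv e a1) t \<noteq> 0"
    "\<And>t. norm t < s \<Longrightarrow> t \<noteq> 0 \<Longrightarrow> eval3 v (pev Q (1 / t)) \<noteq> 0"
  using someI_ex[OF radius_exists] unfolding s_def by blast+

lemma near_infinity:
  assumes "norm t < s" "t \<noteq> 0"
  shows "poly a0 (1 / t) \<noteq> 0" "(poly a1 (1 / t) / poly a0 (1 / t), poly a2 (1 / t) / poly a0 (1 / t)) = (X t, Y t)"
proof -
  have r: "poly (rv e (subst3 Q (lin w))) t = t ^ e * poly (subst3 Q (lin w)) (1 / t)" for w
    by (rule poly_rv[OF degree_subst3_lin_le assms(2)])
  show "poly a0 (1 / t) \<noteq> 0" using s(2)[OF assms(1)] unfolding r by auto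
  show "(poly a1 (1 / t) / poly a0 (1 / t), poly a2 (1 / t) / poly a0 (1 / t)) = (X t, Y t)"
    unfolding X_def Y_def r using assms(2) by simp
qed

lemma X_hol: "X holomorphic_on ball 0 s" and Y_hol: "Y holomorphic_on ball 0 s"
  unfolding X_def[abs_def] Y_def[abs_def]
  using s(2) by (auto intro!: holomorphic_intros)

lemma X0: "X 0 = 0" and Y0: "Y 0 = 0"
  by (simp_all add: X_def Y_def rv_at_0)

lemma X_nz: "norm t < s \<Longrightarrow> t \<noteq> 0 \<Longrightarrow> X t \<noteq> 0"
  unfolding X_def using s(2,3) by simp

lemma XY_inj:
  assumes "norm a < s" "norm b < s" "X a = X b" "Y a = Y b"
  shows "a = b"
proof (cases "a = 0 \<or> b = 0")
  case True
  then show ?thesis using X_nz[OF assms(1)] X_nz[OF assms(2)] assms(3) X0 by metis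
next
  case False
  then have a: "a \<noteq> 0" and b: "b \<noteq> 0" by auto
  let ?z = "(X b, Y b)"
  have na: "(poly a1 (1 / a) / poly a0 (1 / a), poly a2 (1 / a) / poly a0 (1 / a)) = ?z"
    using near_infinity(2)[OF assms(1) a] assms(3,4) by simp
  note A = parameter_from_point[OF near_infinity(1)[OF assms(1) a] na]
  note B = parameter_from_point[OF near_infinity(1)[OF assms(2) b] near_infinity(2)[OF assms(2) b]]
  have "1 / a * local_equation v p ?z = 1 / b * local_equation v p ?z" using A(1) B(1) by (rule trans[OF sym])
  then have "1 / a = 1 / b" using A(2)[OF s(4)[OF assms(1) a]] by (metis mult_right_cancel)
  then show ?thesis using a b by simp
qed

lemma local_equation_add: "local_equation (f + g) p z = local_equation f p z + local_equation g p z"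
  and local_equation_mult: "local_equation (f * g) p z = local_equation f p z * local_equation g p z"
  and local_equation_scal: "local_equation (scal c) p z = c"
  by (simp_all add: local_equation_def)

lemma local_equation_power: "local_equation (f ^ n) p z = local_equation f p z ^ n"
  by (simp add: local_equation_def)

lemma local_equation_lin: "local_equation (lin w) p z = dot3 w q + fst z * dot3 w e1 + snd z * dot3 w e2"
  using chart[of "fst z" "snd z"] unfolding local_equation_def eval3_lin_dot3
  by (simp add: dot3_add dot3_scale)

lemma local_equation_holo:
  assumes "homogeneous l h"
  shows "local_equation h p \<in> holo_germs"
proof -
  have comp: "(\<lambda>z. affine_chart p z $ i) \<in> holo_germs" for i
  proof -
    have "(\<lambda>z. q $ i + (fst z * e1 $ i + snd z * e2 $ i)) \<in> holo_germs"
      by (intro holo_germs_add holo_germs_mult holo_germs_const holo_germs_fst holo_germs_snd)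
    moreover have "(\<lambda>z. q $ i + (fst z * e1 $ i + snd z * e2 $ i)) = (\<lambda>z. affine_chart p z $ i)"
      using chart by (auto simp: fun_eq_iff)
    ultimately show ?thesis by simp
  qed
  have "local_equation (Mcomb A c) p \<in> holo_germs" for A c
  proof -
    have "(\<lambda>z. \<Sum>b\<in>A. c b * (affine_chart p z $ 1 ^ fst b * affine_chart p z $ 2 ^ fst (snd b) * affine_chart p z $ 3 ^ snd (snd b)))
        \<in> holo_germs"
      by (intro holo_germs_sum holo_germs_cmult holo_germs_mult holo_germs_power comp)
    moreover have "local_equation (Mcomb A c) p = (\<lambda>z. \<Sum>b\<in>A. c b * (affine_chart p z $ 1 ^ fst b * affine_chart p z $ 2 ^ fst (snd b) * affine_chart p z $ 3 ^ snd (snd b)))"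
      by (simp add: fun_eq_iff local_equation_def Mcomb_def eval3_sum case_prod_unfold)
    ultimately show ?thesis by simp
  qed
  then show ?thesis using homogeneous_expand[OF assms] by metis
qed

text \<open>In the coordinate at infinity the restriction becomes its reversal times
  \<open>t^(l * e - degree)\<close>, divided by the \<open>l\<close>-th power of
  \<open>rv e a0\<close>; both the reversal and \<open>rv e a0\<close> are nonzero at
  \<open>0\<close>.\<close>

lemma local_equation_lc:
  assumes h: "homogeneous l h" and nz: "subst3 Q h \<noteq> 0"
  shows "\<exists>c. c \<noteq> 0 \<and> lc (\<lambda>t. local_equation h p (X t, Y t)) (l * e - degree (subst3 Q h)) c"
proof -
  define g where "g = subst3 Q h"
  have dg: "degree g \<le> l * e" unfolding g_def by (rule W_degree[OF subst3_in_W[OF h]])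
  define n where "n = l * e - degree g"
  define f where "f = (\<lambda>t. poly (reflect_poly g) t / poly (rv e a0) t ^ l)"
  have fh: "f holomorphic_on ball 0 s"
    unfolding f_def using s(2) by (intro holomorphic_intros) auto
  obtain r where r: "r > 0" "r \<le> s" "(\<lambda>t. local_equation h p (X t, Y t)) holomorphic_on ball 0 r"
    using curve_holomorphic[OF local_equation_holo[OF h] X_hol Y_hol s(1) X0 Y0] by blast
  have off: "local_equation h p (X t, Y t) = t ^ n * f t" if t: "norm t < r" "t \<noteq> 0" for t
  proof -
    have ts: "norm t < s" using t(1) r(2) by simp
    have "poly (rv e a0) t ^ l * local_equation h p (X t, Y t) =
        (t ^ e * poly a0 (1 / t)) ^ l * local_equation h p (X t, Y t)"
      by (simp only: poly_rv[OF degree_subst3_lin_le t(2)])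
    also have "\<dots> = t ^ (l * e) * (poly a0 (1 / t) ^ l * local_equation h p (X t, Y t))"
      by (simp add: power_mult_distrib power_mult mult.commute[of l e] del: poly_subst3)
    also have "poly a0 (1 / t) ^ l * local_equation h p (X t, Y t) = poly g (1 / t)"
      using eval3_chart[OF h near_infinity(1)[OF ts t(2)]] unfolding near_infinity(2)[OF ts t(2)] g_def by simp
    also have "t ^ (l * e) * poly g (1 / t) = poly (rv (l * e) g) t" by (rule poly_rv[OF dg t(2), symmetric])
    also have "\<dots> = t ^ n * poly (reflect_poly g) t" by (simp add: rv_def poly_monom n_def)
    finally show ?thesis using s(2)[OF ts] by (simp add: f_def eq_divide_eq mult.commute)
  qed
  have fr: "(\<lambda>t. t ^ n * f t) holomorphic_on ball 0 r"
    using holomorphic_on_subset[OF fh subset_ball[OF r(2)]] by (intro holomorphic_intros)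
  have at0: "local_equation h p (X 0, Y 0) = 0 ^ n * f 0"
    by (rule equal_off_0_imp_equal[OF r(3) fr r(1) off])
  have "lc (\<lambda>t. local_equation h p (X t, Y t)) n (f 0)"
  proof (rule lcI[OF r(1)])
    show "f holomorphic_on ball 0 r" using fh by (rule holomorphic_on_subset) (rule subset_ball[OF r(2)])
    show "local_equation h p (X t, Y t) = t ^ n * f t" if "norm t < r" for t
      using off[OF that] at0 by (cases "t = 0") auto
  qed
  moreover have "f 0 \<noteq> 0" using nz mu_nz by (simp add: f_def rv_at_0 g_def)
  ultimately show ?thesis unfolding n_def g_def by blast
qed

lemma F_on_branch: "\<forall>\<^sub>F t in nhds 0. local_equation F p (X t, Y t) = 0"
proof -
  have "local_equation F p (X t, Y t) = 0" if t: "norm t < s" for t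
  proof (cases "t = 0")
    case True
    then show ?thesis using chart[of 0 0] Fq by (simp add: local_equation_def X0 Y0)
  next
    case False
    then show ?thesis
      using eval3_chart[OF homF near_infinity(1)[OF t False]] F_pev[of "1 / t"] near_infinity(1)[OF t False]
      unfolding near_infinity(2)[OF t False] by (simp del: poly_subst3)
  qed
  then show ?thesis unfolding eventually_nhds_0_norm using s(1) by blast
qed

sublocale branch: holomorphic_branch "local_equation F p" X Y s
proof
  show "X holomorphic_on ball 0 s" "Y holomorphic_on ball 0 s" "s > 0" "X 0 = 0" "Y 0 = 0"
    by (fact X_hol Y_hol s(1) X0 Y0)+
  show "germ_irreducible (local_equation F p)" by (fact irr)
  show "\<forall>\<^sub>F t in nhds 0. local_equation F p (X t, Y t) = 0" by (fact F_on_branch)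
  show "a = b" if "norm a < s" "norm b < s" "X a = X b" "Y a = Y b" for a b by (rule XY_inj[OF that])
  show "\<not> (\<forall>\<^sub>F t in nhds 0. X t = 0)"
  proof
    assume "\<forall>\<^sub>F t in nhds 0. X t = 0"
    then obtain r where r: "r > 0" "\<And>t. norm t < r \<Longrightarrow> X t = 0" unfolding eventually_nhds_0_norm by blast
    define t :: complex where "t = of_real (min r s / 2)"
    have "norm t < r" "norm t < s" "t \<noteq> 0" using r(1) s(1) by (auto simp: t_def)
    then show False using r(2) X_nz by blast
  qed
qed

lemma zeros_on_branch: "\<epsilon> > 0 \<Longrightarrow>
    \<forall>\<^sub>F z in nhds 0. local_equation F p z = 0 \<longrightarrow> (\<exists>t. norm t < \<epsilon> \<and> z = (X t, Y t))"
  by (rule branch.intersection_mult_eq_order(2)[OF holo_germs_const lc_const one_neq_zero])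

text \<open>A finite parameter at the cusp would give a second arc through \<open>p\<close>. By
  \<open>zeros_on_branch\<close> its points have the form \<open>(X \<tau>, Y \<tau>)\<close> with
  small \<open>\<tau>\<close>, and \<open>u / v\<close> evaluated there yields both
  \<open>\<alpha> + t\<close> and \<open>1 / \<tau>\<close>, although \<open>1 / \<tau>\<close> is
  large.\<close>

lemma pev_not_singular: "\<not> singular_point F (pev Q \<alpha>)"
proof
  assume "singular_point F (pev Q \<alpha>)"
  then obtain \<kappa> where "pev Q \<alpha> = \<kappa> *s p" using uniq by blast
  then have k: "pev Q \<alpha> = (\<kappa> * \<nu>) *s q" unfolding pq by (simp add: vector_smult_assoc)
  then have kn: "\<kappa> * \<nu> \<noteq> 0" using pev_nz[of \<alpha>] by auto
  have at: "poly a0 \<alpha> = \<kappa> * \<nu>" "poly a1 \<alpha> = 0" "poly a2 \<alpha> = 0"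
    unfolding poly_subst3_lin k dot3_scale dual by simp_all
  define sh where "sh = (\<lambda>g :: complex poly. pcompose g [:\<alpha>, 1:])"
  have sh: "poly (sh g) t = poly g (\<alpha> + t)" for g t by (simp add: sh_def poly_pcompose)
  have shnz: "sh g \<noteq> 0" if "g \<noteq> 0" for g unfolding sh_def using that by (simp add: pcompose_eq_0_iff)
  have "a0 \<noteq> 0" using at(1) kn poly_0 by metis
  then obtain r0 where r0: "r0 > 0" "\<And>t. t \<noteq> 0 \<Longrightarrow> norm t < r0 \<Longrightarrow> poly (sh a0) t \<noteq> 0"
    using poly_nonzero_near[OF shnz] by blast
  have nz0: "poly (sh a0) t \<noteq> 0" if "norm t < r0" for t
    using r0(2)[OF _ that] at(1) kn by (cases "t = 0") (auto simp: sh simp del: poly_subst3)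
  define X' where "X' = (\<lambda>t. poly (sh a1) t / poly (sh a0) t)"
  define Y' where "Y' = (\<lambda>t. poly (sh a2) t / poly (sh a0) t)"
  have hol: "X' holomorphic_on ball 0 r0" "Y' holomorphic_on ball 0 r0"
    unfolding X'_def Y'_def using nz0 by (auto intro!: holomorphic_intros)
  have z: "X' 0 = 0" "Y' 0 = 0" unfolding X'_def Y'_def sh using at by (simp_all del: poly_subst3)
  \<comment> \<open>For \<open>\<tau> \<noteq> 0\<close> below this bound \<open>1 / \<tau>\<close>
    has norm greater than \<open>norm \<alpha> + 1\<close>, hence differs from
    \<open>\<alpha> + t\<close> when \<open>norm t < 1\<close>.\<close>
  define \<epsilon> where "\<epsilon> = min s (1 / (norm \<alpha> + 1))"
  have "norm \<alpha> + 1 > 0" by (simp add: add_nonneg_pos)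
  then have "\<epsilon> > 0" using s(1) by (simp add: \<epsilon>_def)
  from curve_eventually[OF hol r0(1) z zeros_on_branch[OF this]]
  obtain r1 where r1: "r1 > 0" "\<And>t. norm t < r1 \<Longrightarrow> local_equation F p (X' t, Y' t) = 0 \<Longrightarrow>
      \<exists>\<tau>. norm \<tau> < \<epsilon> \<and> (X' t, Y' t) = (X \<tau>, Y \<tau>)" unfolding eventually_nhds_0_norm by blast
  have "a1 * subst3 Q v \<noteq> 0" using a1_nz vQ by simp
  then obtain r2 where r2: "r2 > 0" "\<And>t. t \<noteq> 0 \<Longrightarrow> norm t < r2 \<Longrightarrow> poly (sh (a1 * subst3 Q v)) t \<noteq> 0"
    using poly_nonzero_near[OF shnz] by blast
  \<comment> \<open>A small nonzero \<open>t\<close> off the zeros of \<open>a1\<close> and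
    \<open>v\<close>: the first forces \<open>\<tau> \<noteq> 0\<close>, the second lets the point
    determine the parameter.\<close>
  define t :: complex where "t = of_real (min (min r0 r1) (min r2 1) / 2)"
  have t: "t \<noteq> 0" "norm t < r0" "norm t < r1" "norm t < r2" "norm t < 1"
    using r0(1) r1(1) r2(1) by (auto simp: t_def)
  have n0: "poly a0 (\<alpha> + t) \<noteq> 0" using nz0[OF t(2)] unfolding sh .
  have zz: "(poly a1 (\<alpha> + t) / poly a0 (\<alpha> + t), poly a2 (\<alpha> + t) / poly a0 (\<alpha> + t)) = (X' t, Y' t)"
    by (simp only: X'_def Y'_def sh)
  have "poly a0 (\<alpha> + t) ^ d * local_equation F p (X' t, Y' t) = 0"
    using eval3_chart[OF homF n0] F_pev[of "\<alpha> + t"] unfolding zz by simp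
  then have "local_equation F p (X' t, Y' t) = 0" using n0 by (metis mult_eq_0_iff power_not_zero)
  then obtain \<tau> where \<tau>: "norm \<tau> < \<epsilon>" "(X' t, Y' t) = (X \<tau>, Y \<tau>)" using r1(2)[OF t(3)] by blast
  have n1: "poly a1 (\<alpha> + t) \<noteq> 0" "poly (subst3 Q v) (\<alpha> + t) \<noteq> 0"
    using r2(2)[OF t(1,4)] unfolding sh poly_mult by (metis mult_zero_left, metis mult_zero_right)
  have "X' t \<noteq> 0" unfolding X'_def sh using n0 n1(1) by (simp del: poly_subst3)
  then have \<tau>0: "\<tau> \<noteq> 0" using \<tau>(2) X0 by auto
  have \<tau>s: "norm \<tau> < s" using \<tau>(1) by (simp add: \<epsilon>_def)
  note A = parameter_from_point[OF n0 zz[unfolded \<tau>(2)]]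
  note B = parameter_from_point[OF near_infinity(1)[OF \<tau>s \<tau>0] near_infinity(2)[OF \<tau>s \<tau>0]]
  have "local_equation v p (X \<tau>, Y \<tau>) \<noteq> 0" using A(2) n1(2) by simp
  then have "\<alpha> + t = 1 / \<tau>" using A(1) B(1) by (metis mult_right_cancel)
  then have "norm (1 / \<tau>) \<le> norm \<alpha> + norm t" using norm_triangle_ineq[of \<alpha> t] by simp
  then have "1 / norm \<tau> < norm \<alpha> + 1" using t(5) by (simp add: norm_divide)
  then have "1 < (norm \<alpha> + 1) * norm \<tau>" using \<tau>0 by (simp add: divide_less_eq)
  moreover have "norm \<tau> * (norm \<alpha> + 1) < 1"
    using \<tau>(1) \<open>norm \<alpha> + 1 > 0\<close> by (simp add: \<epsilon>_def less_divide_eq)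
  ultimately show False by (simp add: mult.commute)
qed

lemma e_eq_d: "e = d"
  by (rule degree_eq[OF pev_not_singular d2])

definition ord_at_cusp :: "fun2 \<Rightarrow> nat \<Rightarrow> bool" where
  "ord_at_cusp h n \<longleftrightarrow> (\<exists>c. c \<noteq> 0 \<and> lc (\<lambda>t. h (X t, Y t)) n c)"

text \<open>Multiplicities are orders along the branch, and a germ has no finite order exactly when
  it vanishes on the branch, hence at all zeros of the local equation near the cusp.\<close>

lemma semigroup_eq: "semigroup_of_germ F p = {n. \<exists>h\<in>holo_germs. ord_at_cusp h n}"
proof (intro equalityI subsetI)
  fix n assume "n \<in> semigroup_of_germ F p"
  then obtain h where h: "h \<in> holo_germs" "\<not> vanishes_on_germ (local_equation F p) h"
    "intersection_mult (local_equation F p) h = enat n" unfolding semigroup_of_germ_def by blast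
  obtain r where r: "r > 0" "r \<le> s" "(\<lambda>t. h (X t, Y t)) holomorphic_on ball 0 r"
    using curve_holomorphic[OF h(1) X_hol Y_hol s(1) X0 Y0] by blast
  from lc_exists[OF r(3,1)] have "\<exists>n c. c \<noteq> 0 \<and> lc (\<lambda>t. h (X t, Y t)) n c"
  proof
    assume "\<forall>\<^sub>F t in nhds 0. h (X t, Y t) = 0"
    then obtain \<epsilon> where e: "\<epsilon> > 0" "\<And>t. norm t < \<epsilon> \<Longrightarrow> h (X t, Y t) = 0"
      unfolding eventually_nhds_0_norm by blast
    have "vanishes_on_germ (local_equation F p) h"
      unfolding vanishes_on_germ_def using zeros_on_branch[OF e(1)] by eventually_elim (use e(2) in auto)
    then show ?thesis using h(2) by blast
  qed
  then obtain k c where k: "c \<noteq> 0" "lc (\<lambda>t. h (X t, Y t)) k c" by blast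
  then have "enat n = enat k" using branch.intersection_mult_eq_order(1)[OF h(1) k(2,1)] h(3) by simp
  then show "n \<in> {n. \<exists>h\<in>holo_germs. ord_at_cusp h n}" unfolding ord_at_cusp_def using h(1) k by auto
next
  fix n assume "n \<in> {n. \<exists>h\<in>holo_germs. ord_at_cusp h n}"
  then obtain h c where h: "h \<in> holo_germs" "c \<noteq> 0" "lc (\<lambda>t. h (X t, Y t)) n c"
    unfolding ord_at_cusp_def by blast
  have "\<not> vanishes_on_germ (local_equation F p) h"
  proof
    assume "vanishes_on_germ (local_equation F p) h"
    then have "\<forall>\<^sub>F t in nhds 0. local_equation F p (X t, Y t) = 0 \<longrightarrow> h (X t, Y t) = 0"
      unfolding vanishes_on_germ_def by (rule curve_eventually[OF X_hol Y_hol s(1) X0 Y0])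
    then have "\<forall>\<^sub>F t in nhds 0. h (X t, Y t) = 0" using F_on_branch by eventually_elim blast
    from lc_cong[OF h(3) this] have "c = 0" by (rule lc_unique[OF _ lc_zero])
    then show False using h(2) by blast
  qed
  then show "n \<in> semigroup_of_germ F p"
    unfolding semigroup_of_germ_def using h(1) branch.intersection_mult_eq_order(1)[OF h(1,3,2)] by blast
qed

lemma semigroup_zero: "0 \<in> semigroup_of_germ F p"
proof -
  have "ord_at_cusp (\<lambda>z. 1) 0" unfolding ord_at_cusp_def using lc_const[of 1] by (intro exI[of _ 1]) simp
  then show ?thesis unfolding semigroup_eq using holo_germs_const[of 1] by (intro CollectI bexI)
qed

lemma semigroup_add:
  assumes "a \<in> semigroup_of_germ F p" "b \<in> semigroup_of_germ F p"
  shows "a + b \<in> semigroup_of_germ F p"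
proof -
  obtain g c where g: "g \<in> holo_germs" "c \<noteq> 0" "lc (\<lambda>t. g (X t, Y t)) a c"
    using assms(1) unfolding semigroup_eq ord_at_cusp_def by blast
  obtain h c' where h: "h \<in> holo_germs" "c' \<noteq> 0" "lc (\<lambda>t. h (X t, Y t)) b c'"
    using assms(2) unfolding semigroup_eq ord_at_cusp_def by blast
  have "c * c' \<noteq> 0 \<and> lc (\<lambda>t. g (X t, Y t) * h (X t, Y t)) (a + b) (c * c')"
    using lc_mult[OF g(3) h(3)] g(2) h(2) by simp
  then have "ord_at_cusp (\<lambda>z. g z * h z) (a + b)" unfolding ord_at_cusp_def by blast
  then show ?thesis
    unfolding semigroup_eq using holo_germs_mult[OF g(1) h(1)]
    by (intro CollectI bexI[where x = "\<lambda>z. g z * h z"])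
qed

lemma curve_mult:
  assumes "homogeneous l h" "subst3 Q h \<noteq> 0"
  shows "curve_intersection_mult p F h = enat (l * d - degree (subst3 Q h))"
proof -
  obtain c where "c \<noteq> 0" "lc (\<lambda>t. local_equation h p (X t, Y t)) (l * e - degree (subst3 Q h)) c"
    using local_equation_lc[OF assms] by blast
  then show ?thesis
    unfolding curve_intersection_mult_def
    using branch.intersection_mult_eq_order(1)[OF local_equation_holo[OF assms(1)]] e_eq_d by blast
qed

text \<open>In the chart \<open>lin w0\<close> is 1 and \<open>lin w1\<close>, \<open>lin w2\<close>
  are the coordinates. Each step splits off the constant term of \<open>h\<close>, approximates the
  two cofactors by forms of degree one less, and gains one order because \<open>X\<close> and
  \<open>Y\<close> vanish at \<open>0\<close>.\<close>

lemma approximation: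
  assumes "h \<in> holo_germs" "l \<ge> N"
  shows "\<exists>H a. homogeneous l H \<and> lc (\<lambda>t. h (X t, Y t) - local_equation H p (X t, Y t)) N a"
  using assms
proof (induction N arbitrary: h l)
  case 0
  obtain r where r: "r > 0" "r \<le> s" "(\<lambda>t. h (X t, Y t)) holomorphic_on ball 0 r"
    using curve_holomorphic[OF 0(1) X_hol Y_hol s(1) X0 Y0] by blast
  have "lc (\<lambda>t. h (X t, Y t)) 0 (h (X 0, Y 0))"
    using lcI[OF r(1,3), of "\<lambda>t. h (X t, Y t)" 0] by simp
  then show ?case by (intro exI[of _ 0] exI[of _ "h (X 0, Y 0)"]) (simp add: local_equation_def)
next
  case (Suc N)
  obtain j where j: "l = Suc j" "j \<ge> N" using Suc.prems(2) by (cases l) auto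
  obtain c A B where AB: "A \<in> holo_germs" "B \<in> holo_germs"
    "\<forall>\<^sub>F z in nhds 0. h z = c + fst z * A z + snd z * B z"
    using germ_decomposition[OF Suc.prems(1)] by blast
  obtain HA a where HA: "homogeneous j HA" "lc (\<lambda>t. A (X t, Y t) - local_equation HA p (X t, Y t)) N a"
    using Suc.IH[OF AB(1) j(2)] by blast
  obtain HB b where HB: "homogeneous j HB" "lc (\<lambda>t. B (X t, Y t) - local_equation HB p (X t, Y t)) N b"
    using Suc.IH[OF AB(2) j(2)] by blast
  define H where "H = scal c * lin w0 ^ l + lin w1 * HA + lin w2 * HB"
  have pw: "homogeneous l (lin w0 ^ l)" using homogeneous_power[OF homogeneous_lin, of l w0] by simp
  have "homogeneous l (lin w1 * HA)" "homogeneous l (lin w2 * HB)"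
    using homogeneous_mult[OF homogeneous_lin HA(1)] homogeneous_mult[OF homogeneous_lin HB(1)] j(1) by simp_all
  then have H: "homogeneous l H" unfolding H_def using pw by (intro homogeneous_add homogeneous_scal_mult)
  have locH: "local_equation H p z = c + fst z * local_equation HA p z + snd z * local_equation HB p z" for z
    unfolding H_def local_equation_add local_equation_mult local_equation_power local_equation_scal
      local_equation_lin dual by simp
  have lX: "\<exists>a. lc X 1 a" using lcI[OF s(1) X_hol, of X 0] X0 lc_Suc[of X 0] by simp
  have lY: "\<exists>a. lc Y 1 a" using lcI[OF s(1) Y_hol, of Y 0] Y0 lc_Suc[of Y 0] by simp
  obtain ax ay where xy: "lc X 1 ax" "lc Y 1 ay" using lX lY by blast
  let ?D = "\<lambda>t. X t * (A (X t, Y t) - local_equation HA p (X t, Y t)) + Y t * (B (X t, Y t) - local_equation HB p (X t, Y t))"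
  have "lc ?D (1 + N) (ax * a + ay * b)"
    by (intro lc_add lc_mult xy HA(2) HB(2))
  moreover have "\<forall>\<^sub>F t in nhds 0. ?D t = h (X t, Y t) - local_equation H p (X t, Y t)"
    using curve_eventually[OF X_hol Y_hol s(1) X0 Y0 AB(3)]
    by eventually_elim (simp add: locH algebra_simps)
  ultimately have "lc (\<lambda>t. h (X t, Y t) - local_equation H p (X t, Y t)) (1 + N) (ax * a + ay * b)"
    by (rule lc_cong)
  then show ?case using H by auto
qed

text \<open>By \<open>local_equation_lc\<close> and \<open>e = d\<close> the order at the cusp is
  the defect of the degree of the restriction from \<open>l * d\<close>.\<close>

definition S :: "nat \<Rightarrow> nat set" where
  "S l = (\<lambda>\<delta>. l * d - \<delta>) ` degs (W l)"

lemma S_iff: "n \<in> S l \<longleftrightarrow> (\<exists>h. homogeneous l h \<and> subst3 Q h \<noteq> 0 \<and> n = l * d - degree (subst3 Q h))"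
  unfolding S_def degs_def W_def by blast

lemma card_S: "card (S l) = card (degs (W l))"
  unfolding S_def
proof (rule card_image, rule inj_onI)
  fix x y assume xy: "x \<in> degs (W l)" "y \<in> degs (W l)" and e: "l * d - x = l * d - y"
  have "x \<le> l * d" "y \<le> l * d" using xy degs_W_subset[of l] unfolding e_eq_d by auto
  then show "x = y" using e by (metis diff_diff_cancel)
qed

lemma S_subset: "S l \<subseteq> semigroup_of_germ F p \<inter> {0..l * d}"
proof
  fix n assume "n \<in> S l"
  then obtain h where h: "homogeneous l h" "subst3 Q h \<noteq> 0" "n = l * d - degree (subst3 Q h)"
    unfolding S_iff by blast
  have "ord_at_cusp (local_equation h p) n"
    unfolding ord_at_cusp_def using local_equation_lc[OF h(1,2)] h(3) e_eq_d by simp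
  then have "n \<in> semigroup_of_germ F p" unfolding semigroup_eq using local_equation_holo[OF h(1)] by blast
  then show "n \<in> semigroup_of_germ F p \<inter> {0..l * d}" using h(3) by simp
qed

text \<open>An order \<open>n >= C\<close> is realized by the monomial \<open>t^(l * d - n)\<close>,
  which is the restriction of a form by \<open>W_cofinite\<close>. The finitely many smaller orders
  come from germs approximated by a form beyond order \<open>n\<close>.\<close>

lemma S_stable: "\<exists>l0. \<forall>l\<ge>l0. S l = semigroup_of_germ F p \<inter> {0..l * d}"
proof -
  obtain C l1 where C: "\<And>l f. l \<ge> l1 \<Longrightarrow> degree f + C \<le> l * e \<Longrightarrow> f \<in> W l"
    using W_cofinite[OF pev_not_singular d2] by blast
  have "semigroup_of_germ F p \<inter> {0..l * d} \<subseteq> S l" if l: "l \<ge> max l1 C" for l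
  proof
    fix n assume n: "n \<in> semigroup_of_germ F p \<inter> {0..l * d}"
    show "n \<in> S l"
    proof (cases "n \<ge> C")
      case True
      have "degree (monom (1 :: complex) (l * d - n)) + C \<le> l * e"
        using True n e_eq_d by (simp add: degree_monom_eq)
      then have "monom 1 (l * d - n) \<in> W l" using l by (intro C) auto
      moreover have "monom 1 (l * d - n) \<noteq> (0 :: complex poly)" by (simp add: monom_eq_0_iff)
      ultimately have "l * d - n \<in> degs (W l)" unfolding degs_def
        by (intro image_eqI[of _ _ "monom 1 (l * d - n)"]) (auto simp: degree_monom_eq)
      moreover have "n = l * d - (l * d - n)" using n by simp
      ultimately show ?thesis unfolding S_def by blast
    next
      case False
      then have ln: "l \<ge> Suc n" using l by simp
      obtain h c where h: "h \<in> holo_germs" "c \<noteq> 0" "lc (\<lambda>t. h (X t, Y t)) n c"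
        using n unfolding semigroup_eq ord_at_cusp_def by blast
      obtain H a where H: "homogeneous l H" "lc (\<lambda>t. h (X t, Y t) - local_equation H p (X t, Y t)) (Suc n) a"
        using approximation[OF h(1) ln] by blast
      have "lc (\<lambda>t. h (X t, Y t) - local_equation H p (X t, Y t)) n 0" by (rule lc_lower[OF H(2) lessI])
      from lc_sub[OF h(3) this, of 1]
      have lH: "lc (\<lambda>t. local_equation H p (X t, Y t)) n c" by simp
      have nz: "subst3 Q H \<noteq> 0"
      proof
        assume "subst3 Q H = 0"
        then obtain G where G: "H = F * G" using kernel[OF H(1)] by (auto elim: dvdE)
        have "\<forall>\<^sub>F t in nhds 0. local_equation H p (X t, Y t) = 0"
          using F_on_branch by eventually_elim (simp add: G local_equation_mult)
        from lc_cong[OF lH this] have "c = 0" by (rule lc_unique[OF _ lc_zero])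
        then show False using h(2) by blast
      qed
      obtain c' where c': "c' \<noteq> 0" "lc (\<lambda>t. local_equation H p (X t, Y t)) (l * e - degree (subst3 Q H)) c'"
        using local_equation_lc[OF H(1) nz] by blast
      have "n = l * e - degree (subst3 Q H)" by (rule lc_order_unique[OF lH c'(2) h(2) c'(1)])
      then show ?thesis unfolding S_iff using H(1) nz e_eq_d by blast
    qed
  qed
  then show ?thesis using S_subset by blast
qed

theorem distribution_iff:
  "(\<forall>l::nat. l > 0 \<longrightarrow> card (semigroup_of_germ F p \<inter> {(l - 1) * d<..l * d}) = min (l + 1) d) \<longleftrightarrow>
   (\<forall>l::nat. l + 3 \<le> d \<longrightarrow> (\<forall>n \<in> semigroup_of_germ F p \<inter> {0..l * d}.
       \<exists>h. h \<noteq> 0 \<and> homogeneous l h \<and> curve_intersection_mult p F h = enat n))"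
proof -
  obtain l0 where l0: "\<And>l. l \<ge> l0 \<Longrightarrow> S l = semigroup_of_germ F p \<inter> {0..l * d}" using S_stable by blast
  have stable: "2 * card (semigroup_of_germ F p \<inter> {0..l * d}) + (d - 1) * (d - 2) = 2 * (l * d + 1)"
    if "l \<ge> max l0 d" for l
    using l0[of l] card_S[of l] card_degs_W_large[of l] d2 that by simp
  have cS: "2 * card (S l) = (l + 1) * (l + 2)" if "l < d" for l
    using card_degs_W_small[OF that] card_S by simp
  \<comment> \<open>Below degree \<open>d\<close> no nonzero form vanishes on the curve, so every
    nonzero form has a finite order and realizability means membership in
    \<open>S l\<close>.\<close>
  have realized: "(\<exists>h. h \<noteq> 0 \<and> homogeneous l h \<and> curve_intersection_mult p F h = enat n) \<longleftrightarrow> n \<in> S l"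
    if "l < d" for l n
  proof
    assume "\<exists>h. h \<noteq> 0 \<and> homogeneous l h \<and> curve_intersection_mult p F h = enat n"
    then obtain h where h: "h \<noteq> 0" "homogeneous l h" "curve_intersection_mult p F h = enat n" by blast
    have nz: "subst3 Q h \<noteq> 0" using kernel[OF h(2)] homogeneous_dvd_degree_le[OF homF h(2,1)] that by auto
    show "n \<in> S l" unfolding S_iff using curve_mult[OF h(2) nz] h(2,3) nz by auto
  next
    assume "n \<in> S l"
    then obtain h where h: "homogeneous l h" "subst3 Q h \<noteq> 0" "n = l * d - degree (subst3 Q h)"
      unfolding S_iff by blast
    then have "h \<noteq> 0" by auto
    then show "\<exists>h. h \<noteq> 0 \<and> homogeneous l h \<and> curve_intersection_mult p F h = enat n"
      using h curve_mult[OF h(1,2)] by blast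
  qed
  have "(\<forall>l::nat. l > 0 \<longrightarrow> card (semigroup_of_germ F p \<inter> {(l - 1) * d<..l * d}) = min (l + 1) d) \<longleftrightarrow>
      (\<forall>l::nat. l + 3 \<le> d \<longrightarrow> semigroup_of_germ F p \<inter> {0..l * d} \<subseteq> S l)"
    by (rule semigroup_distribution_iff[OF d2 semigroup_zero semigroup_add S_subset cS stable])
  also have "\<dots> \<longleftrightarrow> (\<forall>l::nat. l + 3 \<le> d \<longrightarrow> (\<forall>n \<in> semigroup_of_germ F p \<inter> {0..l * d}.
       \<exists>h. h \<noteq> 0 \<and> homogeneous l h \<and> curve_intersection_mult p F h = enat n))"
  proof -
    have eq: "(semigroup_of_germ F p \<inter> {0..l * d} \<subseteq> S l) \<longleftrightarrow> (\<forall>n \<in> semigroup_of_germ F p \<inter> {0..l * d}.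
       \<exists>h. h \<noteq> 0 \<and> homogeneous l h \<and> curve_intersection_mult p F h = enat n)" if l: "l + 3 \<le> d" for l
    proof -
      have "l < d" using l by simp
      show ?thesis unfolding realized[OF \<open>l < d\<close>] by (rule subset_eq)
    qed
    show ?thesis by (rule iff_allI, rule imp_cong[OF refl], rule eq)
  qed
  finally show ?thesis .
qed

end

theorem theorem6p8:
  fixes F :: poly3 and d :: nat and p :: "complex^3"
  assumes "unicuspidal_rational_curve F d p"
  shows "(\<forall>l::nat. l > 0 \<longrightarrow>
            card (semigroup_of_germ F p \<inter> {(l - 1) * d<..l * d}) = min (l + 1) d)
     \<longleftrightarrow>
         (\<forall>l::nat. l + 3 \<le> d \<longrightarrow>
            (\<forall>s \<in> semigroup_of_germ F p \<inter> {0..l * d}.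
               \<exists>h. h \<noteq> 0 \<and> homogeneous l h \<and> curve_intersection_mult p F h = enat s))"
proof -
  have F: "homogeneous d F" "irreducible F" "rational_curve F" and sing: "singular_point F p"
    and uniq: "\<And>q. singular_point F q \<Longrightarrow> \<exists>\<mu>. q = \<mu> *s p" and irr: "germ_irreducible (local_equation F p)"
    using assms unfolding unicuspidal_rational_curve_def by blast+
  have p: "p \<noteq> 0" "eval3 F p = 0" using sing by (auto simp: singular_point_def)
  have F0: "F \<noteq> 0" using F(2) by auto
  obtain Q e u v m \<mu> where r: "reduced_parametrization F d Q e u v m" and top: "top_coeffs Q e = \<mu> *s p"
    using normal_parametrization_exists[OF F p] by blast
  obtain q e1 e2 w0 w1 w2 \<nu> where fr: "frame q e1 e2 w0 w1 w2" "p = \<nu> *s q" "\<nu> \<noteq> 0"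
    and chart: "\<And>x y. affine_chart p (x, y) = q + x *s e1 + y *s e2"
    using affine_chart_frame[OF p(1)] by blast
  have Fq: "eval3 F q = 0"
    using p(2) eval3_homogeneous_scale[OF F(1), of \<nu> q] fr(2,3) by simp
  \<comment> \<open>The point at infinity is \<open>\<mu>\<close> times \<open>p\<close>, and
    \<open>p\<close> is \<open>\<nu>\<close> times \<open>q\<close>, whence the product of
    scalars.\<close>
  interpret unicuspidal_parametrization F d Q e u v m p q e1 e2 w0 w1 w2 "\<mu> * \<nu>" \<nu>
  proof (intro unicuspidal_parametrization.intro r unicuspidal_parametrization_axioms.intro)
    show "top_coeffs Q e = (\<mu> * \<nu>) *s q" unfolding top by (subst fr(2)) (simp add: vector_smult_assoc)
    show "d \<ge> 2" by (rule homogeneous_singular_degree_ge_2[OF F(1) F0 sing])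
  qed (use fr(1,2) chart Fq irr uniq in blast)+
  show ?thesis by (rule distribution_iff)
qed

end
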